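(* Let $p\ge3$. The prism $\mathcal{W}_{p,1}\times I$ over the wedge product $\mathcal{W}_{p,1}=C_p\triangleleft\Delta_1$ has a realization in $\mathbb{R}^{3+p}$ (a polytope combinatorially equivalent to $\mathcal{W}_{p,1}\times I$) such that the prism $\Sigma_{p,4}\times I$ over the surface survives the projection to $\mathbb{R}^4$, respectively $\mathbb{R}^3$: all faces of $\Sigma_{p,4}\times I$ are preserved by a coordinate projection to $\mathbb{R}^4$, and a further coordinate projection to $\mathbb{R}^3$ maps their images to an embedded polyhedral complex in $\mathbb{R}^3$ combinatorially isomorphic to $\Sigma_{p,4}\times I$. Furthermore, the dual of the projected $4$-polytope contains the dual surface $\Sigma_{p,4}^*$ as a subcomplex of its boundary complex; thus, by constructing a Schlegel diagram, one obtains a realization of $\Sigma_{p,4}^*$ in $\mathbb{R}^3$ (as an embedded polyhedral surface with planar convex faces).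
   Context: Notation: $[n]=\{0,1,\dots,n-1\}$, $I=[0,1]$. Let $C_p=\{x\in\mathbb{R}^2 : a_ix\le1,\ i\in[p]\}$ be a convex $p$-gon with its $p$ edges labeled in cyclic order, and $\Delta_1=\{y\in\mathbb{R} : b_jy\le1,\ j\in[2]\}$ an interval (both given by their facet inequalities). The wedge product is the simple polytope $$\mathcal{W}_{p,1}=C_p\triangleleft\Delta_1=\{(x,y_0,\dots,y_{p-1})\in\mathbb{R}^{2+p} : a_ix+b_jy_i\le1\ \text{for all } i\in[p],\ j\in[2]\},$$ with facet hyperplanes $h_{i,j}: a_ix+b_jy_i=1$. A face $G$ is denoted by the vector $(H_0,\dots,H_{p-1})$, $H_i\subseteq[2]$, where $j\in H_i\iff G\subset h_{i,j}$. $\Sigma_{p,4}$ is the polytopal subcomplex of the boundary of $\mathcal{W}_{p,1}$ consisting of all faces $(\{j_0\},\dots,\{j_{p-1}\})$ with $j_k\in[2]$ (all of these are $p$-gons), together with all their edges and vertices. It is a closed connected orientable $2$-manifold composed of $p$-gons with all vertices of degree $4$. The dual surface $\Sigma_{p,4}^*$ is the (abstract) polyhedral surface whose face poset is the opposite of the face poset of $\Sigma_{p,4}$. The prism over a polyhedral complex $\Sigma$ is $\Sigma\times I$ with the product cell structure (where $I$ has two vertices and one edge). $\Sigma_{p,4}\times I$ is a subcomplex of the boundary complex of $\mathcal{W}_{p,1}\times I$, and in any polytope combinatorially equivalent to $\mathcal{W}_{p,1}\times I$ one considers the corresponding faces. Preserved faces: let $P\subset\mathbb{R}^d$ be a polytope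 and $\pi:\mathbb{R}^d\to\mathbb{R}^k$ an affine projection. A non-empty face $F$ of $P$ is preserved by $\pi$ if (D1) $\pi(F)$ is a face of $\pi(P)$, (D2) $\pi(F)$ is combinatorially equivalent to $F$, and (D3) $\pi^{-1}(\pi(F))\cap P=F$. *)

theory Defs
  imports "HOL-Analysis.Analysis"
begin

section \<open>Face posets and polytopal complexes\<close>

definition poset_iso ::
  "'a set \<Rightarrow> ('a \<Rightarrow> 'a \<Rightarrow> bool) \<Rightarrow> 'b set \<Rightarrow> ('b \<Rightarrow> 'b \<Rightarrow> bool) \<Rightarrow> ('a \<Rightarrow> 'b) \<Rightarrow> bool" where
  "poset_iso A leA B leB f \<longleftrightarrow>
     bij_betw f A B \<and> (\<forall>x\<in>A. \<forall>y\<in>A. leA x y \<longleftrightarrow> leB (f x) (f y))"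

text \<open>All faces, including the empty face and the polytope itself.\<close>
definition faces :: "'a::real_vector set \<Rightarrow> 'a set set" where
  "faces P = {F. F face_of P}"

definition face_lattice_iso ::
  "'a::real_vector set \<Rightarrow> 'b::real_vector set \<Rightarrow> ('a set \<Rightarrow> 'b set) \<Rightarrow> bool" where
  "face_lattice_iso P Q \<phi> \<longleftrightarrow> poset_iso (faces P) (\<subseteq>) (faces Q) (\<subseteq>) \<phi>"

definition comb_equivalent :: "'a::real_vector set \<Rightarrow> 'b::real_vector set \<Rightarrow> bool" where
  "comb_equivalent P Q \<longleftrightarrow> (\<exists>\<phi>. face_lattice_iso P Q \<phi>)"

text \<open>The dual of a polytope is meant up to combinatorial equivalence: any polytope whose
  face lattice is anti-isomorphic to the given one (for instance a polar polytope).\<close>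
definition dual_polytope :: "'a::real_vector set \<Rightarrow> 'b::real_vector set \<Rightarrow> bool" where
  "dual_polytope P D \<longleftrightarrow>
     polytope D \<and> (\<exists>\<psi>. poset_iso (faces P) (\<subseteq>) (faces D) (\<supseteq>) \<psi>)"

text \<open>As with \<open>simplicial_complex\<close> in the library, a nonempty complex contains the empty face.\<close>
definition polytopal_complex :: "'a::real_vector set set \<Rightarrow> bool" where
  "polytopal_complex K \<longleftrightarrow>
     finite K \<and>
     (\<forall>F\<in>K. polytope F) \<and>
     (\<forall>F\<in>K. \<forall>G. G face_of F \<longrightarrow> G \<in> K) \<and>
     (\<forall>F\<in>K. \<forall>G\<in>K. (F \<inter> G) face_of F \<and> (F \<inter> G) face_of G)"

definition boundary_complex :: "'a::real_vector set \<Rightarrow> 'a set set" where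
  "boundary_complex P = {F. F face_of P \<and> F \<noteq> P}"

definition subcomplex_of :: "'a::real_vector set set \<Rightarrow> 'a set set \<Rightarrow> bool" where
  "subcomplex_of L K \<longleftrightarrow> L \<subseteq> K \<and> (\<forall>F\<in>L. \<forall>G. G face_of F \<longrightarrow> G \<in> L)"

text \<open>The abstract dual of a complex \<open>C\<close> has the nonempty faces of \<open>C\<close>, ordered by reverse
  inclusion, as its nonempty faces.\<close>
definition has_dual_face_poset :: "'a set set \<Rightarrow> 'b set set \<Rightarrow> bool" where
  "has_dual_face_poset C K \<longleftrightarrow> (\<exists>\<theta>. poset_iso (C - {{}}) (\<supseteq>) (K - {{}}) (\<subseteq>) \<theta>)"

definition pure_2_dimensional :: "'a::euclidean_space set set \<Rightarrow> bool" where
  "pure_2_dimensional K \<longleftrightarrow> (\<forall>F\<in>K. \<exists>G\<in>K. F \<subseteq> G \<and> aff_dim G = 2)"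

definition prism :: "'a set set \<Rightarrow> ('a \<times> real) set set" where
  "prism K = {F \<times> J | F J. F \<in> K \<and> J face_of {0..1}}"


section \<open>The wedge product of a polygon and an interval\<close>

definition ineq_polyhedron :: "('i \<Rightarrow> 'a::euclidean_space) \<Rightarrow> 'a set" where
  "ineq_polyhedron a = {x. \<forall>i. a i \<bullet> x \<le> 1}"

definition ineq_facet :: "('i \<Rightarrow> 'a::euclidean_space) \<Rightarrow> 'i \<Rightarrow> 'a set" where
  "ineq_facet a i = {x \<in> ineq_polyhedron a. a i \<bullet> x = 1}"

text \<open>The inequalities \<open>a i \<bullet> x \<le> 1\<close> are the facet inequalities of a polytope: every one of
  them defines a facet, and different indices give different facets.\<close>
definition facet_description :: "('i \<Rightarrow> 'a::euclidean_space) \<Rightarrow> bool" where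
  "facet_description a \<longleftrightarrow>
     polytope (ineq_polyhedron a) \<and>
     (\<forall>i. ineq_facet a i facet_of ineq_polyhedron a) \<and>
     inj (ineq_facet a)"

text \<open>The label set \<open>{0,\<dots>,p-1}\<close> is represented by a finite type \<open>'p\<close> with an enumeration
  \<open>e 0, \<dots>, e (p-1)\<close>; cyclic order means that consecutive edges share a vertex.\<close>
definition cyclically_labeled :: "('p::finite \<Rightarrow> real^2) \<Rightarrow> (nat \<Rightarrow> 'p) \<Rightarrow> bool" where
  "cyclically_labeled a e \<longleftrightarrow>
     bij_betw e {..<CARD('p)} UNIV \<and>
     (\<forall>k<CARD('p). ineq_facet a (e k) \<inter> ineq_facet a (e (Suc k mod CARD('p))) \<noteq> {})"

definition wedge_product ::
  "('p::finite \<Rightarrow> real^2) \<Rightarrow> (2 \<Rightarrow> real) \<Rightarrow> ((real^2) \<times> (real^'p)) set" where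
  "wedge_product a b = {(x, y). \<forall>i j. a i \<bullet> x + b j * y $ i \<le> 1}"

definition wedge_hyperplane ::
  "('p::finite \<Rightarrow> real^2) \<Rightarrow> (2 \<Rightarrow> real) \<Rightarrow> 'p \<Rightarrow> 2 \<Rightarrow> ((real^2) \<times> (real^'p)) set" where
  "wedge_hyperplane a b i j = {(x, y). a i \<bullet> x + b j * y $ i = 1}"

text \<open>The vector \<open>(H\<^sub>0, \<dots>, H\<^sub>p\<^sub>-\<^sub>1)\<close> denoting a face.\<close>
definition facet_vector ::
  "('p::finite \<Rightarrow> real^2) \<Rightarrow> (2 \<Rightarrow> real) \<Rightarrow> ((real^2) \<times> (real^'p)) set \<Rightarrow> 'p \<Rightarrow> 2 set" where
  "facet_vector a b G i = {j. G \<subseteq> wedge_hyperplane a b i j}"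

text \<open>The surface: the faces denoted by vectors of singletons, and all their faces
  (edges, vertices, and the empty face).\<close>
definition wedge_surface ::
  "('p::finite \<Rightarrow> real^2) \<Rightarrow> (2 \<Rightarrow> real) \<Rightarrow> ((real^2) \<times> (real^'p)) set set" where
  "wedge_surface a b =
     {F. \<exists>G j. G face_of wedge_product a b \<and>
               (\<forall>i. facet_vector a b G i = {j i}) \<and> F face_of G}"


section \<open>Projections and Schlegel diagrams\<close>

text \<open>For injective \<open>f\<close> this is the projection to the coordinates selected by \<open>f\<close>.\<close>
definition coord_proj :: "('k \<Rightarrow> 'n) \<Rightarrow> real^'n \<Rightarrow> real^'k" where
  "coord_proj f x = (\<chi> k. x $ f k)"

definition preserved ::
  "('a::real_vector \<Rightarrow> 'b::real_vector) \<Rightarrow> 'a set \<Rightarrow> 'a set \<Rightarrow> bool" where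
  "preserved \<pi> P F \<longleftrightarrow>
     F face_of P \<and> F \<noteq> {} \<and>
     (\<pi> ` F) face_of (\<pi> ` P) \<and>
     comb_equivalent (\<pi> ` F) F \<and>
     \<pi> -` (\<pi> ` F) \<inter> P = F"

text \<open>The point \<open>z\<close> lies beyond the facet \<open>G\<close> of the full-dimensional polytope \<open>D\<close>: it violates
  the inequality of \<open>G\<close> and strictly satisfies those of all other facets.\<close>
definition beyond_facet :: "'a::euclidean_space set \<Rightarrow> 'a set \<Rightarrow> 'a \<Rightarrow> bool" where
  "beyond_facet D G z \<longleftrightarrow>
     G facet_of D \<and>
     (\<forall>n c F. F facet_of D \<and> D \<subseteq> {x. n \<bullet> x \<le> c} \<and> F = D \<inter> {x. n \<bullet> x = c} \<longrightarrow>
        (if F = G then c < n \<bullet> z else n \<bullet> z < c))"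

text \<open>Central projection from \<open>z\<close> to the hyperplane spanned by \<open>G\<close>.\<close>
definition schlegel_map :: "'a::euclidean_space set \<Rightarrow> 'a \<Rightarrow> 'a \<Rightarrow> 'a" where
  "schlegel_map G z x = (THE y. y \<in> affine hull G \<and> y \<in> affine hull {z, x})"

text \<open>\<open>K\<close> is the part of a Schlegel diagram of the 4-polytope \<open>D\<close> that corresponds to the
  family \<open>S\<close> of faces; the linear map \<open>L\<close> identifies the hyperplane spanned by the projection
  facet \<open>G\<close> with 3-space.\<close>
definition schlegel_image ::
  "(real^4) set \<Rightarrow> (real^4) set set \<Rightarrow> (real^3) set set \<Rightarrow> bool" where
  "schlegel_image D S K \<longleftrightarrow>
     (\<exists>G z (L :: real^4 \<Rightarrow> real^3).
        beyond_facet D G z \<and> G \<notin> S \<and> linear L \<and> inj_on L (affine hull G) \<and>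
        K = (\<lambda>F. L ` schlegel_map G z ` F) ` S)"

end

theory Submission
  imports Defs
begin

text \<open>The realization is a small deformation of the prism \<open>W \<times> [-1, 1]\<close>. Write \<open>e 0, e 1, \<dots>\<close> for the
edge labels and put \<open>u 0 = t\<close> (the prism coordinate) and \<open>u (k + 1) = y (e k)\<close>. The inequality with
label \<open>(e k, j)\<close> becomes \<open>a (e k) \<bullet> x + b j * u (k + 1) + \<delta> * u k \<le> 1\<close>. The prism is a simple polytope:
the normals of the inequalities that are tight at a point are linearly independent. Hence for small
\<open>\<delta> > 0\<close> the same sets of inequalities are simultaneously tight at points of the two polytopes
(\<open>simple_system_stable\<close>), and these sets determine the face lattice (\<open>face_lattice_iso_patterns\<close>).

For a choice \<open>j\<close> of one inequality per edge, the cell over the corresponding polygon of the surface is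
given by \<open>p\<close> equations, which form a chain: \<open>u k\<close> is an affine function of \<open>x\<close> and \<open>u (k + 1)\<close>. So
\<open>x\<close> and the last chain coordinate \<open>u p\<close> are already injective on a cell; they are the projection to
3-space. The fourth coordinate is the weighted sum \<open>s = \<delta> * (\<Sum>k<p. M ^ k * u k)\<close>. The
growth rate \<open>M = 3 * B / \<delta>\<close>, where \<open>\<bar>b j\<bar> \<le> B\<close>, is so large that for each of the \<open>2 ^ p\<close> choices
\<open>j\<close> the function \<open>s\<close> plus a suitable affine function of \<open>(x, u p)\<close> is a strictly positive combination
of the \<open>p\<close> chosen inequalities (\<open>cell_supporting\<close>). Therefore each cell is the preimage of a face of
the projected 4-polytope, which gives preservation of all faces of the prism over the surface. It also
shows that of two points of the polytope with the same \<open>(x, u p)\<close>, a point in a cell has the larger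
\<open>s\<close>, with equality only if both lie in that cell; hence the further projection to 3-space is injective
on the union of all cells (\<open>inj_proj3\<close>).

For the dual surface, let a linear functional on 4-space attain its maximum at the image of a point of
\<open>F \<times> I\<close>, \<open>F\<close> a face of the surface, at which no prism facet is tight. By Farkas' lemma its pullback is a
nonnegative combination of the tight rows. Comparing coefficients along the chain, with the same
estimates as before, shows that either the functional vanishes or for every edge some row has a
positive coefficient; so the face where the maximum is attained lies in a cell (\<open>surface_star\<close>). Thus the faces
\<open>F \<times> I\<close> are closed under passing to larger proper faces of the 4-polytope, and in any dual polytope
they form a subcomplex with the dual face poset. A vertex \<open>v\<close> of the surface gives two vertices
\<open>v \<times> {0}\<close> and \<open>v \<times> {1}\<close> of the prism, hence two facets of the dual that contain the dual face of \<open>v\<close>;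
whatever facet is used as the base of a Schlegel diagram, each face of the dual surface lies in another
facet, and central projection is injective on the union of the facets other than the base
(\<open>schlegel_complex\<close>).\<close>

section \<open>Polyhedra and their sets of tight inequalities\<close>

definition polyh :: "('k \<Rightarrow> 'a::euclidean_space) \<Rightarrow> ('k \<Rightarrow> real) \<Rightarrow> 'a set" where
  "polyh n c = {x. \<forall>k. n k \<bullet> x \<le> c k}"

definition active :: "('k \<Rightarrow> 'a::euclidean_space) \<Rightarrow> ('k \<Rightarrow> real) \<Rightarrow> 'a \<Rightarrow> 'k set" where
  "active n c x = {k. n k \<bullet> x = c k}"

text \<open>A pattern is the set of all inequalities that are tight at some point of the polyhedron. Nonempty
faces correspond to patterns: a face is determined by the inequalities tight at its relative interior points.\<close>
definition patterns :: "('k \<Rightarrow> 'a::euclidean_space) \<Rightarrow> ('k \<Rightarrow> real) \<Rightarrow> 'k set set" where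
  "patterns n c = active n c ` polyh n c"

definition common :: "('k \<Rightarrow> 'a::euclidean_space) \<Rightarrow> ('k \<Rightarrow> real) \<Rightarrow> 'a set \<Rightarrow> 'k set" where
  "common n c F = {k. \<forall>x\<in>F. n k \<bullet> x = c k}"

definition slice :: "('k \<Rightarrow> 'a::euclidean_space) \<Rightarrow> ('k \<Rightarrow> real) \<Rightarrow> 'k set \<Rightarrow> 'a set" where
  "slice n c X = {x \<in> polyh n c. X \<subseteq> active n c x}"

lemma convex_polyh: "convex (polyh n c)"
proof -
  have "polyh n c = (\<Inter>k. {x. n k \<bullet> x \<le> c k})" by (auto simp: polyh_def)
  then show ?thesis by (simp add: convex_INT convex_halfspace_le)
qed

lemma polyhedron_polyh: "polyhedron (polyh n c)" for n :: "'k::finite \<Rightarrow> 'a::euclidean_space"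
proof -
  have "polyh n c = \<Inter>((\<lambda>k. {x. n k \<bullet> x \<le> c k}) ` UNIV)" by (auto simp: polyh_def)
  then show ?thesis by (simp only:) (intro polyhedron_Inter, auto simp: polyhedron_halfspace_le)
qed

lemma slice_face_of: "slice n c X face_of polyh n c"
proof (cases "X = {}")
  case True
  then show ?thesis by (simp add: slice_def convex_polyh face_of_refl)
next
  case False
  have *: "(polyh n c \<inter> {x. n k \<bullet> x = c k}) face_of polyh n c" for k
    by (rule face_of_Int_supporting_hyperplane_le[OF convex_polyh]) (auto simp: polyh_def)
  have "slice n c X = \<Inter>((\<lambda>k. polyh n c \<inter> {x. n k \<bullet> x = c k}) ` X)"
    using False by (auto simp: slice_def active_def)
  then show ?thesis using False * by (simp only:) (rule face_of_Inter, auto)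
qed

text \<open>A relative interior point can be pushed beyond itself, away from any other point \<open>y\<close>; a smaller value
at \<open>y\<close> would then force a value above the maximum.\<close>
lemma rel_interior_max_const:
  fixes F :: "'a::euclidean_space set"
  assumes "convex F" "x \<in> rel_interior F" "y \<in> F" "\<And>z. z \<in> F \<Longrightarrow> n \<bullet> z \<le> c" "n \<bullet> x = c"
  shows "n \<bullet> y = c"
proof -
  obtain e where e: "e > 1" "(1 - e) *\<^sub>R y + e *\<^sub>R x \<in> F"
    using assms convex_rel_interior_iff[of F x] by (metis empty_iff)
  have "(1 - e) * (n \<bullet> y) + e * c \<le> c"
    using assms(4)[OF e(2)] assms(5) by (simp add: inner_add_right)
  then have "(e - 1) * (c - n \<bullet> y) \<le> 0" by (simp add: algebra_simps)
  with e have "c \<le> n \<bullet> y" by (simp add: mult_le_0_iff)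
  with assms show ?thesis by (simp add: antisym)
qed

lemma eventually_step_in_polyh:
  fixes n :: "'k::finite \<Rightarrow> 'a::euclidean_space"
  assumes "x \<in> polyh n c" "\<And>k. k \<in> active n c x \<Longrightarrow> n k \<bullet> v \<le> 0"
  shows "\<forall>\<^sub>F r in at_right 0. x + r *\<^sub>R v \<in> polyh n c \<and>
           active n c (x + r *\<^sub>R v) = {k \<in> active n c x. n k \<bullet> v = 0}"
proof -
  have "\<forall>\<^sub>F r in at_right (0::real). \<forall>k\<in>UNIV. k \<notin> active n c x \<longrightarrow> n k \<bullet> (x + r *\<^sub>R v) < c k"
  proof (rule eventually_ball_finite, simp, rule ballI)
    fix k
    show "\<forall>\<^sub>F r in at_right 0. k \<notin> active n c x \<longrightarrow> n k \<bullet> (x + r *\<^sub>R v) < c k"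
    proof (cases "k \<in> active n c x")
      case False
      have "((\<lambda>r. n k \<bullet> (x + r *\<^sub>R v)) \<longlongrightarrow> n k \<bullet> (x + 0 *\<^sub>R v)) (at_right 0)"
        by (intro tendsto_intros)
      moreover have "n k \<bullet> (x + 0 *\<^sub>R v) < c k"
        using assms False by (auto simp: polyh_def active_def less_le)
      ultimately show ?thesis by (auto dest: order_tendstoD elim: eventually_mono)
    qed simp
  qed
  moreover have "\<forall>\<^sub>F r in at_right (0::real). 0 < r" by (simp add: eventually_at_right_less)
  ultimately show ?thesis
  proof eventually_elim
    case (elim r)
    have act: "n k \<bullet> (x + r *\<^sub>R v) = c k + r * (n k \<bullet> v)" if "k \<in> active n c x" for k
      using that by (simp add: active_def inner_add_right)
    have le: "n k \<bullet> (x + r *\<^sub>R v) \<le> c k" for k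
      using elim act[of k] assms(2)[of k] by (cases "k \<in> active n c x") (auto simp: mult_le_0_iff less_imp_le)
    have "active n c (x + r *\<^sub>R v) = {k \<in> active n c x. n k \<bullet> v = 0}"
    proof (rule set_eqI)
      fix k show "k \<in> active n c (x + r *\<^sub>R v) \<longleftrightarrow> k \<in> {k \<in> active n c x. n k \<bullet> v = 0}"
      proof (cases "k \<in> active n c x")
        case True
        then show ?thesis using act[OF True] elim by (simp add: active_def)
      next
        case False
        then have "n k \<bullet> (x + r *\<^sub>R v) < c k" using elim by blast
        then show ?thesis using False by (simp add: active_def)
      qed
    qed
    with le show ?case by (auto simp: polyh_def)
  qed
qed

lemma step_in_polyh:
  fixes n :: "'k::finite \<Rightarrow> 'a::euclidean_space"
  assumes "x \<in> polyh n c" "\<And>k. k \<in> active n c x \<Longrightarrow> n k \<bullet> v \<le> 0"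
  obtains r where "r > 0" "x + r *\<^sub>R v \<in> polyh n c"
    "active n c (x + r *\<^sub>R v) = {k \<in> active n c x. n k \<bullet> v = 0}"
proof -
  have pos: "\<forall>\<^sub>F r in at_right (0::real). 0 < r" by (simp add: eventually_at_right_less)
  have ev: "\<forall>\<^sub>F r in at_right 0. x + r *\<^sub>R v \<in> polyh n c \<and>
           active n c (x + r *\<^sub>R v) = {k \<in> active n c x. n k \<bullet> v = 0}"
    using eventually_step_in_polyh[of x n c v] assms by blast
  with pos have "\<forall>\<^sub>F r in at_right (0::real). r > 0 \<and> x + r *\<^sub>R v \<in> polyh n c \<and>
           active n c (x + r *\<^sub>R v) = {k \<in> active n c x. n k \<bullet> v = 0}"
    by eventually_elim auto
  then show thesis using that eventually_happens by (metis (mono_tags, lifting) trivial_limit_at_right_real)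
qed

lemma face_rel_interior_active:
  fixes n :: "'k \<Rightarrow> 'a::euclidean_space"
  assumes "F face_of polyh n c" "x \<in> rel_interior F"
  shows "active n c x = common n c F"
proof -
  have F: "convex F" "F \<subseteq> polyh n c" using face_of_imp_convex[OF assms(1)] face_of_imp_subset[OF assms(1)] by auto
  have x: "x \<in> F" using assms rel_interior_subset by blast
  have le: "n k \<bullet> z \<le> c k" if "z \<in> F" for k z using F(2) that by (auto simp: polyh_def)
  have "n k \<bullet> y = c k" if "n k \<bullet> x = c k" "y \<in> F" for k y
    using rel_interior_max_const[OF F(1) assms(2) that(2) le that(1)] by blast
  then show ?thesis using x by (auto simp: active_def common_def)
qed

text \<open>If everything that is tight at \<open>x\<close> is also tight at \<open>y\<close>, then the segment from \<open>y\<close> to \<open>x\<close> can be prolonged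
beyond \<open>x\<close> inside the polyhedron, so \<open>y\<close> belongs to each face that contains \<open>x\<close>.\<close>
lemma slice_active_subset_face:
  fixes n :: "'k::finite \<Rightarrow> 'a::euclidean_space"
  assumes F: "F face_of polyh n c" and x: "x \<in> F"
  shows "slice n c (active n c x) \<subseteq> F"
proof
  fix y assume y: "y \<in> slice n c (active n c x)"
  have xP: "x \<in> polyh n c" using F x face_of_imp_subset by blast
  have "n k \<bullet> (x - y) \<le> 0" if "k \<in> active n c x" for k
    using y that by (auto simp: slice_def active_def inner_diff_right)
  then obtain r where r: "r > 0" "x + r *\<^sub>R (x - y) \<in> polyh n c"
    using step_in_polyh[OF xP, of "x - y"] by metis
  show "y \<in> F"
  proof (cases "x = y")
    case False
    define w where "w = x + r *\<^sub>R (x - y)"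
    have "x = (1 - 1 / (1 + r)) *\<^sub>R y + (1 / (1 + r)) *\<^sub>R w"
    proof -
      have "(1 + r) *\<^sub>R ((1 - 1 / (1 + r)) *\<^sub>R y + (1 / (1 + r)) *\<^sub>R w) = r *\<^sub>R y + w"
        using r(1) by (simp add: scaleR_add_right algebra_simps)
      also have "\<dots> = (1 + r) *\<^sub>R x" by (simp add: w_def algebra_simps)
      finally show ?thesis using r(1) by (simp del: scaleR_add_right add: scaleR_cancel_left)
    qed
    moreover have "y \<noteq> w"
    proof
      assume "y = w"
      then have "(1 + r) *\<^sub>R (x - y) = 0" by (simp add: w_def algebra_simps)
      then show False using False r(1) by simp
    qed
    ultimately have "x \<in> open_segment y w"
      unfolding in_segment using r(1) by (intro conjI exI[of _ "1 / (1 + r)"]) auto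
    then show ?thesis using F x r y w_def unfolding face_of_def slice_def by blast
  qed (use x in simp)
qed

lemma common_slice:
  assumes "X \<in> patterns n c" shows "common n c (slice n c X) = X"
  using assms by (auto simp: patterns_def common_def slice_def active_def)

text \<open>The empty face is encoded by the full index set; this is unambiguous as long as no point makes all
inequalities tight.\<close>
lemma slice_UNIV: "UNIV \<notin> patterns n c \<Longrightarrow> slice n c UNIV = {}"
  by (force simp: patterns_def slice_def)

lemma slice_common:
  fixes n :: "'k::finite \<Rightarrow> 'a::euclidean_space"
  assumes "UNIV \<notin> patterns n c" "F face_of polyh n c"
  shows "slice n c (common n c F) = F" and "common n c F \<in> insert UNIV (patterns n c)"
proof -
  show "slice n c (common n c F) = F"
  proof (cases "F = {}")
    case True
    then show ?thesis using slice_UNIV[OF assms(1)] by (simp add: common_def)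
  next
    case False
    then obtain x where x: "x \<in> rel_interior F"
      using assms face_of_imp_convex rel_interior_eq_empty by blast
    then have "x \<in> F" using rel_interior_subset by blast
    then have "slice n c (common n c F) \<subseteq> F"
      using slice_active_subset_face[OF assms(2)] face_rel_interior_active[OF assms(2) x] by metis
    moreover have "F \<subseteq> slice n c (common n c F)"
      using face_of_imp_subset[OF assms(2)] by (auto simp: slice_def common_def active_def)
    ultimately show ?thesis by blast
  qed
  show "common n c F \<in> insert UNIV (patterns n c)"
  proof (cases "F = {}")
    case False
    then obtain x where x: "x \<in> rel_interior F"
      using assms face_of_imp_convex rel_interior_eq_empty by blast
    then have "x \<in> polyh n c" using rel_interior_subset assms(2) face_of_imp_subset by blast
    then show ?thesis using face_rel_interior_active[OF assms(2) x] by (auto simp: patterns_def)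
  qed (simp add: common_def)
qed

lemma common_antimono: "F \<subseteq> G \<Longrightarrow> common n c G \<subseteq> common n c F"
  by (auto simp: common_def)

lemma slice_antimono: "X \<subseteq> Y \<Longrightarrow> slice n c Y \<subseteq> slice n c X"
  by (auto simp: slice_def)

text \<open>Both face lattices are anti-isomorphic to the set of patterns, with the full index set added for the
empty face. This makes combinatorial equivalence of two polyhedra, possibly in different spaces, a statement
about tightness at points only.\<close>
lemma face_lattice_iso_patterns:
  fixes n :: "'k::finite \<Rightarrow> 'a::euclidean_space" and n' :: "'k \<Rightarrow> 'b::euclidean_space"
  assumes eq: "patterns n c = patterns n' c'" and U: "UNIV \<notin> patterns n c"
  shows "face_lattice_iso (polyh n c) (polyh n' c') (\<lambda>F. slice n' c' (common n c F))"
proof -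
  have U': "UNIV \<notin> patterns n' c'" using eq U by simp
  have cs: "common n c (slice n c X) = X" if "X \<in> insert UNIV (patterns n c)" for X
    using that common_slice[of X n c] slice_UNIV[OF U] by (auto simp: common_def)
  have cs': "common n' c' (slice n' c' X) = X" if "X \<in> insert UNIV (patterns n c)" for X
    using that common_slice[of X n' c'] slice_UNIV[OF U'] eq by (auto simp: common_def)
  note sc = slice_common[OF U] and sc' = slice_common[OF U']
  show ?thesis
    unfolding face_lattice_iso_def poset_iso_def faces_def
  proof (intro conjI ballI)
    show "bij_betw (\<lambda>F. slice n' c' (common n c F)) {F. F face_of polyh n c} {F. F face_of polyh n' c'}"
    proof (rule bij_betwI[where g = "\<lambda>F. slice n c (common n' c' F)"])
      show "slice n c (common n' c' (slice n' c' (common n c F))) = F" if "F \<in> {F. F face_of polyh n c}" for F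
        using that sc cs' by simp
      show "slice n' c' (common n c (slice n c (common n' c' F))) = F" if "F \<in> {F. F face_of polyh n' c'}" for F
        using that sc'[of F] cs[of "common n' c' F"] eq by simp
    qed (auto simp: slice_face_of)
    fix F G assume FG: "F \<in> {F. F face_of polyh n c}" "G \<in> {F. F face_of polyh n c}"
    show "F \<subseteq> G \<longleftrightarrow> slice n' c' (common n c F) \<subseteq> slice n' c' (common n c G)"
    proof
      assume "slice n' c' (common n c F) \<subseteq> slice n' c' (common n c G)"
      then have "common n c G \<subseteq> common n c F"
        using common_antimono[of _ _ n' c'] cs' sc(2) FG by (metis mem_Collect_eq)
      then show "F \<subseteq> G" using slice_antimono[of _ _ n c] sc(1) FG by (metis mem_Collect_eq)
    qed (intro slice_antimono common_antimono)
  qed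
qed

section \<open>Simple systems and their perturbations\<close>

text \<open>The normals with indices in \<open>X\<close> are linearly independent and pairwise different; the formulation by dual
vectors is the one that the arguments below use.\<close>
definition regular :: "('k \<Rightarrow> 'a::euclidean_space) \<Rightarrow> 'k set \<Rightarrow> bool" where
  "regular n X \<longleftrightarrow> (\<forall>k\<in>X. \<exists>v. n k \<bullet> v = 1 \<and> (\<forall>l\<in>X - {k}. n l \<bullet> v = 0))"

definition simple_system :: "('k \<Rightarrow> 'a::euclidean_space) \<Rightarrow> ('k \<Rightarrow> real) \<Rightarrow> bool" where
  "simple_system n c \<longleftrightarrow> (\<forall>X\<in>patterns n c. regular n X)"

lemma regular_subset: "regular n Y \<Longrightarrow> X \<subseteq> Y \<Longrightarrow> regular n X"
  unfolding regular_def by (meson Diff_mono order_refl subsetD)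

lemma regular_dual_vectors:
  assumes "regular n X"
  shows "\<exists>v. \<forall>k\<in>X. \<forall>l\<in>X. n l \<bullet> v k = (if l = k then 1 else 0)"
proof -
  have "\<forall>k\<in>X. \<exists>v. \<forall>l\<in>X. n l \<bullet> v = (if l = k then 1 else 0)"
    using assms unfolding regular_def by (metis DiffI empty_iff insert_iff)
  then show ?thesis by (rule bchoice)
qed

text \<open>Moving from a point in the direction of the negative sum of some of the dual vectors makes exactly the
corresponding inequalities slack.\<close>
lemma patterns_subset_closed:
  fixes n :: "'k::finite \<Rightarrow> 'a::euclidean_space"
  assumes "simple_system n c" "Y \<in> patterns n c" "X \<subseteq> Y"
  shows "X \<in> patterns n c"
proof -
  obtain x where x: "x \<in> polyh n c" "Y = active n c x" using assms by (auto simp: patterns_def)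
  have "regular n Y" using assms unfolding simple_system_def by blast
  from regular_dual_vectors[OF this]
  obtain v where "\<forall>k\<in>Y. \<forall>l\<in>Y. n l \<bullet> v k = (if l = k then 1 else 0)" ..
  then have v: "\<And>k l. k \<in> Y \<Longrightarrow> l \<in> Y \<Longrightarrow> n l \<bullet> v k = (if l = k then 1 else 0)" by blast
  \<comment> \<open>the value of \<open>w\<close> is \<open>-1\<close> on the rows to be released and \<open>0\<close> on those to be kept\<close>
  define w where "w = - (\<Sum>k\<in>Y - X. v k)"
  have w: "n l \<bullet> w = (if l \<in> X then 0 else -1)" if "l \<in> Y" for l
  proof -
    have "n l \<bullet> w = - (\<Sum>k\<in>Y - X. if l = k then 1 else 0)"
      using that v by (simp add: w_def inner_sum_right)
    then show ?thesis using that by simp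
  qed
  obtain r where "x + r *\<^sub>R w \<in> polyh n c" "active n c (x + r *\<^sub>R w) = {k \<in> active n c x. n k \<bullet> w = 0}"
    using step_in_polyh[OF x(1), of w] w x(2) by (metis (full_types) order_refl neg_le_0_iff_le zero_le_one)
  moreover have "{k \<in> active n c x. n k \<bullet> w = 0} = X" using w x(2) assms(3) by (auto split: if_splits)
  ultimately show ?thesis unfolding patterns_def by (metis image_eqI)
qed

text \<open>Farkas' lemma in the simple case, where it is elementary: stepping from \<open>x\<close> along the negative of a
dual vector stays in the polyhedron, so the value of \<open>f\<close> on that dual vector is a nonnegative multiplier.\<close>
lemma simple_multipliers:
  fixes n :: "'k::finite \<Rightarrow> 'a::euclidean_space"
  assumes simp: "simple_system n c" and x: "x \<in> polyh n c"
    and max: "\<And>z. z \<in> polyh n c \<Longrightarrow> f \<bullet> z \<le> f \<bullet> x"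
  obtains \<mu> where "\<And>k. \<mu> k \<ge> 0" "\<And>k. k \<notin> active n c x \<Longrightarrow> \<mu> k = 0" "f = (\<Sum>k\<in>UNIV. \<mu> k *\<^sub>R n k)"
proof -
  define X where "X = active n c x"
  have "regular n X" using simp x by (auto simp: simple_system_def patterns_def X_def)
  from regular_dual_vectors[OF this]
  obtain v where "\<forall>k\<in>X. \<forall>l\<in>X. n l \<bullet> v k = (if l = k then 1 else 0)" ..
  then have v: "\<And>k l. k \<in> X \<Longrightarrow> l \<in> X \<Longrightarrow> n l \<bullet> v k = (if l = k then 1 else 0)" by blast
  have desc: "f \<bullet> w \<le> 0" if w: "\<And>k. k \<in> X \<Longrightarrow> n k \<bullet> w \<le> 0" for w
  proof -
    obtain r where "r > 0" "x + r *\<^sub>R w \<in> polyh n c"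
      using step_in_polyh[OF x] w unfolding X_def by metis
    with max[of "x + r *\<^sub>R w"] show ?thesis by (simp add: inner_add_right mult_le_0_iff)
  qed
  define \<mu> where "\<mu> k = (if k \<in> X then f \<bullet> v k else 0)" for k
  have "\<mu> k \<ge> 0" for k
    using desc[of "- v k"] v by (simp add: \<mu>_def)
  moreover have "f = (\<Sum>k\<in>UNIV. \<mu> k *\<^sub>R n k)"
  proof (rule vector_eq_rdot[THEN iffD1], rule allI)
    fix z
    define w where "w = z - (\<Sum>k\<in>X. (n k \<bullet> z) *\<^sub>R v k)"
    have nw: "n l \<bullet> w = 0" if "l \<in> X" for l
    proof -
      have "(\<Sum>k\<in>X. (n k \<bullet> z) * (n l \<bullet> v k)) = (\<Sum>k\<in>X. if l = k then n k \<bullet> z else 0)"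
        by (rule sum.cong) (use v that in auto)
      then show ?thesis using that by (simp add: w_def inner_diff_right inner_sum_right)
    qed
    have "f \<bullet> w \<le> 0" using nw by (intro desc) simp
    moreover have "f \<bullet> (- w) \<le> 0" using nw by (intro desc) simp
    ultimately have "f \<bullet> w = 0" by simp
    then have "f \<bullet> z = (\<Sum>k\<in>X. (n k \<bullet> z) * (f \<bullet> v k))"
      by (simp add: w_def inner_diff_right inner_sum_right)
    also have "\<dots> = (\<Sum>k\<in>UNIV. \<mu> k * (n k \<bullet> z))"
      by (rule sum.mono_neutral_cong_left) (auto simp: \<mu>_def)
    finally show "f \<bullet> z = (\<Sum>k\<in>UNIV. \<mu> k *\<^sub>R n k) \<bullet> z" by (simp add: inner_sum_left)
  qed
  ultimately show thesis using that[of \<mu>] by (simp add: \<mu>_def X_def)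
qed

text \<open>An independent system of linear equations keeps a solution nearby when it is perturbed. Adding one equation at
a time avoids determinants: a solution of the old equations is corrected along a perturbed dual vector
of the new one.\<close>
lemma regular_perturbed_solution:
  fixes n0 :: "'k \<Rightarrow> 'a::euclidean_space"
  assumes "finite X" "regular n0 X" "\<And>k. k \<in> X \<Longrightarrow> ((\<lambda>d. N d k) \<longlongrightarrow> n0 k) \<F>"
    and "\<And>k. k \<in> X \<Longrightarrow> n0 k \<bullet> x = r k"
  shows "\<exists>y. (y \<longlongrightarrow> x) \<F> \<and> (\<forall>\<^sub>F d in \<F>. \<forall>k\<in>X. N d k \<bullet> y d = r k)"
  using assms
proof (induction X arbitrary: x r rule: finite_induct)
  case empty
  show ?case by (intro exI[of _ "\<lambda>_. x"]) auto
next
  case (insert k X)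
  have reg: "regular n0 X" using insert.prems(1) regular_subset by blast
  have "insert k X - {k} = X" using insert.hyps(2) by simp
  then obtain v where v: "n0 k \<bullet> v = 1" "\<forall>l\<in>X. n0 l \<bullet> v = 0"
    using insert.prems(1) unfolding regular_def by (metis insertI1)
  obtain y where y: "(y \<longlongrightarrow> x) \<F>" "\<forall>\<^sub>F d in \<F>. \<forall>l\<in>X. N d l \<bullet> y d = r l"
    using insert.IH[OF reg, of x r] insert.prems by auto
  obtain u where u: "(u \<longlongrightarrow> v) \<F>" "\<forall>\<^sub>F d in \<F>. \<forall>l\<in>X. N d l \<bullet> u d = 0"
    using insert.IH[OF reg, of v "\<lambda>_. 0"] insert.prems v by auto
  have Nk: "((\<lambda>d. N d k) \<longlongrightarrow> n0 k) \<F>" using insert.prems by auto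
  define y' where "y' d = y d + ((r k - N d k \<bullet> y d) / (N d k \<bullet> u d)) *\<^sub>R u d" for d
  have "(y' \<longlongrightarrow> x + ((r k - n0 k \<bullet> x) / (n0 k \<bullet> v)) *\<^sub>R v) \<F>"
    unfolding y'_def using v by (intro tendsto_intros y u Nk) auto
  then have "(y' \<longlongrightarrow> x) \<F>" using insert.prems by simp
  moreover have "\<forall>\<^sub>F d in \<F>. N d k \<bullet> u d > 0"
    by (rule order_tendstoD(1)[OF tendsto_inner[OF Nk u(1)]]) (simp add: v)
  then have "\<forall>\<^sub>F d in \<F>. \<forall>l\<in>insert k X. N d l \<bullet> y' d = r l"
    using y(2) u(2)
  proof eventually_elim
    case (elim d)
    then show ?case by (simp add: y'_def inner_add_right)
  qed
  ultimately show ?case by blast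
qed

lemma eventually_regular:
  fixes n0 :: "'k \<Rightarrow> 'a::euclidean_space"
  assumes "finite X" "regular n0 X" "\<And>k. ((\<lambda>d. N d k) \<longlongrightarrow> n0 k) \<F>"
  shows "\<forall>\<^sub>F d in \<F>. regular (N d) X"
  unfolding regular_def
proof (rule eventually_ball_finite[OF assms(1)], rule ballI)
  fix k assume k: "k \<in> X"
  then obtain v where v: "n0 k \<bullet> v = 1" "\<forall>l\<in>X - {k}. n0 l \<bullet> v = 0"
    using assms(2) unfolding regular_def by blast
  have v': "n0 l \<bullet> v = (if l = k then 1 else 0)" if "l \<in> X" for l using v that by auto
  obtain y where y: "\<forall>\<^sub>F d in \<F>. \<forall>l\<in>X. N d l \<bullet> y d = (if l = k then 1 else 0)"
    using regular_perturbed_solution[OF assms(1,2,3) v'] by blast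
  then show "\<forall>\<^sub>F d in \<F>. \<exists>v. N d k \<bullet> v = 1 \<and> (\<forall>l\<in>X - {k}. N d l \<bullet> v = 0)"
  proof eventually_elim
    case (elim d)
    then show ?case using k by (intro exI[of _ "y d"]) simp
  qed
qed

lemma eventually_pattern_persists:
  fixes n0 :: "'k::finite \<Rightarrow> 'a::euclidean_space"
  assumes "simple_system n0 c" "X \<in> patterns n0 c" "\<And>k. ((\<lambda>d. N d k) \<longlongrightarrow> n0 k) \<F>"
  shows "\<forall>\<^sub>F d in \<F>. X \<in> patterns (N d) c"
proof -
  obtain x where x: "x \<in> polyh n0 c" "X = active n0 c x" using assms by (auto simp: patterns_def)
  have reg: "regular n0 X" using assms unfolding simple_system_def by blast
  have nx: "n0 k \<bullet> x = c k" if "k \<in> X" for k using that x(2) unfolding active_def by blast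
  obtain y where y: "(y \<longlongrightarrow> x) \<F>" "\<forall>\<^sub>F d in \<F>. \<forall>k\<in>X. N d k \<bullet> y d = c k"
    using regular_perturbed_solution[OF finite[of X] reg assms(3) nx] by blast
  have "\<forall>\<^sub>F d in \<F>. \<forall>k\<in>- X. N d k \<bullet> y d < c k"
  proof (rule eventually_ball_finite, simp, rule ballI)
    fix k assume "k \<in> - X"
    then have "n0 k \<bullet> x < c k" using x by (auto simp: polyh_def active_def less_le)
    then show "\<forall>\<^sub>F d in \<F>. N d k \<bullet> y d < c k"
      by (rule order_tendstoD(2)[OF tendsto_inner[OF assms(3) y(1)]])
  qed
  with y(2) show ?thesis
  proof eventually_elim
    case (elim d)
    then have "N d k \<bullet> y d \<le> c k" for k by (cases "k \<in> X") (auto simp: less_imp_le)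
    then have "y d \<in> polyh (N d) c" unfolding polyh_def by blast
    moreover have "active (N d) c (y d) = X" using elim unfolding active_def by force
    ultimately show ?case unfolding patterns_def by blast
  qed
qed

text \<open>Weak inequalities and equations survive limits of points and normals.\<close>
lemma limit_in_polyh:
  fixes n0 :: "'k \<Rightarrow> 'a::euclidean_space"
  assumes "\<And>k. (\<lambda>m. N m k) \<longlonglongrightarrow> n0 k" "z \<longlonglongrightarrow> x" "\<And>m. z m \<in> polyh (N m) c" "\<And>m. X \<subseteq> active (N m) c (z m)"
  shows "x \<in> polyh n0 c \<and> X \<subseteq> active n0 c x"
proof -
  have lim: "(\<lambda>m. N m k \<bullet> z m) \<longlonglongrightarrow> n0 k \<bullet> x" for k by (intro tendsto_inner assms)
  have "n0 k \<bullet> x \<le> c k" for k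
    by (rule LIMSEQ_le_const2[OF lim]) (use assms(3) in \<open>auto simp: polyh_def\<close>)
  moreover have "n0 k \<bullet> x = c k" if "k \<in> X" for k
  proof -
    have "(\<lambda>m. N m k \<bullet> z m) = (\<lambda>m. c k)" using assms(4) that by (auto simp: active_def)
    then show ?thesis using lim[of k] by (simp add: LIMSEQ_const_iff)
  qed
  ultimately show ?thesis by (auto simp: polyh_def active_def)
qed

text \<open>The perturbed polyhedra are convex and contain \<open>0\<close>, so a point of large norm can be scaled back to
a point of norm exactly \<open>R\<close>. A limit of such points would lie in the unperturbed polyhedron, whose points
have norm less than \<open>R\<close>.\<close>
lemma uniformly_bounded_perturbation:
  fixes n0 :: "'k \<Rightarrow> 'a::euclidean_space"
  assumes bd: "bounded (polyh n0 c)" and c: "\<And>k. c k > 0"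
    and N: "\<And>k. (\<lambda>m. N m k) \<longlonglongrightarrow> n0 k" and z: "\<And>m. z m \<in> polyh (N m) c"
  shows "bounded (range z)"
proof -
  obtain R where R: "R > 0" "\<And>x. x \<in> polyh n0 c \<Longrightarrow> norm x < R"
    using bd unfolding bounded_pos_less by blast
  have "\<forall>\<^sub>F m in sequentially. norm (z m) \<le> R"
  proof (rule ccontr)
    assume "\<not> ?thesis"
    then have inf: "infinite {m. \<not> norm (z m) \<le> R}"
      by (simp add: not_eventually INFM_iff_infinite cofinite_eq_sequentially[symmetric] frequently_cofinite)
    define g where "g = enumerate {m. \<not> norm (z m) \<le> R}"
    have g: "strict_mono g" "\<And>m. norm (z (g m)) > R"
      using inf strict_mono_enumerate enumerate_in_set[OF inf] by (auto simp: g_def not_le)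
    define y where "y m = (R / norm (z (g m))) *\<^sub>R z (g m)" for m
    have y: "norm (y m) = R" for m
    proof -
      have "norm (z (g m)) > 0" using g(2)[of m] R(1) by linarith
      then show ?thesis using R(1) by (simp add: y_def)
    qed
    have yP: "y m \<in> polyh (N (g m)) c" for m
    proof -
      have "norm (z (g m)) > 0" using g(2)[of m] R(1) by linarith
      then have t: "0 \<le> R / norm (z (g m))" "R / norm (z (g m)) \<le> 1"
        using g(2)[of m] R(1) by (simp_all add: field_simps)
      have "0 \<in> polyh (N (g m)) c" using c by (auto simp: polyh_def less_imp_le)
      then have "(1 - R / norm (z (g m))) *\<^sub>R 0 + (R / norm (z (g m))) *\<^sub>R z (g m) \<in> polyh (N (g m)) c"
        using t z by (intro convexD_alt[OF convex_polyh]) auto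
      then show ?thesis by (simp add: y_def)
    qed
    have "\<forall>m. y m \<in> cball 0 R" by (simp add: y)
    then obtain x h where h: "strict_mono h" "(y \<circ> h) \<longlonglongrightarrow> x"
      using compact_imp_seq_compact[OF compact_cball] unfolding seq_compact_def by blast
    have "(\<lambda>m. N (g (h m)) k) \<longlonglongrightarrow> n0 k" for k
      using LIMSEQ_subseq_LIMSEQ[OF N strict_mono_o[OF g(1) h(1)]] by (simp add: o_def)
    moreover have "(y \<circ> h) m \<in> polyh (N (g (h m))) c" for m using yP by simp
    ultimately have "x \<in> polyh n0 c"
      using limit_in_polyh[OF _ h(2), of "\<lambda>m. N (g (h m))" n0 c "{}"] by blast
    then have "norm x < R" by (rule R)
    moreover have "(\<lambda>m. norm ((y \<circ> h) m)) \<longlonglongrightarrow> norm x" by (intro tendsto_norm h)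
    then have "norm x = R" by (simp add: y LIMSEQ_const_iff)
    ultimately show False by simp
  qed
  then obtain m0 where "\<And>m. m \<ge> m0 \<Longrightarrow> norm (z m) \<le> R" unfolding eventually_sequentially by blast
  then have "z m \<in> z ` {..<m0} \<union> cball 0 R" for m by (cases "m < m0") auto
  then have "range z \<subseteq> z ` {..<m0} \<union> cball 0 R" by blast
  then show ?thesis by (rule bounded_subset[rotated]) (simp add: bounded_Un finite_imp_bounded)
qed

lemma eventually_bounded_perturbation:
  fixes n0 :: "'k \<Rightarrow> 'a::euclidean_space"
  assumes bd: "bounded (polyh n0 c)" and c: "\<And>k. c k > 0" and N: "\<And>k. (\<lambda>m. N m k) \<longlonglongrightarrow> n0 k"
  shows "\<forall>\<^sub>F m in sequentially. bounded (polyh (N m) c)"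
proof -
  have "\<exists>z. z \<in> polyh (N m) c \<and> (\<not> bounded (polyh (N m) c) \<longrightarrow> norm z > real m)" for m
  proof (cases "bounded (polyh (N m) c)")
    case True
    then show ?thesis using c by (intro exI[of _ 0]) (simp add: polyh_def less_imp_le)
  next
    case False
    then show ?thesis unfolding bounded_iff by (meson not_le)
  qed
  then obtain z where z: "\<And>m. z m \<in> polyh (N m) c"
    "\<And>m. \<not> bounded (polyh (N m) c) \<Longrightarrow> norm (z m) > real m" by metis
  obtain R where R: "\<And>m. norm (z m) \<le> R"
    using uniformly_bounded_perturbation[OF bd c N z(1)] unfolding bounded_iff by blast
  obtain m0 where m0: "real m0 \<ge> R" using real_arch_simple by blast
  have "bounded (polyh (N m) c)" if "m \<ge> m0" for m
  proof (rule ccontr)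
    assume "\<not> ?thesis"
    then have "norm (z m) > real m" by (rule z(2))
    then show False using R[of m] m0 that by (meson not_le of_nat_mono order_trans)
  qed
  then show ?thesis unfolding eventually_sequentially by blast
qed

text \<open>Simple polytopes are combinatorially stable. Each old pattern persists because its equations can be solved
nearby. A new pattern \<open>X\<close> that occurred for arbitrarily small perturbations would, by compactness, be
contained in the pattern of a limit point, and subsets of patterns of a simple system are patterns.\<close>
lemma simple_system_stable:
  fixes n0 :: "'k::finite \<Rightarrow> 'a::euclidean_space"
  assumes simp: "simple_system n0 c" and bd: "bounded (polyh n0 c)" and c: "\<And>k. c k > 0"
    and N: "\<And>k. (\<lambda>m. N m k) \<longlonglongrightarrow> n0 k"
  shows "\<forall>\<^sub>F m in sequentially. patterns (N m) c = patterns n0 c \<and> simple_system (N m) c \<and>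
    bounded (polyh (N m) c)"
proof -
  have 1: "\<forall>\<^sub>F m in sequentially. \<forall>X\<in>patterns n0 c. X \<in> patterns (N m) c \<and> regular (N m) X"
    by (intro eventually_ball_finite ballI eventually_conj eventually_pattern_persists[OF simp _ N]
        eventually_regular[OF _ _ N]) (use simp in \<open>auto simp: simple_system_def\<close>)
  have "\<forall>\<^sub>F m in sequentially. \<forall>X\<in>- patterns n0 c. X \<notin> patterns (N m) c"
  proof (intro eventually_ball_finite ballI)
    fix X assume X: "X \<in> - patterns n0 c"
    show "\<forall>\<^sub>F m in sequentially. X \<notin> patterns (N m) c"
    proof (rule ccontr)
      assume "\<not> ?thesis"
      then have inf: "infinite {m. X \<in> patterns (N m) c}"
        by (simp add: not_eventually INFM_iff_infinite cofinite_eq_sequentially[symmetric] frequently_cofinite)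
      define g where "g = enumerate {m. X \<in> patterns (N m) c}"
      have g: "strict_mono g" "\<And>m. X \<in> patterns (N (g m)) c"
        using inf strict_mono_enumerate enumerate_in_set[OF inf] by (auto simp: g_def)
      have "\<forall>m. \<exists>z. z \<in> polyh (N (g m)) c \<and> X = active (N (g m)) c z"
        using g(2) unfolding patterns_def by blast
      then obtain z where z: "\<And>m. z m \<in> polyh (N (g m)) c" "\<And>m. X = active (N (g m)) c (z m)"
        by metis
      have Ng: "(\<lambda>m. N (g m) k) \<longlonglongrightarrow> n0 k" for k
        using LIMSEQ_subseq_LIMSEQ[OF N g(1)] by (simp add: o_def)
      have "bounded (range z)" by (rule uniformly_bounded_perturbation[OF bd c Ng z(1)])
      then obtain x h where h: "strict_mono h" "(z \<circ> h) \<longlonglongrightarrow> x"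
        using bounded_imp_convergent_subsequence by blast
      have "(\<lambda>m. N (g (h m)) k) \<longlonglongrightarrow> n0 k" for k
        using LIMSEQ_subseq_LIMSEQ[OF Ng h(1)] by (simp add: o_def)
      moreover have "(z \<circ> h) m \<in> polyh (N (g (h m))) c" "X \<subseteq> active (N (g (h m))) c ((z \<circ> h) m)" for m
        using z(1)[of "h m"] z(2)[of "h m"] by auto
      ultimately have "x \<in> polyh n0 c \<and> X \<subseteq> active n0 c x"
        by (rule limit_in_polyh[OF _ h(2)])
      then have "X \<in> patterns n0 c"
        using patterns_subset_closed[OF simp] unfolding patterns_def by (meson imageI)
      with X show False by simp
    qed
  qed simp
  with 1 eventually_bounded_perturbation[OF bd c N] show ?thesis
    by eventually_elim (auto simp: simple_system_def)
qed

section \<open>Injective images of polytopal complexes\<close>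

text \<open>Maps that send segments onto segments; linear maps and central projections are the two kinds needed. An
injective map of this kind transports convexity, polytopes and faces.\<close>
definition segment_map_on :: "'a::real_vector set \<Rightarrow> ('a \<Rightarrow> 'b::real_vector) \<Rightarrow> bool" where
  "segment_map_on F h \<longleftrightarrow> (\<forall>x\<in>F. \<forall>y\<in>F. h ` closed_segment x y = closed_segment (h x) (h y))"

lemma segment_map_on_linear: "linear h \<Longrightarrow> segment_map_on F h"
  by (simp add: segment_map_on_def closed_segment_linear_image)

lemma segment_map_on_subset: "segment_map_on F h \<Longrightarrow> T \<subseteq> F \<Longrightarrow> segment_map_on T h"
  by (auto simp: segment_map_on_def)

lemma segment_map_onD:
  "segment_map_on F h \<Longrightarrow> x \<in> F \<Longrightarrow> y \<in> F \<Longrightarrow> closed_segment (h x) (h y) = h ` closed_segment x y"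
  by (simp add: segment_map_on_def)

lemma segment_map_convex_image:
  assumes "segment_map_on F h" "convex F" shows "convex (h ` F)"
  unfolding convex_contains_segment
proof (intro ballI)
  fix u v assume "u \<in> h ` F" "v \<in> h ` F"
  then obtain x y where xy: "x \<in> F" "y \<in> F" "u = h x" "v = h y" by auto
  then have "closed_segment u v = h ` closed_segment x y" using segment_map_onD[OF assms(1)] by simp
  then show "closed_segment u v \<subseteq> h ` F"
    using closed_segment_subset[OF xy(1,2) assms(2)] by auto
qed

lemma segment_map_convex_iff:
  assumes "segment_map_on F h" "convex F" "inj_on h F" "T \<subseteq> F"
  shows "convex (h ` T) \<longleftrightarrow> convex T"
proof
  assume c: "convex (h ` T)"
  show "convex T"
    unfolding convex_contains_segment
  proof (intro ballI)
    fix x y assume xy: "x \<in> T" "y \<in> T"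
    have xyF: "x \<in> F" "y \<in> F" using xy assms(4) by auto
    have "closed_segment (h x) (h y) \<subseteq> h ` T" using xy by (intro closed_segment_subset c) auto
    then have "h ` closed_segment x y \<subseteq> h ` T" unfolding segment_map_onD[OF assms(1) xyF] .
    moreover have "closed_segment x y \<subseteq> F"
      by (rule closed_segment_subset[OF xyF assms(2)])
    ultimately show "closed_segment x y \<subseteq> T"
      using inj_on_image_subset_iff[OF assms(3) _ assms(4)] by blast
  qed
next
  assume "convex T" then show "convex (h ` T)"
    using assms segment_map_convex_image segment_map_on_subset by blast
qed

text \<open>The image of the hull of \<open>V\<close> is the hull of the image of \<open>V\<close>, since both the image of the hull and the preimage of
\<open>convex hull (h ` V)\<close> are convex.\<close>
lemma segment_map_polytope_image:
  assumes "segment_map_on F h" "polytope F" shows "polytope (h ` F)"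
proof -
  obtain V where V: "finite V" "F = convex hull V" using assms(2) by (auto simp: polytope_def)
  have VF: "V \<subseteq> F" by (simp add: V(2) hull_subset)
  have "h ` F = convex hull (h ` V)"
  proof
    show "convex hull (h ` V) \<subseteq> h ` F"
      using segment_map_convex_image[OF assms(1)] V VF by (intro hull_minimal) auto
    have "convex {x \<in> F. h x \<in> convex hull (h ` V)}"
    proof (rule convex_contains_segment[THEN iffD2], intro ballI, rule subsetI)
      fix x y z
      assume x: "x \<in> {x \<in> F. h x \<in> convex hull (h ` V)}" and y: "y \<in> {x \<in> F. h x \<in> convex hull (h ` V)}"
        and z: "z \<in> closed_segment x y"
      have xy: "x \<in> F" "y \<in> F" "h x \<in> convex hull (h ` V)" "h y \<in> convex hull (h ` V)" using x y by auto
      have "z \<in> F" using closed_segment_subset[OF xy(1,2) polytope_imp_convex[OF assms(2)]] z by blast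
      moreover have "h z \<in> closed_segment (h x) (h y)"
        using z unfolding segment_map_onD[OF assms(1) xy(1,2)] by blast
      ultimately show "z \<in> {x \<in> F. h x \<in> convex hull (h ` V)}"
        using closed_segment_subset[OF xy(3,4) convex_convex_hull] by blast
    qed
    then have "convex hull V \<subseteq> {x \<in> F. h x \<in> convex hull (h ` V)}"
      using VF by (intro hull_minimal) (auto simp: hull_inc)
    then show "h ` F \<subseteq> convex hull (h ` V)" using V(2) by auto
  qed
  then show ?thesis using V(1) by (auto simp: polytope_def)
qed

lemma segment_map_open_segment:
  assumes "segment_map_on F h" "convex F" "inj_on h F" "x \<in> F" "y \<in> F" "z \<in> F"
  shows "h z \<in> open_segment (h x) (h y) \<longleftrightarrow> z \<in> open_segment x y"
proof -
  have sub: "closed_segment x y \<subseteq> F" using assms by (simp add: closed_segment_subset)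
  have "h z \<in> closed_segment (h x) (h y) \<longleftrightarrow> z \<in> closed_segment x y"
    unfolding segment_map_onD[OF assms(1,4,5)] by (rule inj_on_image_mem_iff[OF assms(3,6) sub])
  moreover have "h z = h x \<longleftrightarrow> z = x" "h z = h y \<longleftrightarrow> z = y"
    using inj_on_eq_iff[OF assms(3)] assms(4-6) by auto
  ultimately show ?thesis by (simp add: open_segment_def)
qed

lemma segment_map_face_iff:
  assumes "segment_map_on F h" "convex F" "inj_on h F" "T \<subseteq> F"
  shows "h ` T face_of h ` F \<longleftrightarrow> T face_of F"
proof -
  have mem: "h x \<in> h ` T \<longleftrightarrow> x \<in> T" if "x \<in> F" for x
    by (rule inj_on_image_mem_iff[OF assms(3) that assms(4)])
  have seg: "h x \<in> open_segment (h a) (h b) \<longleftrightarrow> x \<in> open_segment a b" if "a \<in> F" "b \<in> F" "x \<in> T" for a b x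
    using segment_map_open_segment[OF assms(1-3) that(1,2)] that(3) assms(4) by blast
  have "(\<forall>a\<in>h ` F. \<forall>b\<in>h ` F. \<forall>x\<in>h ` T. x \<in> open_segment a b \<longrightarrow> a \<in> h ` T \<and> b \<in> h ` T) \<longleftrightarrow>
        (\<forall>a\<in>F. \<forall>b\<in>F. \<forall>x\<in>T. x \<in> open_segment a b \<longrightarrow> a \<in> T \<and> b \<in> T)"
    by (simp add: seg mem cong: ball_cong)
  then show ?thesis
    using segment_map_convex_iff[OF assms] assms(4) unfolding face_of_def by (auto simp: image_mono)
qed

lemma segment_map_faces:
  assumes "segment_map_on F h" "convex F" "inj_on h F"
  shows "face_lattice_iso F (h ` F) ((`) h)"
  unfolding face_lattice_iso_def poset_iso_def faces_def
proof (intro conjI ballI)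
  have sub: "\<And>T. T face_of F \<Longrightarrow> T \<subseteq> F" by (rule face_of_imp_subset)
  show "bij_betw ((`) h) {T. T face_of F} {T. T face_of h ` F}"
    unfolding bij_betw_def
  proof (intro conjI)
    show "inj_on ((`) h) {T. T face_of F}"
      by (rule inj_onI) (use inj_on_image_eq_iff[OF assms(3) sub sub] in auto)
    show "(`) h ` {T. T face_of F} = {T. T face_of h ` F}"
    proof (intro equalityI subsetI)
      fix T assume "T \<in> {T. T face_of h ` F}"
      then have "T face_of h ` F" by simp
      moreover from this obtain T' where "T' \<subseteq> F" "T = h ` T'"
        using face_of_imp_subset subset_image_iff by metis
      ultimately show "T \<in> (`) h ` {T. T face_of F}" using segment_map_face_iff[OF assms] by auto
    qed (use segment_map_face_iff[OF assms sub] in auto)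
  qed
  fix S T assume "S \<in> {T. T face_of F}" "T \<in> {T. T face_of F}"
  then show "S \<subseteq> T \<longleftrightarrow> h ` S \<subseteq> h ` T"
    using inj_on_image_subset_iff[OF assms(3) sub sub] by simp
qed

lemma polytopal_complex_of_faces:
  fixes P :: "'a::euclidean_space set"
  assumes "polytope P" "\<And>F. F \<in> S \<Longrightarrow> F face_of P" "\<And>F G. F \<in> S \<Longrightarrow> G face_of F \<Longrightarrow> G \<in> S"
  shows "polytopal_complex S"
  unfolding polytopal_complex_def
proof (intro conjI ballI allI impI)
  show "finite S"
    by (rule finite_subset[OF _ finite_polytope_faces[OF assms(1)]]) (use assms(2) in auto)
  show "polytope F" if "F \<in> S" for F using that assms face_of_polytope_polytope by blast
  show "G \<in> S" if "F \<in> S" "G face_of F" for F G using that assms by blast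
  fix F G assume "F \<in> S" "G \<in> S"
  then have *: "F face_of P" "G face_of P" "(F \<inter> G) face_of P" using assms by (auto intro: face_of_Int)
  show "(F \<inter> G) face_of F" "(F \<inter> G) face_of G"
    using * face_of_imp_subset by (blast intro: face_of_subset)+
qed

text \<open>Injectivity on the whole union, not merely on each cell, is what turns intersections of images into
images of intersections.\<close>
lemma polytopal_complex_image:
  assumes S: "polytopal_complex S" and inj: "inj_on h (\<Union>S)" and seg: "\<And>F. F \<in> S \<Longrightarrow> segment_map_on F h"
  shows "polytopal_complex ((`) h ` S)" "poset_iso S (\<subseteq>) ((`) h ` S) (\<subseteq>) ((`) h)"
proof -
  have conv: "convex F" if "F \<in> S" for F using that S polytope_imp_convex by (auto simp: polytopal_complex_def)
  have injF: "inj_on h F" if "F \<in> S" for F by (rule inj_on_subset[OF inj]) (use that in auto)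
  note faceiff = segment_map_face_iff[OF seg conv injF]
  show "polytopal_complex ((`) h ` S)"
    unfolding polytopal_complex_def
  proof (intro conjI ballI allI impI)
    show "finite ((`) h ` S)" using S by (simp add: polytopal_complex_def)
    show "polytope G" if "G \<in> (`) h ` S" for G
      using that S seg segment_map_polytope_image by (auto simp: polytopal_complex_def)
    show "T \<in> (`) h ` S" if G: "G \<in> (`) h ` S" and T: "T face_of G" for G T
    proof -
      obtain F where F: "F \<in> S" "G = h ` F" using G by auto
      obtain T' where T': "T' \<subseteq> F" "T = h ` T'" using T F face_of_imp_subset subset_image_iff by metis
      then have "T' face_of F" using faceiff F T by metis
      then show ?thesis using S F T' by (auto simp: polytopal_complex_def)
    qed
    fix G G' assume "G \<in> (`) h ` S" "G' \<in> (`) h ` S"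
    then obtain F F' where F: "F \<in> S" "G = h ` F" "F' \<in> S" "G' = h ` F'" by auto
    have "G \<inter> G' = h ` (F \<inter> F')" using F by (simp add: inj_on_image_Int[OF inj] Union_upper)
    then show "(G \<inter> G') face_of G" "(G \<inter> G') face_of G'"
      using F faceiff[of F "F \<inter> F'"] faceiff[of F' "F \<inter> F'"] S by (auto simp: polytopal_complex_def)
  qed
  have sub: "h ` F \<subseteq> h ` G \<longleftrightarrow> F \<subseteq> G" if "F \<in> S" "G \<in> S" for F G
    by (rule inj_on_image_subset_iff[OF inj]) (use that in auto)
  have "inj_on ((`) h) S" by (rule inj_onI) (use sub in blast)
  then show "poset_iso S (\<subseteq>) ((`) h ` S) (\<subseteq>) ((`) h)"
    using sub by (auto simp: poset_iso_def bij_betw_def)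
qed

section \<open>Polar duality\<close>

lemma face_of_polytope_supporting:
  fixes P :: "'a::euclidean_space set"
  assumes P: "polytope P" "0 \<in> interior P" and F: "F face_of P" "F \<noteq> {}" "F \<noteq> P"
  obtains f where "\<And>x. x \<in> P \<Longrightarrow> x \<bullet> f \<le> 1" "F = {x \<in> P. x \<bullet> f = 1}"
proof -
  have "F exposed_face_of P" using P F exposed_face_of_polyhedron polytope_imp_polyhedron by blast
  then obtain n c where n: "P \<subseteq> {x. n \<bullet> x \<le> c}" "F = P \<inter> {x. n \<bullet> x = c}"
    by (auto simp: exposed_face_of_def)
  have n0: "n \<noteq> 0" using n F by auto
  obtain r where r: "r > 0" "cball 0 r \<subseteq> P" using P(2) mem_interior_cball by blast
  have "(r / norm n) *\<^sub>R n \<in> P" using r n0 by (intro subsetD[OF r(2)]) simp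
  then have "n \<bullet> ((r / norm n) *\<^sub>R n) \<le> c" using n by blast
  moreover have "n \<bullet> ((r / norm n) *\<^sub>R n) > 0" using r n0 by simp
  ultimately have c: "c > 0" by linarith
  show thesis
  proof
    show "x \<bullet> (n /\<^sub>R c) \<le> 1" if "x \<in> P" for x
      using n(1) that c by (auto simp: inner_commute field_simps)
    show "F = {x \<in> P. x \<bullet> (n /\<^sub>R c) = 1}" using n(2) c by (auto simp: inner_commute field_simps)
  qed
qed

definition polar :: "'a::euclidean_space set \<Rightarrow> 'a set" where
  "polar P = {y. \<forall>x\<in>P. x \<bullet> y \<le> 1}"

lemma polytope_polar:
  fixes P :: "'a::euclidean_space set"
  assumes "polytope P" "0 \<in> interior P"
  shows "polytope (polar P)" "0 \<in> interior (polar P)"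
proof -
  obtain V where V: "finite V" "P = convex hull V" using assms by (auto simp: polytope_def)
  have "polar P = {y. \<forall>x\<in>V. x \<bullet> y \<le> 1}"
  proof (intro equalityI subsetI)
    fix y assume "y \<in> {y. \<forall>x\<in>V. x \<bullet> y \<le> 1}"
    then have "convex hull V \<subseteq> {x. y \<bullet> x \<le> 1}"
      by (intro hull_minimal convex_halfspace_le) (auto simp: inner_commute)
    then show "y \<in> polar P" using V by (auto simp: polar_def inner_commute)
  qed (use V in \<open>auto simp: polar_def hull_inc\<close>)
  also have "\<dots> = \<Inter>((\<lambda>x. {y. x \<bullet> y \<le> 1}) ` V)" by auto
  also have "polyhedron \<dots>" using V by (intro polyhedron_Inter) (auto simp: polyhedron_halfspace_le)
  finally have "polyhedron (polar P)" .
  moreover have "bounded (polar P)"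
  proof -
    obtain r where r: "r > 0" "cball 0 r \<subseteq> P" using assms(2) mem_interior_cball by blast
    have "norm y \<le> 1 / r" if y: "y \<in> polar P" for y
    proof (cases "y = 0")
      case False
      have "(r / norm y) *\<^sub>R y \<in> P" using r False by (intro subsetD[OF r(2)]) simp
      then have "((r / norm y) *\<^sub>R y) \<bullet> y \<le> 1" using y by (auto simp: polar_def)
      then show ?thesis using r False by (simp add: dot_square_norm power2_eq_square field_simps)
    qed (use r in simp)
    then show ?thesis unfolding bounded_iff by blast
  qed
  ultimately show "polytope (polar P)" by (simp add: polytope_eq_bounded_polyhedron)
  obtain B where B: "B > 0" "\<And>x. x \<in> P \<Longrightarrow> norm x \<le> B"
    using polytope_imp_bounded[OF assms(1)] bounded_pos by metis
  have "ball 0 (1 / B) \<subseteq> polar P"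
  proof
    fix y :: 'a assume y: "y \<in> ball 0 (1 / B)"
    have "x \<bullet> y \<le> 1" if "x \<in> P" for x
    proof -
      have "x \<bullet> y \<le> norm x * norm y" by (rule norm_cauchy_schwarz)
      also have "\<dots> \<le> B * (1 / B)" using B y that by (intro mult_mono) auto
      finally show ?thesis using B by simp
    qed
    then show "y \<in> polar P" by (simp add: polar_def)
  qed
  then show "0 \<in> interior (polar P)" using B(1) by (meson centre_in_ball interior_maximal open_ball subsetD divide_pos_pos zero_less_one)
qed

text \<open>A point outside \<open>P\<close> is separated from \<open>P\<close> by a hyperplane; as \<open>P\<close> contains \<open>0\<close>, the normal can be scaled to a point of the
polar that excludes it.\<close>
lemma polar_polar:
  fixes P :: "'a::euclidean_space set"
  assumes "polytope P" "0 \<in> interior P"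
  shows "polar (polar P) = P"
proof (intro equalityI subsetI)
  fix x assume x: "x \<in> polar (polar P)"
  show "x \<in> P"
  proof (rule ccontr)
    assume "x \<notin> P"
    then obtain n c where nc: "n \<bullet> x < c" "\<forall>y\<in>P. n \<bullet> y > c"
      using separating_hyperplane_closed_point[of P x] assms polytope_imp_convex polytope_imp_closed by metis
    have "0 \<in> P" using assms interior_subset by blast
    then have c: "c < 0" using nc by auto
    have "n /\<^sub>R c \<in> polar P" using nc(2) c by (auto simp: polar_def inner_commute field_simps less_imp_le)
    then have "(n /\<^sub>R c) \<bullet> x \<le> 1" using x unfolding polar_def[of "polar P"] by blast
    then show False using nc(1) c by (simp add: field_simps)
  qed
qed (auto simp: polar_def inner_commute)

definition polar_face :: "'a::euclidean_space set \<Rightarrow> 'a set \<Rightarrow> 'a set" where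
  "polar_face P F = {y \<in> polar P. \<forall>x\<in>F. x \<bullet> y = 1}"

lemma polar_face_face_of:
  fixes P :: "'a::euclidean_space set"
  assumes "polytope P" "0 \<in> interior P" "F \<subseteq> P"
  shows "polar_face P F face_of polar P"
proof (cases "F = {}")
  case True
  then show ?thesis
    using polytope_polar(1)[OF assms(1,2)] by (simp add: polar_face_def face_of_refl polytope_imp_convex)
next
  case False
  have *: "(polar P \<inter> {y. x \<bullet> y = 1}) face_of polar P" if "x \<in> F" for x
    by (rule face_of_Int_supporting_hyperplane_le)
      (use that assms polytope_polar(1)[OF assms(1,2)] in \<open>auto simp: polar_def polytope_imp_convex\<close>)
  have "polar_face P F = \<Inter>((\<lambda>x. polar P \<inter> {y. x \<bullet> y = 1}) ` F)"
    using False by (auto simp: polar_face_def)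
  then show ?thesis using False * by (simp only:) (rule face_of_Inter, auto)
qed

text \<open>A proper nonempty face is cut out by one supporting hyperplane, whose normal, scaled to right-hand side
\<open>1\<close>, is a point of the polar face and separates the points of \<open>F\<close> from all other points of \<open>P\<close>.\<close>
lemma polar_face_involution:
  fixes P :: "'a::euclidean_space set"
  assumes P: "polytope P" "0 \<in> interior P" and F: "F face_of P"
  shows "polar_face (polar P) (polar_face P F) = F"
proof -
  have 0: "0 \<in> P" "0 \<in> polar P" using P interior_subset by (auto simp: polar_def)
  have sub: "F \<subseteq> P" by (rule face_of_imp_subset[OF F])
  have eq: "polar_face (polar P) (polar_face P F) = {x \<in> P. \<forall>y\<in>polar_face P F. x \<bullet> y = 1}"
    by (simp add: polar_face_def[of "polar P"] polar_polar[OF P] inner_commute)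
  consider "F = {}" | "F = P" | "F \<noteq> {}" "F \<noteq> P" by blast
  then show ?thesis
  proof cases
    case 1
    have "\<exists>y\<in>polar P. x \<bullet> y \<noteq> 1" for x by (rule bexI[OF _ 0(2)]) simp
    with 1 show ?thesis unfolding eq by (simp add: polar_face_def)
  next
    case 2
    have "\<exists>x\<in>P. x \<bullet> y \<noteq> 1" for y by (rule bexI[OF _ 0(1)]) simp
    with 2 have "polar_face P F = {}" by (simp add: polar_face_def)
    then show ?thesis using 2 unfolding eq by simp
  next
    case 3
    obtain f where f: "\<And>x. x \<in> P \<Longrightarrow> x \<bullet> f \<le> 1" "F = {x \<in> P. x \<bullet> f = 1}"
      using face_of_polytope_supporting[OF P F 3] by metis
    then have "f \<in> polar_face P F" by (auto simp: polar_face_def polar_def)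
    then have "{x \<in> P. \<forall>y\<in>polar_face P F. x \<bullet> y = 1} \<subseteq> F" using f(2) by auto
    then show ?thesis using sub unfolding eq by (auto simp: polar_face_def)
  qed
qed

lemma dual_polytope_polar:
  fixes P :: "'a::euclidean_space set"
  assumes P: "polytope P" "0 \<in> interior P"
  shows "dual_polytope P (polar P)"
proof -
  note D = polytope_polar[OF P]
  note inv = polar_face_involution[OF P] and inv' = polar_face_involution[OF D]
  have anti: "F \<subseteq> G \<Longrightarrow> polar_face R G \<subseteq> polar_face R F" for F G R :: "'a set"
    by (auto simp: polar_face_def)
  have "bij_betw (polar_face P) (faces P) (faces (polar P))"
    by (rule bij_betwI[where g = "polar_face (polar P)"])
      (use inv inv' polar_polar[OF P] polar_face_face_of[OF P] polar_face_face_of[OF D]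
        in \<open>auto simp: faces_def face_of_imp_subset\<close>)
  moreover have "F \<subseteq> G \<longleftrightarrow> polar_face P G \<subseteq> polar_face P F" if "F \<in> faces P" "G \<in> faces P" for F G
    using that inv anti unfolding faces_def by (metis mem_Collect_eq)
  ultimately show ?thesis using D(1) unfolding dual_polytope_def poset_iso_def by blast
qed

section \<open>Schlegel diagrams\<close>

lemma hyperplane_subset_imp_parallel:
  fixes m n :: "'a::euclidean_space"
  assumes m: "m \<noteq> 0" and sub: "{x. m \<bullet> x = k} \<subseteq> {x. n \<bullet> x = c}"
  obtains \<mu> where "n = \<mu> *\<^sub>R m" "c = \<mu> * k"
proof -
  define \<mu> where "\<mu> = (n \<bullet> m) / (m \<bullet> m)"
  define x where "x = (k / (m \<bullet> m)) *\<^sub>R m"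
  define w where "w = n - \<mu> *\<^sub>R m"
  have x: "m \<bullet> x = k" using m by (simp add: x_def)
  have mw: "m \<bullet> w = 0" using m by (simp add: w_def \<mu>_def inner_diff_right inner_commute)
  have "x \<in> {x. n \<bullet> x = c}" by (rule subsetD[OF sub]) (use x in simp)
  moreover have "x + w \<in> {x. n \<bullet> x = c}" by (rule subsetD[OF sub]) (use x mw in \<open>simp add: inner_add_right\<close>)
  ultimately have nx: "n \<bullet> x = c" and nw: "n \<bullet> w = 0" by (auto simp: inner_add_right)
  have "w \<bullet> w = (n - \<mu> *\<^sub>R m) \<bullet> w" by (simp add: w_def[symmetric])
  then have "w \<bullet> w = n \<bullet> w - \<mu> * (m \<bullet> w)" by (simp add: inner_diff_left)
  then have "w = 0" using nw mw by simp
  then have n: "n = \<mu> *\<^sub>R m" by (simp add: w_def)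
  moreover have "c = \<mu> * k" using nx x n by simp
  ultimately show thesis using that by blast
qed

lemma facet_affine_hull_hyperplane:
  fixes D :: "'a::euclidean_space set"
  assumes D: "aff_dim D = DIM('a)" and F: "F facet_of D"
  obtains m k where "m \<noteq> 0" "affine hull F = {x. m \<bullet> x = k}"
proof -
  have "aff_dim F = int (DIM('a) - 1)" using D F DIM_positive[where 'a='a] by (simp add: facet_of_def)
  then obtain m k where "m \<noteq> 0 \<and> affine hull F = {x. m \<bullet> x = k}"
    using aff_dim_eq_hyperplane[of F] by auto
  then show thesis using that by blast
qed

text \<open>In a full-dimensional polytope a facet spans a hyperplane, and so it determines its inequality up to a positive factor.
This reduces the condition of lying beyond a facet, which quantifies over all supporting
inequalities, to one inequality per facet.\<close>
lemma facet_inequality_unique: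
  fixes D :: "'a::euclidean_space set"
  assumes D: "aff_dim D = DIM('a)" and F: "F facet_of D"
    and 1: "D \<subseteq> {x. n \<bullet> x \<le> c}" "F = D \<inter> {x. n \<bullet> x = c}"
    and 2: "D \<subseteq> {x. n' \<bullet> x \<le> c'}" "F = D \<inter> {x. n' \<bullet> x = c'}"
  obtains \<mu> where "\<mu> > 0" "n' = \<mu> *\<^sub>R n" "c' = \<mu> * c"
proof -
  obtain m k where m: "m \<noteq> 0" "affine hull F = {x. m \<bullet> x = k}"
    using facet_affine_hull_hyperplane[OF D F] .
  have sub: "{x. m \<bullet> x = k} \<subseteq> {x. p \<bullet> x = d}" if "F = D \<inter> {x. p \<bullet> x = d}" for p d
    unfolding m(2)[symmetric] by (rule hull_minimal) (use that in \<open>auto simp: affine_hyperplane\<close>)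
  obtain \<nu> where \<nu>: "n = \<nu> *\<^sub>R m" "c = \<nu> * k" using hyperplane_subset_imp_parallel[OF m(1) sub[OF 1(2)]] .
  obtain \<nu>' where \<nu>': "n' = \<nu>' *\<^sub>R m" "c' = \<nu>' * k" using hyperplane_subset_imp_parallel[OF m(1) sub[OF 2(2)]] .
  have "F \<noteq> D" "F \<subseteq> D" using F by (auto simp: facet_of_def face_of_imp_subset)
  then obtain p where p: "p \<in> D" "p \<notin> F" by blast
  have "n \<bullet> p < c" "n' \<bullet> p < c'" using p 1 2 by (auto simp: less_le)
  then have lt: "\<nu> * (m \<bullet> p - k) < 0" "\<nu>' * (m \<bullet> p - k) < 0" by (auto simp: \<nu> \<nu>' algebra_simps)
  show thesis
  proof
    show "\<nu>' / \<nu> > 0" using lt by (auto simp: mult_less_0_iff zero_less_divide_iff)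
    have "\<nu> \<noteq> 0" using lt by auto
    then show "n' = (\<nu>' / \<nu>) *\<^sub>R n" "c' = \<nu>' / \<nu> * c" by (auto simp: \<nu> \<nu>')
  qed
qed

lemma face_of_polytope_inequality:
  fixes D :: "'a::euclidean_space set"
  assumes "polytope D" "F face_of D"
  obtains n c where "D \<subseteq> {x. n \<bullet> x \<le> c}" "F = D \<inter> {x. n \<bullet> x = c}"
proof -
  have "F exposed_face_of D" using assms exposed_face_of_polyhedron polytope_imp_polyhedron by blast
  then show thesis using that by (auto simp: exposed_face_of_def)
qed

text \<open>A relative interior point of \<open>G\<close> is strictly inside all other facet inequalities. A short step outwards
from it violates only the inequality of \<open>G\<close>.\<close>
lemma beyond_facet_exists:
  fixes D :: "'a::euclidean_space set"
  assumes D: "polytope D" "aff_dim D = DIM('a)" and G: "G facet_of D"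
  obtains z where "beyond_facet D G z"
proof -
  have "\<forall>F\<in>{F. F facet_of D}. \<exists>nc. D \<subseteq> {x. fst nc \<bullet> x \<le> snd nc} \<and> F = D \<inter> {x. fst nc \<bullet> x = snd nc}"
    using face_of_polytope_inequality[OF D(1)] by (metis facet_of_imp_face_of fst_conv snd_conv mem_Collect_eq)
  from bchoice[OF this] obtain nc where
    nc: "\<forall>F\<in>{F. F facet_of D}. D \<subseteq> {x. fst (nc F) \<bullet> x \<le> snd (nc F)} \<and> F = D \<inter> {x. fst (nc F) \<bullet> x = snd (nc F)}" ..
  define N where "N = (\<lambda>F. fst (nc F))"
  define C where "C = (\<lambda>F. snd (nc F))"
  have NC: "D \<subseteq> {x. N F \<bullet> x \<le> C F}" "F = D \<inter> {x. N F \<bullet> x = C F}" if "F facet_of D" for F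
    using nc that unfolding N_def C_def by blast+
  have GD: "G face_of D" "G \<noteq> {}" "G \<subseteq> D" "convex G" "G \<noteq> D"
    using G face_of_imp_subset face_of_imp_convex by (auto simp: facet_of_def)
  obtain g where g: "g \<in> rel_interior G" using GD rel_interior_eq_empty by blast
  have gG: "g \<in> G" using g rel_interior_subset by blast
  have N0: "N G \<bullet> N G > 0"
  proof (rule ccontr)
    assume "\<not> N G \<bullet> N G > 0"
    then have z: "N G = 0" by simp
    have "N G \<bullet> g = C G" using NC(2)[OF G] gG by blast
    then have "C G = 0" using z by simp
    then have "G = D" using z NC(2)[OF G] by auto
    then show False using GD by blast
  qed
  have lt: "N F \<bullet> g < C F" if F: "F facet_of D" "F \<noteq> G" for F
  proof (rule ccontr)
    assume "\<not> N F \<bullet> g < C F"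
    then have eq: "N F \<bullet> g = C F" using NC(1)[OF F(1)] gG GD by force
    have "G \<subseteq> F"
    proof
      fix y assume y: "y \<in> G"
      have "N F \<bullet> y = C F"
        by (rule rel_interior_max_const[OF GD(4) g y _ eq]) (use NC(1)[OF F(1)] GD in auto)
      then show "y \<in> F" using y GD NC(2)[OF F(1)] by blast
    qed
    moreover have "F face_of D" using F by (simp add: facet_of_def)
    ultimately have "G face_of F" using GD face_of_subset face_of_imp_subset by metis
    then have "aff_dim G < aff_dim F"
      using F face_of_aff_dim_lt face_of_imp_convex[OF \<open>F face_of D\<close>] by metis
    then show False using F G by (simp add: facet_of_def)
  qed
  have "\<forall>\<^sub>F r in at_right (0::real). \<forall>F\<in>{F. F facet_of D}. F \<noteq> G \<longrightarrow> N F \<bullet> (g + r *\<^sub>R N G) < C F"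
  proof (rule eventually_ball_finite[OF finite_polytope_facets[OF D(1)]], rule ballI)
    fix F assume F: "F \<in> {F. F facet_of D}"
    show "\<forall>\<^sub>F r in at_right (0::real). F \<noteq> G \<longrightarrow> N F \<bullet> (g + r *\<^sub>R N G) < C F"
    proof (cases "F = G")
      case False
      have "((\<lambda>r. N F \<bullet> (g + r *\<^sub>R N G)) \<longlongrightarrow> N F \<bullet> (g + 0 *\<^sub>R N G)) (at_right 0)"
        by (intro tendsto_intros)
      moreover have "N F \<bullet> (g + 0 *\<^sub>R N G) < C F" using lt F False by simp
      ultimately show ?thesis by (auto dest: order_tendstoD elim: eventually_mono)
    qed simp
  qed
  moreover have "\<forall>\<^sub>F r in at_right (0::real). 0 < r" by (simp add: eventually_at_right_less)
  ultimately have "\<forall>\<^sub>F r in at_right (0::real). 0 < r \<and>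
      (\<forall>F\<in>{F. F facet_of D}. F \<noteq> G \<longrightarrow> N F \<bullet> (g + r *\<^sub>R N G) < C F)"
    by eventually_elim auto
  then obtain r where "0 < r \<and> (\<forall>F\<in>{F. F facet_of D}. F \<noteq> G \<longrightarrow> N F \<bullet> (g + r *\<^sub>R N G) < C F)"
    using eventually_happens'[OF trivial_limit_at_right_real] by blast
  then have r: "r > 0" "\<And>F. F facet_of D \<Longrightarrow> F \<noteq> G \<Longrightarrow> N F \<bullet> (g + r *\<^sub>R N G) < C F" by auto
  define z where "z = g + r *\<^sub>R N G"
  have zG: "C G < N G \<bullet> z"
  proof -
    have "N G \<bullet> g = C G" using gG NC(2)[OF G] by blast
    then show ?thesis using r(1) N0 by (simp add: z_def inner_add_right)
  qed
  have "if F = G then c < n \<bullet> z else n \<bullet> z < c"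
    if F: "F facet_of D" and nc: "D \<subseteq> {x. n \<bullet> x \<le> c}" "F = D \<inter> {x. n \<bullet> x = c}" for n c F
  proof -
    obtain \<mu> where \<mu>: "\<mu> > 0" "n = \<mu> *\<^sub>R N F" "c = \<mu> * C F"
      using facet_inequality_unique[OF D(2) F NC[OF F] nc] .
    show ?thesis using \<mu> zG r(2)[OF F] by (auto simp: z_def)
  qed
  then show thesis using that[of z] G unfolding beyond_facet_def by blast
qed

lemma schlegel_map_formula:
  fixes G :: "'a::euclidean_space set"
  assumes G: "affine hull G = {x. n \<bullet> x = c}" and z: "n \<bullet> z > c" and x: "n \<bullet> x \<le> c"
  shows "schlegel_map G z x = z + ((n \<bullet> z - c) / (n \<bullet> z - n \<bullet> x)) *\<^sub>R (x - z)"
  unfolding schlegel_map_def G affine_hull_2_alt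
proof (rule the_equality)
  show "z + ((n \<bullet> z - c) / (n \<bullet> z - n \<bullet> x)) *\<^sub>R (x - z) \<in> {x. n \<bullet> x = c} \<and>
      z + ((n \<bullet> z - c) / (n \<bullet> z - n \<bullet> x)) *\<^sub>R (x - z) \<in> range (\<lambda>u. z + u *\<^sub>R (x - z))"
  proof
    define dd where "dd = n \<bullet> z - n \<bullet> x"
    have dd: "dd \<noteq> 0" "n \<bullet> (x - z) = - dd" using z x by (simp_all add: inner_diff_right dd_def)
    show "z + ((n \<bullet> z - c) / (n \<bullet> z - n \<bullet> x)) *\<^sub>R (x - z) \<in> {x. n \<bullet> x = c}"
      unfolding dd_def[symmetric] using dd by (simp add: inner_add_right)
  qed (rule rangeI)
  fix y assume "y \<in> {x. n \<bullet> x = c} \<and> y \<in> range (\<lambda>u. z + u *\<^sub>R (x - z))"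
  then obtain u where u: "y = z + u *\<^sub>R (x - z)" "n \<bullet> y = c" by auto
  then have "n \<bullet> z + u * (n \<bullet> x - n \<bullet> z) = c" by (simp add: inner_add_right inner_diff_right)
  then have "u * (n \<bullet> z - n \<bullet> x) = n \<bullet> z - c" by (simp add: algebra_simps)
  then have "u = (n \<bullet> z - c) / (n \<bullet> z - n \<bullet> x)" using z x by (simp add: eq_divide_eq)
  then show "y = z + ((n \<bullet> z - c) / (n \<bullet> z - n \<bullet> x)) *\<^sub>R (x - z)" using u by simp
qed

text \<open>Central projection is a projective map: it sends the convex combination of \<open>x\<close> and \<open>y\<close> with weight \<open>\<theta>\<close> to the
combination of their images with weight \<open>\<tau> = \<theta> * dy / ((1 - \<theta>) * dx + \<theta> * dy)\<close>, where
\<open>dx\<close> and \<open>dy\<close> measure the distance to the hyperplane parallel to the image through the centre. The map from \<open>\<theta>\<close> to \<open>\<tau>\<close> is a bijection of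
the unit interval.\<close>
lemma segment_map_on_central_projection:
  fixes n z :: "'a::real_inner" and h :: "'a \<Rightarrow> 'a"
  assumes d: "\<And>x. x \<in> A \<Longrightarrow> n \<bullet> x < n \<bullet> z"
    and h: "\<And>x. n \<bullet> x < n \<bullet> z \<Longrightarrow> h x = z + (d0 / (n \<bullet> z - n \<bullet> x)) *\<^sub>R (x - z)"
  shows "segment_map_on A h"
  unfolding segment_map_on_def
proof (intro ballI)
  fix x y assume xy: "x \<in> A" "y \<in> A"
  define dx where "dx = n \<bullet> z - n \<bullet> x"
  define dy where "dy = n \<bullet> z - n \<bullet> y"
  have pos: "dx > 0" "dy > 0" using d xy by (auto simp: dx_def dy_def)
  have hx: "h x = z + (d0 / dx) *\<^sub>R (x - z)" and hy: "h y = z + (d0 / dy) *\<^sub>R (y - z)"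
    using h d xy by (auto simp: dx_def dy_def)
  have key: "h ((1 - \<theta>) *\<^sub>R x + \<theta> *\<^sub>R y) = (1 - \<tau>) *\<^sub>R h x + \<tau> *\<^sub>R h y"
    if \<theta>: "0 \<le> \<theta>" "\<theta> \<le> 1" and \<tau>: "\<tau> * ((1 - \<theta>) * dx + \<theta> * dy) = \<theta> * dy" for \<theta> \<tau>
  proof -
    define w where "w = (1 - \<theta>) *\<^sub>R x + \<theta> *\<^sub>R y"
    define dw where "dw = (1 - \<theta>) * dx + \<theta> * dy"
    have dw: "n \<bullet> z - n \<bullet> w = dw"
      by (simp add: w_def dw_def dx_def dy_def inner_add_right algebra_simps)
    have dwpos: "dw > 0"
    proof (cases "\<theta> = 0")
      case False
      then have "\<theta> * dy > 0" "(1 - \<theta>) * dx \<ge> 0" using pos \<theta> by auto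
      then show ?thesis by (simp add: dw_def)
    qed (use pos in \<open>simp add: dw_def\<close>)
    have t: "\<tau> = \<theta> * dy / dw" "1 - \<tau> = (1 - \<theta>) * dx / dw"
      using \<tau> dwpos by (auto simp: dw_def field_simps)
    have "h w = z + (d0 / dw) *\<^sub>R (w - z)" using h[of w] dw dwpos by simp
    also have "w - z = (1 - \<theta>) *\<^sub>R (x - z) + \<theta> *\<^sub>R (y - z)" by (simp add: w_def algebra_simps)
    finally have 1: "h w = z + (d0 / dw) *\<^sub>R ((1 - \<theta>) *\<^sub>R (x - z) + \<theta> *\<^sub>R (y - z))" .
    have "(1 - \<tau>) *\<^sub>R h x + \<tau> *\<^sub>R h y = z + ((1 - \<tau>) * (d0 / dx)) *\<^sub>R (x - z) + (\<tau> * (d0 / dy)) *\<^sub>R (y - z)"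
      unfolding hx hy by (simp add: scaleR_add_right scaleR_left_diff_distrib)
    also have "(1 - \<tau>) * (d0 / dx) = (d0 / dw) * (1 - \<theta>)" unfolding t(2) using pos dwpos by simp
    also have "\<tau> * (d0 / dy) = (d0 / dw) * \<theta>" unfolding t(1) using pos dwpos by simp
    finally show ?thesis using 1 by (simp add: w_def scaleR_add_right)
  qed
  show "h ` closed_segment x y = closed_segment (h x) (h y)"
  proof (intro equalityI subsetI)
    fix v assume "v \<in> h ` closed_segment x y"
    then obtain \<theta> where \<theta>: "0 \<le> \<theta>" "\<theta> \<le> 1" "v = h ((1 - \<theta>) *\<^sub>R x + \<theta> *\<^sub>R y)"
      by (auto simp: in_segment)
    define \<tau> where "\<tau> = \<theta> * dy / ((1 - \<theta>) * dx + \<theta> * dy)"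
    have nn: "(1 - \<theta>) * dx \<ge> 0" "\<theta> * dy \<ge> 0" using pos \<theta> by auto
    have "(1 - \<theta>) * dx + \<theta> * dy > 0"
    proof (cases "\<theta> = 0")
      case False
      then have "\<theta> * dy > 0" using pos \<theta> by auto
      then show ?thesis using nn by simp
    qed (use pos in simp)
    then have "\<tau> * ((1 - \<theta>) * dx + \<theta> * dy) = \<theta> * dy" "0 \<le> \<tau>" "\<tau> \<le> 1"
      using nn by (auto simp: \<tau>_def)
    then show "v \<in> closed_segment (h x) (h y)" using key[OF \<theta>(1,2)] \<theta>(3) by (auto simp: in_segment)
  next
    fix v assume "v \<in> closed_segment (h x) (h y)"
    then obtain \<tau> where \<tau>: "0 \<le> \<tau>" "\<tau> \<le> 1" "v = (1 - \<tau>) *\<^sub>R h x + \<tau> *\<^sub>R h y"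
      by (auto simp: in_segment)
    define E where "E = \<tau> * dx + (1 - \<tau>) * dy"
    define \<theta> where "\<theta> = \<tau> * dx / E"
    have nn: "(1 - \<tau>) * dy \<ge> 0" "\<tau> * dx \<ge> 0" using pos \<tau> by auto
    have E: "E > 0"
    proof (cases "\<tau> = 0")
      case False
      then have "\<tau> * dx > 0" using pos \<tau> by auto
      then show ?thesis using nn by (simp add: E_def)
    qed (use pos in \<open>simp add: E_def\<close>)
    have 1: "1 - \<theta> = (1 - \<tau>) * dy / E" 
    proof -
      have "E - \<tau> * dx = (1 - \<tau>) * dy" by (simp add: E_def)
      moreover have "1 - \<theta> = (E - \<tau> * dx) / E" using E by (simp add: \<theta>_def diff_divide_distrib)
      ultimately show ?thesis by simp
    qed
    have "\<tau> * ((1 - \<theta>) * dx + \<theta> * dy) = \<theta> * dy"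
    proof -
      have "(1 - \<theta>) * dx + \<theta> * dy = dx * dy / E"
        unfolding 1 by (simp add: \<theta>_def add_divide_distrib[symmetric]) (simp add: algebra_simps)
      then show ?thesis by (simp add: \<theta>_def)
    qed
    moreover have "0 \<le> \<theta>" "\<theta> \<le> 1" using nn E by (auto simp: \<theta>_def) (simp add: E_def)
    ultimately show "v \<in> h ` closed_segment x y"
      using key \<tau>(3) by (auto simp: in_segment intro!: image_eqI[of _ _ "(1 - \<theta>) *\<^sub>R x + \<theta> *\<^sub>R y"])
  qed
qed

text \<open>A ray from \<open>z\<close> meets the facets other than \<open>G\<close> in at most one point: if \<open>y\<close> lay strictly between \<open>z\<close> and a
point of \<open>D\<close>, then the inequality of a facet that contains \<open>y\<close>, which is strict at \<open>z\<close>, would be strict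
at \<open>y\<close>. Dimension does not grow, because the image of \<open>X\<close> lies in the span of \<open>X\<close> and \<open>z\<close> and in a hyperplane that
misses \<open>z\<close>.\<close>
lemma schlegel_complex:
  fixes D :: "(real^4) set"
  assumes D: "polytope D" "aff_dim D = 4" and G: "G facet_of D"
    and S: "\<And>X. X \<in> S \<Longrightarrow> \<exists>F. F facet_of D \<and> F \<noteq> G \<and> X \<subseteq> F"
  obtains z and L :: "real^4 \<Rightarrow> real^3" where "beyond_facet D G z" "linear L" "inj_on L (affine hull G)"
    "inj_on (L \<circ> schlegel_map G z) (\<Union>S)" "\<And>X. X \<in> S \<Longrightarrow> segment_map_on X (L \<circ> schlegel_map G z)"
    "\<And>X. X \<in> S \<Longrightarrow> aff_dim ((L \<circ> schlegel_map G z) ` X) \<le> aff_dim X"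
proof -
  have D': "aff_dim D = int DIM(real^4)" using D by simp
  obtain z where z: "beyond_facet D G z" using beyond_facet_exists[OF D(1) D' G] .
  have Gf: "G face_of D" "G \<subseteq> D" "G \<noteq> D" using G by (auto simp: facet_of_def face_of_imp_subset)
  obtain n c where nc: "D \<subseteq> {x. n \<bullet> x \<le> c}" "G = D \<inter> {x. n \<bullet> x = c}"
    using face_of_polytope_inequality[OF D(1) Gf(1)] .
  have nz: "c < n \<bullet> z" using z G nc unfolding beyond_facet_def by metis
  have n0: "n \<noteq> 0"
  proof
    assume n: "n = 0"
    obtain g where "g \<in> G" using G by (auto simp: facet_of_def)
    then have "n \<bullet> g = c" using nc(2) by blast
    then have "c = 0" using n by simp
    then have "G = D" using n nc(2) by auto
    then show False using Gf by blast
  qed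
  have hullG: "affine hull G = {x. n \<bullet> x = c}"
  proof -
    obtain m k where m: "m \<noteq> 0" "affine hull G = {x. m \<bullet> x = k}"
      using facet_affine_hull_hyperplane[OF D' G] .
    have "{x. m \<bullet> x = k} \<subseteq> {x. n \<bullet> x = c}"
      unfolding m(2)[symmetric] by (rule hull_minimal) (use nc(2) in \<open>auto simp: affine_hyperplane\<close>)
    then obtain \<mu> where "n = \<mu> *\<^sub>R m" "c = \<mu> * k" using hyperplane_subset_imp_parallel[OF m(1)] by blast
    then show ?thesis using m n0 by auto
  qed
  define h where "h = schlegel_map G z"
  define d where "d x = n \<bullet> z - n \<bullet> x" for x
  have h: "h x = z + ((n \<bullet> z - c) / d x) *\<^sub>R (x - z)" if "n \<bullet> x \<le> c" for x
    using schlegel_map_formula[OF hullG nz that] by (simp add: h_def d_def)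
  have dpos: "d x > 0" if "x \<in> D" for x using that nc(1) nz by (auto simp: d_def)
  have SD: "X \<subseteq> D" if "X \<in> S" for X
    using S[OF that] face_of_imp_subset by (fastforce simp: facet_of_def)
  obtain L :: "real^4 \<Rightarrow> real^3" where L: "linear L" "\<And>x. n \<bullet> x = 0 \<Longrightarrow> norm (L x) = norm x"
  proof -
    have "subspace {x. n \<bullet> x = 0}" by (rule subspace_hyperplane)
    moreover have "dim {x. n \<bullet> x = 0} = dim (UNIV :: (real^3) set)" using n0 by (simp add: dim_hyperplane)
    ultimately show thesis
      by (rule isometries_subspaces[OF _ subspace_UNIV]) (use that in auto)
  qed
  have Linj: "inj_on L (affine hull G)"
  proof (rule inj_onI)
    fix x y assume "x \<in> affine hull G" "y \<in> affine hull G" "L x = L y"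
    then have "n \<bullet> (x - y) = 0" "L (x - y) = 0"
      by (auto simp: hullG inner_diff_right linear_diff[OF L(1)])
    then show "x = y" using L(2)[of "x - y"] by simp
  qed
  have hG: "h x \<in> affine hull G" if "x \<in> D" for x
  proof -
    have "n \<bullet> (x - z) = - d x" by (simp add: d_def inner_diff_right)
    moreover have "n \<bullet> x \<le> c" using that nc by auto
    ultimately show ?thesis using dpos[OF that] by (simp add: hullG h inner_add_right)
  qed
  have hinj1: "\<not> d y < d x" if x: "x \<in> D" and y: "y \<in> F" "F facet_of D" "F \<noteq> G" and eq: "h x = h y" for x y F
  proof
    assume lt: "d y < d x"
    have yD: "y \<in> D" using y face_of_imp_subset by (fastforce simp: facet_of_def)
    obtain m k where m: "D \<subseteq> {x. m \<bullet> x \<le> k}" "F = D \<inter> {x. m \<bullet> x = k}"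
      using face_of_polytope_inequality[OF D(1)] y(2) facet_of_imp_face_of by metis
    have mz: "m \<bullet> z < k" using z y m unfolding beyond_facet_def by metis
    have nxy: "n \<bullet> x \<le> c" "n \<bullet> y \<le> c" using x yD nc by auto
    have dx: "d x > 0" "d y > 0" using dpos x yD by auto
    define \<delta> where "\<delta> = n \<bullet> z - c"
    have \<delta>: "\<delta> > 0" using nz by (simp add: \<delta>_def)
    have "(\<delta> / d y) *\<^sub>R (y - z) = (\<delta> / d x) *\<^sub>R (x - z)" using eq h nxy by (simp add: \<delta>_def)
    then have "(d y / \<delta>) *\<^sub>R (\<delta> / d y) *\<^sub>R (y - z) = (d y / \<delta>) *\<^sub>R (\<delta> / d x) *\<^sub>R (x - z)" by simp
    then have "y - z = (d y / d x) *\<^sub>R (x - z)" using dx \<delta> by simp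
    then have "m \<bullet> (y - z) = (d y / d x) * (m \<bullet> (x - z))" by simp
    also have "\<dots> \<le> (d y / d x) * (k - m \<bullet> z)"
      using m(1) x dx by (intro mult_left_mono) (auto simp: inner_diff_right)
    also have "\<dots> < 1 * (k - m \<bullet> z)"
      using mz lt dx by (intro mult_strict_right_mono) auto
    finally have "m \<bullet> y < k" by (simp add: inner_diff_right)
    moreover have "m \<bullet> y = k" using m(2) y(1) by auto
    ultimately show False by simp
  qed
  have hinj: "inj_on h (\<Union>S)"
  proof (rule inj_onI)
    fix x y assume x: "x \<in> \<Union>S" and y: "y \<in> \<Union>S" and eq: "h x = h y"
    obtain X Y where XY: "X \<in> S" "x \<in> X" "Y \<in> S" "y \<in> Y" using x y by auto
    then have xy: "x \<in> D" "y \<in> D" using SD by blast+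
    obtain F where F: "F facet_of D" "F \<noteq> G" "x \<in> F" using S[OF XY(1)] XY(2) by blast
    obtain F' where F': "F' facet_of D" "F' \<noteq> G" "y \<in> F'" using S[OF XY(3)] XY(4) by blast
    have "d x = d y" using hinj1[OF xy(1) F'(3,1,2) eq] hinj1[OF xy(2) F(3,1,2) eq[symmetric]] by simp
    moreover have nxy: "n \<bullet> x \<le> c" "n \<bullet> y \<le> c" using xy nc(1) by auto
    ultimately have "((n \<bullet> z - c) / d y) *\<^sub>R (x - z) = ((n \<bullet> z - c) / d y) *\<^sub>R (y - z)"
      using eq h[OF nxy(1)] h[OF nxy(2)] by simp
    then show "x = y" using nz dpos[OF xy(2)] by simp
  qed
  have seg: "segment_map_on X h" if X: "X \<in> S" for X
    unfolding segment_map_on_def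
  proof (intro ballI)
    fix x y assume xy: "x \<in> X" "y \<in> X"
    define h' where "h' x = z + ((n \<bullet> z - c) / (n \<bullet> z - n \<bullet> x)) *\<^sub>R (x - z)" for x
    have xyD: "x \<in> D" "y \<in> D" using xy X SD by auto
    have "segment_map_on D h'"
      by (rule segment_map_on_central_projection[of D n z h' "n \<bullet> z - c"]) (use dpos in \<open>auto simp: h'_def d_def\<close>)
    then have "h' ` closed_segment x y = closed_segment (h' x) (h' y)"
      using segment_map_onD[OF _ xyD, of h'] by simp
    moreover have hh': "h' w = h w" if "w \<in> D" for w
    proof -
      have "n \<bullet> w \<le> c" using that nc(1) by blast
      then show ?thesis using h[of w] by (simp add: h'_def d_def)
    qed
    moreover have "closed_segment x y \<subseteq> D" by (rule closed_segment_subset[OF xyD polytope_imp_convex[OF D(1)]])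
    then have "h' ` closed_segment x y = h ` closed_segment x y" using hh' by (intro image_cong) auto
    ultimately show "h ` closed_segment x y = closed_segment (h x) (h y)"
      using hh'[OF xyD(1)] hh'[OF xyD(2)] by simp
  qed
  have dim: "aff_dim (h ` X) \<le> aff_dim X" if X: "X \<in> S" for X
  proof -
    have sub: "h ` X \<subseteq> affine hull (insert z X)"
    proof
      fix y assume "y \<in> h ` X"
      then obtain x where x: "x \<in> X" "y = h x" by auto
      then have "y = z + ((n \<bullet> z - c) / d x) *\<^sub>R (x - z)" using h SD[OF X] nc by blast
      then have "y \<in> affine hull {z, x}" by (auto simp: affine_hull_2_alt)
      moreover have "affine hull {z, x} \<subseteq> affine hull (insert z X)" using x by (intro hull_mono) auto
      ultimately show "y \<in> affine hull (insert z X)" by blast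
    qed
    have "h ` X \<subseteq> {x. n \<bullet> x = c}" using hG SD[OF X] hullG by auto
    then have "affine hull (h ` X) \<subseteq> {x. n \<bullet> x = c}" by (rule hull_minimal) (rule affine_hyperplane)
    then have "z \<notin> affine hull (h ` X)" using nz by auto
    moreover have "z \<in> affine hull (insert z X)" by (simp add: hull_inc)
    moreover have "affine hull (h ` X) \<subseteq> affine hull (insert z X)" using sub by (rule hull_minimal) simp
    ultimately have "affine hull (h ` X) \<subset> affine hull (insert z X)" by blast
    then have "aff_dim (h ` X) < aff_dim (insert z X)" by (rule aff_dim_psubset)
    also have "\<dots> \<le> aff_dim X + 1" by (simp add: aff_dim_insert)
    finally show ?thesis by simp
  qed
  show thesis
  proof (rule that[OF z L(1) Linj], unfold h_def[symmetric])
    show "inj_on (L \<circ> h) (\<Union>S)"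
      by (rule comp_inj_on[OF hinj]) (rule inj_on_subset[OF Linj], use hG SD in blast)
    show "segment_map_on X (L \<circ> h)" if "X \<in> S" for X
      using seg[OF that] unfolding segment_map_on_def image_comp[symmetric]
      by (simp add: closed_segment_linear_image[OF L(1)])
    show "aff_dim ((L \<circ> h) ` X) \<le> aff_dim X" if "X \<in> S" for X
    proof -
      have "aff_dim (L ` (h ` X)) \<le> aff_dim (h ` X)" by (rule aff_dim_linear_image_le[OF L(1)])
      then show ?thesis using dim[OF that] by (simp add: image_comp)
    qed
  qed
qed

section \<open>The polygon and the interval\<close>

lemma polyh_one: "polyh a (\<lambda>_. 1) = ineq_polyhedron a"
  by (simp add: polyh_def ineq_polyhedron_def)

text \<open>All facets have the same dimension, so an inclusion between two of them would be an equality.\<close>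
lemma facets_incomparable:
  assumes "facet_description a" "i \<noteq> k"
  shows "\<not> ineq_facet a i \<subseteq> ineq_facet a k"
proof
  assume sub: "ineq_facet a i \<subseteq> ineq_facet a k"
  have f: "ineq_facet a l facet_of ineq_polyhedron a" for l using assms by (simp add: facet_description_def)
  have "ineq_facet a i face_of ineq_facet a k"
  proof (rule face_of_subset[OF _ sub])
    show "ineq_facet a i face_of ineq_polyhedron a" using f[of i] by (simp add: facet_of_def)
    show "ineq_facet a k \<subseteq> ineq_polyhedron a" by (auto simp: ineq_facet_def)
  qed
  moreover have "ineq_facet a i \<noteq> ineq_facet a k" using assms by (auto simp: facet_description_def dest: injD)
  moreover have "convex (ineq_facet a k)" using f[of k] by (auto simp: facet_of_def face_of_imp_convex)
  ultimately have "aff_dim (ineq_facet a i) < aff_dim (ineq_facet a k)" by (simp add: face_of_aff_dim_lt)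
  then show False using f[of i] f[of k] by (simp add: facet_of_def)
qed

text \<open>If the normal of facet \<open>k\<close> were such a combination, then equality in \<open>k\<close> would force equality in \<open>l\<close>, and the
facet \<open>k\<close> would be contained in the facet \<open>l\<close>.\<close>
lemma no_redundant_combination:
  assumes fd: "facet_description a" and ik: "k \<noteq> l"
    and comb: "a k = s *\<^sub>R a l + t *\<^sub>R a i" and st: "s > 0" "t \<ge> 0" "s + t = 1"
  shows False
proof -
  have "ineq_facet a k \<subseteq> ineq_facet a l"
  proof
    fix y assume y: "y \<in> ineq_facet a k"
    then have le: "a l \<bullet> y \<le> 1" "a i \<bullet> y \<le> 1" and 1: "s * (a l \<bullet> y) + t * (a i \<bullet> y) = 1"
      using comb by (auto simp: ineq_facet_def ineq_polyhedron_def inner_add_left)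
    have "t * (a i \<bullet> y) \<le> t * 1" using le st by (intro mult_left_mono) auto
    then have "s * (a l \<bullet> y) \<ge> s * 1" using 1 st(3) by linarith
    then have "a l \<bullet> y \<ge> 1" using st by simp
    then show "y \<in> ineq_facet a l" using y le by (auto simp: ineq_facet_def)
  qed
  then show False using facets_incomparable[OF fd ik] by blast
qed

lemma inner_real2: "x \<bullet> y = x $ 1 * y $ 1 + x $ 2 * y $ 2" for x y :: "real^2"
  by (simp add: inner_vec_def sum_2)

definition det2 :: "real^2 \<Rightarrow> real^2 \<Rightarrow> real" where
  "det2 p q = p $ 1 * q $ 2 - p $ 2 * q $ 1"

text \<open>Cramer's rule.\<close>
lemma det2_decompose:
  assumes "det2 p q \<noteq> 0"
  shows "r = (det2 r q / det2 p q) *\<^sub>R p + (det2 p r / det2 p q) *\<^sub>R q"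
proof -
  have "det2 p q *\<^sub>R r = det2 r q *\<^sub>R p + det2 p r *\<^sub>R q"
    by (simp add: vec_eq_iff forall_2 det2_def algebra_simps)
  then have "(1 / det2 p q) *\<^sub>R det2 p q *\<^sub>R r = (1 / det2 p q) *\<^sub>R (det2 r q *\<^sub>R p + det2 p r *\<^sub>R q)" by simp
  then show ?thesis using assms by (simp add: scaleR_add_right)
qed

lemma det2_nonzero:
  fixes p q x :: "real^2"
  assumes "p \<bullet> x = 1" "q \<bullet> x = 1" "p \<noteq> q"
  shows "det2 p q \<noteq> 0"
proof
  assume 0: "det2 p q = 0"
  have px: "p $ 1 * x $ 1 + p $ 2 * x $ 2 = 1" and qx: "q $ 1 * x $ 1 + q $ 2 * x $ 2 = 1"
    using assms by (auto simp: inner_real2)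
  have d: "p $ 1 * q $ 2 = p $ 2 * q $ 1" using 0 by (simp add: det2_def)
  have "p $ 1 = q $ 1" using px qx d by algebra
  moreover have "p $ 2 = q $ 2" using px qx d by algebra
  ultimately show False using assms(3) by (simp add: vec_eq_iff forall_2)
qed

text \<open>Of three normals in the plane that take the value \<open>1\<close> at a common point, one is a convex combination of the other two.\<close>
lemma polygon_at_most_two_active:
  fixes a :: "'p::finite \<Rightarrow> real^2"
  assumes fd: "facet_description a"
    and act: "a i \<bullet> x = 1" "a k \<bullet> x = 1" "a l \<bullet> x = 1" and ne: "i \<noteq> k" "i \<noteq> l" "k \<noteq> l"
  shows False
proof -
  have inj: "a r \<noteq> a s" if "r \<noteq> s" for r s
    using facets_incomparable[OF fd that] by (auto simp: ineq_facet_def)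
  have nz: "det2 (a i) (a k) \<noteq> 0" by (rule det2_nonzero[OF act(1,2) inj[OF ne(1)]])
  define \<alpha> where "\<alpha> = det2 (a l) (a k) / det2 (a i) (a k)"
  define \<beta> where "\<beta> = det2 (a i) (a l) / det2 (a i) (a k)"
  have al: "a l = \<alpha> *\<^sub>R a i + \<beta> *\<^sub>R a k"
    using det2_decompose[OF nz, of "a l"] by (simp add: \<alpha>_def \<beta>_def)
  have "a l \<bullet> x = \<alpha> * (a i \<bullet> x) + \<beta> * (a k \<bullet> x)" unfolding al by (simp add: inner_add_left)
  then have sum: "\<alpha> + \<beta> = 1" using act by simp
  consider "\<alpha> \<le> 0" | "\<beta> \<le> 0" | "\<alpha> > 0" "\<beta> > 0" by linarith
  then show False
  proof cases
    case 1
    then have \<beta>: "\<beta> > 0" using sum by simp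
    have "(1 / \<beta>) *\<^sub>R a l + (- \<alpha> / \<beta>) *\<^sub>R a i = a k" unfolding al using \<beta> by (simp add: scaleR_add_right)
    moreover have "1 / \<beta> + - \<alpha> / \<beta> = 1" using \<beta> sum by (simp add: field_simps)
    ultimately show False
      using no_redundant_combination[OF fd ne(3), of "1 / \<beta>" "- \<alpha> / \<beta>" i] \<beta> 1
      by (simp add: divide_nonpos_pos)
  next
    case 2
    then have \<alpha>: "\<alpha> > 0" using sum by simp
    have "(1 / \<alpha>) *\<^sub>R a l + (- \<beta> / \<alpha>) *\<^sub>R a k = a i" unfolding al using \<alpha> by (simp add: scaleR_add_right)
    moreover have "1 / \<alpha> + - \<beta> / \<alpha> = 1" using \<alpha> sum by (simp add: field_simps)
    ultimately show False
      using no_redundant_combination[OF fd ne(2), of "1 / \<alpha>" "- \<beta> / \<alpha>" k] \<alpha> 2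
      by (simp add: divide_nonpos_pos)
  next
    case 3
    then show False using no_redundant_combination[OF fd _ al] ne(2) sum by auto
  qed
qed

lemma polygon_simple:
  fixes a :: "'p::finite \<Rightarrow> real^2"
  assumes fd: "facet_description a"
  shows "simple_system a (\<lambda>_. 1)"
  unfolding simple_system_def
proof
  fix X assume "X \<in> patterns a (\<lambda>_. 1)"
  then obtain x where X: "X = {k. a k \<bullet> x = 1}" by (auto simp: patterns_def active_def)
  show "regular a X"
    unfolding regular_def
  proof
    fix i assume i: "i \<in> X"
    then have ix: "a i \<bullet> x = 1" by (simp add: X)
    show "\<exists>v. a i \<bullet> v = 1 \<and> (\<forall>l\<in>X - {i}. a l \<bullet> v = 0)"
    proof (cases "\<exists>k\<in>X. k \<noteq> i")
      case True
      then obtain k where k: "a k \<bullet> x = 1" "k \<noteq> i" by (auto simp: X)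
      have "a k \<noteq> a i" using facets_incomparable[OF fd k(2)] by (auto simp: ineq_facet_def)
      then have nz: "det2 (a i) (a k) \<noteq> 0" using det2_nonzero[OF ix k(1)] by simp
      define v :: "real^2" where "v = (1 / det2 (a i) (a k)) *\<^sub>R (\<chi> j. if j = 1 then a k $ 2 else - a k $ 1)"
      have "a i \<bullet> (\<chi> j. if j = 1 then a k $ 2 else - a k $ 1) = det2 (a i) (a k)"
        by (simp add: inner_real2 det2_def)
      then have "a i \<bullet> v = (1 / det2 (a i) (a k)) * det2 (a i) (a k)"
        by (simp add: v_def)
      then have "a i \<bullet> v = 1" using nz by simp
      moreover have "a k \<bullet> v = 0" by (simp add: v_def inner_real2)
      moreover have "X - {i} = {k}"
        using polygon_at_most_two_active[OF fd ix k(1)] k by (auto simp: X)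
      ultimately show ?thesis by auto
    next
      case False
      then show ?thesis using ix by (intro exI[of _ x]) auto
    qed
  qed
qed

text \<open>If \<open>b j\<close> and \<open>b k\<close> had the same weak sign, the inequalities would leave a half-line.\<close>
lemma interval_opposite_signs:
  fixes b :: "2 \<Rightarrow> real"
  assumes fd: "facet_description b" and ne: "j \<noteq> k"
  shows "b j * b k < 0"
proof (rule ccontr)
  assume "\<not> b j * b k < 0"
  then have ge: "b j * b k \<ge> 0" by simp
  have "bounded (ineq_polyhedron b)" using fd by (simp add: facet_description_def polytope_imp_bounded)
  then obtain B where B: "B > 0" "\<And>y. y \<in> ineq_polyhedron b \<Longrightarrow> norm y \<le> B" by (auto simp: bounded_pos)
  have jk: "l = j \<or> l = k" for l using ne exhaust_2[of j] exhaust_2[of k] exhaust_2[of l] by auto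
  have "\<exists>s. \<bar>s\<bar> = 1 \<and> (\<forall>l. b l * s \<le> 0)"
  proof (cases "b j \<le> 0 \<and> b k \<le> 0")
    case True
    then have "b l * 1 \<le> 0" for l using jk[of l] by auto
    then show ?thesis by (intro exI[of _ 1]) auto
  next
    case False
    then have "b j \<ge> 0 \<and> b k \<ge> 0" using ge by (auto simp: zero_le_mult_iff)
    then have "b l * (-1) \<le> 0" for l using jk[of l] by auto
    then show ?thesis by (intro exI[of _ "-1"]) auto
  qed
  then obtain s :: real where s: "\<bar>s\<bar> = 1" "\<And>l. b l * s \<le> 0" by auto
  have "b l * (s * (B + 1)) \<le> 1" for l
  proof -
    have "(b l * s) * (B + 1) \<le> 0" using s(2)[of l] B(1) by (simp add: mult_nonpos_nonneg)
    then show ?thesis by (simp add: mult.assoc)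
  qed
  then have "s * (B + 1) \<in> ineq_polyhedron b" by (simp add: ineq_polyhedron_def)
  then have "\<bar>s * (B + 1)\<bar> \<le> B" using B(2) by auto
  then show False using s(1) B(1) by (simp add: abs_mult)
qed

section \<open>The deformed prism\<close>

type_synonym 'p ambient = "((real^2) \<times> (real^'p)) \<times> real"

locale wedge_data =
  fixes a :: "'p::finite \<Rightarrow> real^2" and b :: "2 \<Rightarrow> real" and e :: "nat \<Rightarrow> 'p"
  assumes polygon: "facet_description a" and interval: "facet_description b"
    and enum: "bij_betw e {..<CARD('p)} UNIV"
begin

definition pos :: "'p \<Rightarrow> nat" where
  "pos = inv_into {..<CARD('p)} e"

lemma pos: "pos i < CARD('p)" "e (pos i) = i" "k < CARD('p) \<Longrightarrow> pos (e k) = k"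
  using enum inv_into_into[of i e "{..<CARD('p)}"] f_inv_into_f[of i e "{..<CARD('p)}"]
    inv_into_f_f[of e "{..<CARD('p)}" k]
  by (auto simp: pos_def bij_betw_def)

text \<open>The chain starts with the prism coordinate and continues with the \<open>y\<close>-coordinates in the order of the
enumeration, shifted by one: the chain coordinate \<open>Suc k\<close> belongs to the edge \<open>e k\<close>.\<close>
definition chain_vec :: "nat \<Rightarrow> 'p ambient" where
  "chain_vec k = (case k of 0 \<Rightarrow> ((0, 0), 1) | Suc l \<Rightarrow> ((0, axis (e l) 1), 0))"

definition chain :: "'p ambient \<Rightarrow> nat \<Rightarrow> real" where
  "chain z k = chain_vec k \<bullet> z"

lemma chain_simps [simp]: "chain z 0 = snd z" "chain z (Suc k) = snd (fst z) $ e k"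
proof -
  obtain x y t where z: "z = ((x, y), t)" by (metis surj_pair)
  show "chain z 0 = snd z" "chain z (Suc k) = snd (fst z) $ e k"
    by (simp_all add: z chain_def chain_vec_def inner_axis')
qed

text \<open>For \<open>\<delta> = 0\<close> these are the normals of the prism over the wedge product; the deformation adds to the row of
each edge a multiple of the preceding chain coordinate. With right-hand sides \<open>1\<close> the interval factor is
\<open>[-1, 1]\<close>, so that \<open>0\<close> is an interior point.\<close>
definition rows :: "real \<Rightarrow> ('p \<times> 2) + bool \<Rightarrow> 'p ambient" where
  "rows \<delta> r = (case r of
      Inl ij \<Rightarrow> ((a (fst ij), b (snd ij) *\<^sub>R axis (fst ij) 1), 0) + \<delta> *\<^sub>R chain_vec (pos (fst ij))
    | Inr s \<Rightarrow> ((0, 0), if s then 1 else - 1))"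

lemma rows_inner:
  "rows \<delta> (Inl (i, j)) \<bullet> z = a i \<bullet> fst (fst z) + b j * snd (fst z) $ i + \<delta> * chain z (pos i)"
  "rows \<delta> (Inr s) \<bullet> z = (if s then snd z else - snd z)"
proof -
  obtain x y t where z: "z = ((x, y), t)" by (metis surj_pair)
  show "rows \<delta> (Inl (i, j)) \<bullet> z = a i \<bullet> fst (fst z) + b j * snd (fst z) $ i + \<delta> * chain z (pos i)"
    by (simp only: rows_def sum.case inner_add_left chain_def inner_scaleR_left fst_conv snd_conv)
      (simp add: z inner_axis')
  show "rows \<delta> (Inr s) \<bullet> z = (if s then snd z else - snd z)"
    by (simp add: z rows_def)
qed

lemma b_props: "b j \<noteq> 0" "j \<noteq> k \<Longrightarrow> b j * b k < 0" "j \<noteq> k \<Longrightarrow> b j \<noteq> b k"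
proof -
  have "j + 1 \<noteq> j" by simp
  then have "b (j + 1) * b j < 0" by (rule interval_opposite_signs[OF interval])
  then show "b j \<noteq> 0" by auto
  show 1: "b j * b k < 0" if "j \<noteq> k" using interval_opposite_signs[OF interval that] .
  show "b j \<noteq> b k" if "j \<noteq> k" using 1[OF that] by (auto simp: mult_less_0_iff)
qed

text \<open>As \<open>b\<close> takes both signs, one of the two products \<open>b j * y\<close> is nonnegative.\<close>
lemma polygon_inequality:
  assumes "\<And>j. s + b j * y \<le> 1"
  shows "s \<le> 1"
proof (rule ccontr)
  assume "\<not> s \<le> 1"
  have neg: "b j * y < 0" for j using assms[of j] \<open>\<not> s \<le> 1\<close> by linarith
  have "b 0 * b 1 < 0" by (rule b_props(2)) simp
  then have "(b 0 * b 1) * (y * y) \<le> 0" by (simp add: mult_nonpos_nonneg less_imp_le)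
  moreover have "(b 0 * y) * (b 1 * y) > 0" using neg by (simp add: mult_neg_neg)
  ultimately show False by (simp add: algebra_simps)
qed

lemma polygon_of_rows:
  assumes "z \<in> polyh (rows 0) c" "\<And>i j. c (Inl (i, j)) = 1"
  shows "fst (fst z) \<in> polyh a (\<lambda>_. 1)"
proof -
  have "a i \<bullet> fst (fst z) \<le> 1" for i
  proof (rule polygon_inequality)
    fix j
    have "rows 0 (Inl (i, j)) \<bullet> z \<le> c (Inl (i, j))" using assms(1) unfolding polyh_def by blast
    then show "a i \<bullet> fst (fst z) + b j * snd (fst z) $ i \<le> 1" by (simp add: rows_inner assms(2))
  qed
  then show ?thesis by (simp add: polyh_def)
qed

lemma bounded_undeformed: "bounded (polyh (rows 0) (\<lambda>_. 1))"
proof -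
  have "bounded (ineq_polyhedron a)" using polygon by (simp add: facet_description_def polytope_imp_bounded)
  then obtain R where R: "R > 0" "\<And>x. x \<in> ineq_polyhedron a \<Longrightarrow> norm x \<le> R" by (auto simp: bounded_pos)
  define M where "M i = (1 + norm (a i) * R) * (\<Sum>j\<in>UNIV. 1 / \<bar>b j\<bar>)" for i
  have "norm z \<le> R + (\<Sum>i\<in>UNIV. M i) + 1" if z: "z \<in> polyh (rows 0) (\<lambda>_. 1)" for z
  proof -
    obtain x y t where zz: "z = ((x, y), t)" by (metis surj_pair)
    have x: "norm x \<le> R" using R(2) polygon_of_rows[OF z] by (simp add: polyh_one zz)
    have row: "a i \<bullet> x + b j * y $ i \<le> 1" for i j
    proof -
      have "rows 0 (Inl (i, j)) \<bullet> z \<le> 1" using z unfolding polyh_def by blast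
      then show ?thesis by (simp add: rows_inner zz)
    qed
    have t: "\<bar>t\<bar> \<le> 1"
    proof -
      have "rows 0 (Inr s) \<bullet> z \<le> 1" for s using z unfolding polyh_def by blast
      from this[of True] this[of False] show ?thesis by (simp add: rows_inner zz)
    qed
    have y: "\<bar>y $ i\<bar> \<le> M i" for i
    proof -
      have ax: "1 - a i \<bullet> x \<le> 1 + norm (a i) * R"
      proof -
        have "- (a i \<bullet> x) \<le> norm (a i) * norm x" using Cauchy_Schwarz_ineq2[of "a i" x] by linarith
        also have "\<dots> \<le> norm (a i) * R" using x by (intro mult_left_mono) auto
        finally show ?thesis by simp
      qed
      obtain j where j: "b j * y $ i = \<bar>b j\<bar> * \<bar>y $ i\<bar>"
      proof -
        have "b 0 * b 1 < 0" by (rule b_props(2)) simp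
        then have "(b 0 > 0 \<and> b 1 < 0) \<or> (b 0 < 0 \<and> b 1 > 0)" by (auto simp: mult_less_0_iff)
        then show thesis using that[of 0] that[of 1] by (cases "y $ i \<ge> 0") (auto simp: abs_if)
      qed
      have "\<bar>b j\<bar> * \<bar>y $ i\<bar> \<le> 1 + norm (a i) * R" using row[of i j] j ax by linarith
      then have "\<bar>y $ i\<bar> \<le> (1 + norm (a i) * R) * (1 / \<bar>b j\<bar>)" using b_props(1)[of j] by (simp add: field_simps)
      also have "\<dots> \<le> M i" unfolding M_def using R(1)
        by (intro mult_left_mono member_le_sum) auto
      finally show ?thesis .
    qed
    have "norm z \<le> norm (x, y) + norm t" unfolding zz by (rule norm_Pair_le)
    also have "norm (x, y) \<le> norm x + norm y" by (rule norm_Pair_le)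
    also have "norm y \<le> (\<Sum>i\<in>UNIV. \<bar>y $ i\<bar>)" by (rule norm_le_l1_cart)
    also have "\<dots> \<le> (\<Sum>i\<in>UNIV. M i)" using y by (intro sum_mono)
    finally show ?thesis using x t by simp
  qed
  then show ?thesis unfolding bounded_iff by blast
qed

text \<open>At a point of the prism, an edge has both of its inequalities tight only if it is tight in the polygon, and then
\<open>y\<close> vanishes at this edge. In this case a dual vector combines a dual vector \<open>w\<close> of the polygon with
\<open>y\<close>-entries that compensate the effect of \<open>w\<close> on the edges with only one tight inequality. In all
other cases a multiple of a coordinate vector serves.\<close>
lemma simple_undeformed: "simple_system (rows 0) (\<lambda>_. 1)"
  unfolding simple_system_def
proof
  fix X assume "X \<in> patterns (rows 0) (\<lambda>_. 1)"
  then obtain z where z: "z \<in> polyh (rows 0) (\<lambda>_. 1)" and X: "X = active (rows 0) (\<lambda>_. 1) z"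
    by (auto simp: patterns_def)
  obtain x y t where zz: "z = ((x, y), t)" by (metis surj_pair)
  have XL: "Inl (i, j) \<in> X \<longleftrightarrow> a i \<bullet> x + b j * y $ i = 1" for i j
    by (simp add: X active_def rows_inner zz)
  have XR: "Inr s \<in> X \<longleftrightarrow> (if s then t else - t) = 1" for s
    by (simp add: X active_def rows_inner zz)
  have xP: "x \<in> polyh a (\<lambda>_. 1)" using polygon_of_rows[OF z refl] by (simp add: zz)
  define T where "T = active a (\<lambda>_. 1) x"
  have T: "i \<in> T \<longleftrightarrow> a i \<bullet> x = 1" for i by (simp add: T_def active_def)
  have regT: "regular a T"
    using polygon_simple[OF polygon] xP unfolding simple_system_def patterns_def T_def by blast
  have two: "i \<in> T \<and> y $ i = 0" if "Inl (i, j) \<in> X" "Inl (i, j') \<in> X" "j \<noteq> j'" for i j j'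
  proof -
    have "b j * y $ i = b j' * y $ i" using that(1,2) unfolding XL by linarith
    then have "(b j - b j') * y $ i = 0" by (simp add: left_diff_distrib)
    then have "y $ i = 0" using b_props(3)[OF that(3)] by simp
    then show ?thesis using that(1) by (simp add: XL T)
  qed
  show "regular (rows 0) X"
    unfolding regular_def
  proof
    fix r assume r: "r \<in> X"
    show "\<exists>v. rows 0 r \<bullet> v = 1 \<and> (\<forall>q\<in>X - {r}. rows 0 q \<bullet> v = 0)"
    proof (cases r)
      case (Inr s)
      have "rows 0 q \<bullet> ((0, 0), if s then 1 else - 1) = (if q = r then 1 else 0)" if "q \<in> X" for q
      proof (cases q)
        case (Inr s')
        then have "s' = s" using that r \<open>r = Inr s\<close> by (cases s; cases s') (auto simp: XR)
        then show ?thesis using Inr \<open>r = Inr s\<close> by (simp add: rows_inner)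
      qed (use Inr in \<open>auto simp: rows_inner\<close>)
      then show ?thesis using r by (intro exI[of _ "((0, 0), if s then 1 else - 1)"]) auto
    next
      case (Inl ij)
      obtain i j where ij: "r = Inl (i, j)" using Inl by (cases ij) auto
      show ?thesis
      proof (cases "\<exists>j'. j' \<noteq> j \<and> Inl (i, j') \<in> X")
        case False
        have "rows 0 q \<bullet> ((0, axis i (1 / b j)), 0) = (if q = r then 1 else 0)" if "q \<in> X" for q
        proof (cases q)
          case (Inl lk)
          then obtain l k where q: "q = Inl (l, k)" by (cases lk) auto
          then have "l = i \<Longrightarrow> k = j" using False that by auto
          then show ?thesis using q ij b_props(1)[of j] by (auto simp: rows_inner axis_def)
        qed (use ij in \<open>auto simp: rows_inner\<close>)
        then show ?thesis using r by (intro exI[of _ "((0, axis i (1 / b j)), 0)"]) auto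
      next
        case True
        then obtain j' where j': "j' \<noteq> j" "Inl (i, j') \<in> X" by blast
        have iT: "i \<in> T" using two[of i j j'] r ij j' by auto
        obtain w where w: "a i \<bullet> w = 1" "\<And>l. l \<in> T - {i} \<Longrightarrow> a l \<bullet> w = 0"
          using regT iT unfolding regular_def by blast
        define \<alpha> where "\<alpha> = - b j' / (b j - b j')"
        \<comment> \<open>for an edge that is not tight in the polygon, \<open>SOME\<close> picks its only tight inequality\<close>
        define vy :: "real^'p" where "vy = (\<chi> l. if l = i then 1 / (b j - b j') else if l \<in> T then 0
             else - \<alpha> * (a l \<bullet> w) / b (SOME k. Inl (l, k) \<in> X))"
        have bjj: "b j - b j' \<noteq> 0" using b_props(3)[OF j'(1)] by simp
        have "rows 0 q \<bullet> ((\<alpha> *\<^sub>R w, vy), 0) = (if q = r then 1 else 0)" if q: "q \<in> X" for q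
        proof (cases q)
          case (Inl lk)
          then obtain l k where lk: "q = Inl (l, k)" by (cases lk) auto
          have val: "rows 0 q \<bullet> ((\<alpha> *\<^sub>R w, vy), 0) = \<alpha> * (a l \<bullet> w) + b k * vy $ l"
            by (simp add: lk rows_inner)
          consider "l = i" | "l \<noteq> i" "l \<in> T" | "l \<noteq> i" "l \<notin> T" by blast
          then show ?thesis
          proof cases
            case 1
            have "k = j \<or> k = j'" using j'(1) exhaust_2[of k] exhaust_2[of j] exhaust_2[of j'] by auto
            moreover have "\<alpha> + b j / (b j - b j') = (b j - b j') / (b j - b j')"
              by (simp only: \<alpha>_def add_divide_distrib[symmetric]) (simp only: add.commute diff_conv_add_uminus)
            then have "\<alpha> + b j / (b j - b j') = 1" using bjj by simp
            moreover have "\<alpha> + b j' / (b j - b j') = 0" by (simp add: \<alpha>_def)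
            ultimately show ?thesis using val w(1) 1 lk ij j'(1) by (auto simp: vy_def)
          next
            case 2
            then show ?thesis using val w(2)[of l] lk ij by (simp add: vy_def)
          next
            case 3
            have "(SOME k. Inl (l, k) \<in> X) = k"
            proof (rule some_equality)
              show "Inl (l, k) \<in> X" using q lk by simp
              show "k' = k" if "Inl (l, k') \<in> X" for k' using two[of l k k'] that q lk 3 by blast
            qed
            then show ?thesis using val 3 lk ij b_props(1)[of k] by (simp add: vy_def)
          qed
        qed (use ij in \<open>auto simp: rows_inner\<close>)
        then show ?thesis using r by (intro exI[of _ "((\<alpha> *\<^sub>R w, vy), 0)"]) auto
      qed
    qed
  qed
qed

text \<open>These right-hand sides describe the prism with interval factor \<open>[0, 1]\<close>. The affine map from
\<open>[0, 1]\<close> to \<open>[-1, 1]\<close> shows that it has the same patterns as the one with all right-hand sides \<open>1\<close>.\<close>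
definition prism_rhs :: "('p \<times> 2) + bool \<Rightarrow> real" where
  "prism_rhs r = (if r = Inr False then 0 else 1)"

lemma polyh_wedge_prism: "polyh (rows 0) prism_rhs = wedge_product a b \<times> {0..1}"
proof -
  have "(\<forall>r. rows 0 r \<bullet> z \<le> prism_rhs r) \<longleftrightarrow>
      (\<forall>i j. rows 0 (Inl (i, j)) \<bullet> z \<le> 1) \<and> rows 0 (Inr True) \<bullet> z \<le> 1 \<and> rows 0 (Inr False) \<bullet> z \<le> 0" (is "?L \<longleftrightarrow> ?R") for z
  proof
    assume ?L
    then have "rows 0 r \<bullet> z \<le> prism_rhs r" for r by blast
    from this[of "Inl _"] this[of "Inr True"] this[of "Inr False"] show ?R by (simp add: prism_rhs_def)
  next
    assume R: ?R
    have "rows 0 r \<bullet> z \<le> prism_rhs r" for r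
    proof (cases r)
      case (Inl ij)
      then show ?thesis using R by (cases ij) (simp add: prism_rhs_def)
    next
      case (Inr s)
      then show ?thesis using R by (cases s) (simp_all add: prism_rhs_def)
    qed
    then show ?L by blast
  qed
  then show ?thesis by (auto simp: polyh_def wedge_product_def rows_inner)
qed

lemma patterns_wedge_prism: "patterns (rows 0) prism_rhs = patterns (rows 0) (\<lambda>_. 1)"
proof -
  define g :: "'p ambient \<Rightarrow> 'p ambient" where "g z = (fst z, 2 * snd z - 1)" for z
  have surj: "z = g (fst z, (snd z + 1) / 2)" for z by (simp add: g_def prod_eq_iff field_simps)
  have le: "rows 0 r \<bullet> z \<le> prism_rhs r \<longleftrightarrow> rows 0 r \<bullet> g z \<le> 1" for r z
    by (cases r) (auto simp: rows_inner prism_rhs_def g_def)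
  have eq: "rows 0 r \<bullet> z = prism_rhs r \<longleftrightarrow> rows 0 r \<bullet> g z = 1" for r z
    by (cases r) (auto simp: rows_inner prism_rhs_def g_def)
  have act: "active (rows 0) prism_rhs z = active (rows 0) (\<lambda>_. 1) (g z)" for z
    by (simp add: active_def eq)
  have mem: "z \<in> polyh (rows 0) prism_rhs \<longleftrightarrow> g z \<in> polyh (rows 0) (\<lambda>_. 1)" for z
    by (simp add: polyh_def le)
  show ?thesis
    unfolding patterns_def
  proof (intro equalityI subsetI)
    fix X assume "X \<in> active (rows 0) (\<lambda>_. 1) ` polyh (rows 0) (\<lambda>_. 1)"
    then obtain z where "z \<in> polyh (rows 0) (\<lambda>_. 1)" "X = active (rows 0) (\<lambda>_. 1) z" by blast
    then show "X \<in> active (rows 0) prism_rhs ` polyh (rows 0) prism_rhs"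
      using act mem surj[of z] by (metis image_eqI)
  qed (use act mem in auto)
qed

lemma UNIV_not_pattern: "UNIV \<notin> patterns (rows \<delta>) (\<lambda>_. 1)"
proof
  assume "UNIV \<in> patterns (rows \<delta>) (\<lambda>_. 1)"
  then obtain z where "UNIV = active (rows \<delta>) (\<lambda>_. 1) z" by (auto simp: patterns_def)
  then have "rows \<delta> (Inr True) \<bullet> z = 1" "rows \<delta> (Inr False) \<bullet> z = 1" by (auto simp: active_def)
  then show False by (simp add: rows_inner)
qed

lemma deformation_exists:
  obtains \<delta> where "\<delta> > 0" "patterns (rows \<delta>) (\<lambda>_. 1) = patterns (rows 0) prism_rhs"
    "simple_system (rows \<delta>) (\<lambda>_. 1)" "bounded (polyh (rows \<delta>) (\<lambda>_. 1))"
proof -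
  have "(\<lambda>m. rows (1 / real (Suc m)) r) \<longlonglongrightarrow> rows 0 r" for r
  proof (cases r)
    case (Inl ij)
    have "(\<lambda>m. 1 / real (Suc m)) \<longlonglongrightarrow> 0" using LIMSEQ_inverse_real_of_nat by (simp add: inverse_eq_divide)
    then show ?thesis unfolding Inl rows_def sum.case by (intro tendsto_intros)
  qed (simp add: rows_def)
  from simple_system_stable[OF simple_undeformed bounded_undeformed _ this]
  have "\<forall>\<^sub>F m in sequentially. patterns (rows (1 / real (Suc m))) (\<lambda>_. 1) = patterns (rows 0) (\<lambda>_. 1) \<and>
      simple_system (rows (1 / real (Suc m))) (\<lambda>_. 1) \<and> bounded (polyh (rows (1 / real (Suc m))) (\<lambda>_. 1))" by simp
  then obtain m where m: "bounded (polyh (rows (1 / real (Suc m))) (\<lambda>_. 1))" "patterns (rows (1 / real (Suc m))) (\<lambda>_. 1) = patterns (rows 0) (\<lambda>_. 1)"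
      "simple_system (rows (1 / real (Suc m))) (\<lambda>_. 1)"
    unfolding eventually_sequentially by blast
  show thesis by (rule that[of "1 / real (Suc m)"]) (use m patterns_wedge_prism in auto)
qed

end

section \<open>Projecting the deformed prism\<close>

locale deformed_prism = wedge_data a b e
  for a :: "'p::finite \<Rightarrow> real^2" and b :: "2 \<Rightarrow> real" and e :: "nat \<Rightarrow> 'p" +
  fixes \<delta> :: real
  assumes delta: "\<delta> > 0"
    and same_patterns: "patterns (rows \<delta>) (\<lambda>_. 1) = patterns (rows 0) prism_rhs"
    and simple: "simple_system (rows \<delta>) (\<lambda>_. 1)"
    and bounded_polyh: "bounded (polyh (rows \<delta>) (\<lambda>_. 1))"
begin

definition deformed :: "'p ambient set" where
  "deformed = polyh (rows \<delta>) (\<lambda>_. 1)"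

definition B :: real where "B = \<bar>b 0\<bar> + \<bar>b 1\<bar>"

definition M :: real where "M = 3 * B / \<delta>"

text \<open>The fourth coordinate of the projection. Its coefficients grow so fast along the chain that the sign
of a multiplier is decided by the weight and not by the sign of \<open>b j\<close>.\<close>
definition weight :: "'p ambient \<Rightarrow> real" where
  "weight z = \<delta> * (\<Sum>k<CARD('p). M ^ k * chain z k)"

definition proj4 :: "'p ambient \<Rightarrow> real^4" where
  "proj4 z = (\<chi> i. if i = 1 then fst (fst z) $ 1 else if i = 2 then fst (fst z) $ 2
     else if i = 3 then chain z CARD('p) else weight z)"

definition cell :: "('p \<Rightarrow> 2) \<Rightarrow> 'p ambient set" where
  "cell j = {z \<in> deformed. \<forall>i. rows \<delta> (Inl (i, j i)) \<bullet> z = 1}"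

lemma proj4_nth [simp]:
  "proj4 z $ 1 = fst (fst z) $ 1" "proj4 z $ 2 = fst (fst z) $ 2"
  "proj4 z $ 3 = chain z CARD('p)" "proj4 z $ 4 = weight z"
  by (simp_all add: proj4_def)

lemma chain_add: "chain (z + z') k = chain z k + chain z' k"
  and chain_scale: "chain (r *\<^sub>R z) k = r * chain z k"
  by (simp_all add: chain_def inner_add_right)

lemma linear_proj4: "linear proj4"
  by (rule linearI) (simp_all add: vec_eq_iff forall_4 weight_def chain_add chain_scale
      sum.distrib distrib_left sum_distrib_left mult.left_commute del: chain_simps)

lemma inner_proj4: "w \<bullet> proj4 z =
    w $ 1 * fst (fst z) $ 1 + w $ 2 * fst (fst z) $ 2 + w $ 3 * chain z CARD('p) + w $ 4 * weight z"
  by (simp add: inner_vec_def sum_4)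

lemma abs_b_le: "\<bar>b j\<bar> \<le> B"
proof -
  have "j = 0 \<or> j = 1" using exhaust_2[of j] by auto
  then show ?thesis by (auto simp: B_def)
qed

lemma B_pos: "B > 0"
  using b_props(1)[of 0] by (simp add: B_def add_pos_nonneg)

lemma delta_M: "\<delta> * M = 3 * B"
  using delta by (simp add: M_def)

lemma card_pos: "CARD('p) > 0"
  by (simp add: card_gt_0_iff)

text \<open>The recursion for the multipliers along the chain: \<open>\<beta>\<close> is the contribution of the previous edge to the current chain coordinate. By the
choice of \<open>M\<close> the right-hand side equals \<open>3 * B * \<gamma> * M ^ k\<close>, and the upper bound on \<open>l\<close> limits \<open>\<beta>\<close> to half of that, so the
next multiplier stays strictly positive and satisfies the upper bound with the next power of \<open>M\<close>.\<close>
lemma multiplier_step: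
  assumes step: "\<delta> * l' + \<beta> = \<gamma> * (\<delta> * M ^ Suc k)" and \<beta>: "\<bar>\<beta>\<bar> \<le> B * l"
    and l: "0 < l" "l \<le> 3/2 * \<gamma> * M ^ k"
  shows "0 < l'" "l' \<le> 3/2 * \<gamma> * M ^ Suc k"
proof -
  have g: "\<gamma> * M ^ k > 0" using l by (simp add: mult.assoc)
  have "B * l \<le> B * (3/2 * (\<gamma> * M ^ k))" using l(2) B_pos by (intro mult_left_mono) (auto simp: mult.assoc)
  then have \<beta>': "\<bar>\<beta>\<bar> \<le> 3/2 * (B * (\<gamma> * M ^ k))" using \<beta> by simp
  have "\<gamma> * (\<delta> * M ^ Suc k) = (\<delta> * M) * (\<gamma> * M ^ k)" by simp
  also have "\<dots> = 3 * (B * (\<gamma> * M ^ k))" unfolding delta_M by simp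
  finally have val: "\<gamma> * (\<delta> * M ^ Suc k) = 3 * (B * (\<gamma> * M ^ k))" .
  have Bg: "B * (\<gamma> * M ^ k) > 0" using B_pos g by simp
  have "\<delta> * l' > 0" using step val \<beta>' Bg by linarith
  then show "0 < l'" using delta by (simp add: zero_less_mult_iff)
  have "\<delta> * l' \<le> 3/2 * (\<gamma> * (\<delta> * M ^ Suc k))" using step val \<beta>' by linarith
  also have "\<dots> = \<delta> * (3/2 * \<gamma> * M ^ Suc k)" by simp
  finally show "l' \<le> 3/2 * \<gamma> * M ^ Suc k" using delta by (simp only: mult_le_cancel_left_pos)
qed

text \<open>The positive multipliers that express the weight, up to the coordinates kept in 3-space, by the rows chosen by \<open>j\<close>.\<close>
primrec multiplier :: "('p \<Rightarrow> 2) \<Rightarrow> nat \<Rightarrow> real" where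
  "multiplier j 0 = 1"
| "multiplier j (Suc k) = M ^ Suc k - multiplier j k * b (j (e k)) / \<delta>"

lemma multiplier_bounds: "0 < multiplier j k \<and> multiplier j k \<le> 3/2 * 1 * M ^ k"
proof (induction k)
  case (Suc k)
  have "\<delta> * multiplier j (Suc k) + multiplier j k * b (j (e k)) = 1 * (\<delta> * M ^ Suc k)"
    using delta by (simp add: right_diff_distrib)
  moreover have "\<bar>multiplier j k * b (j (e k))\<bar> \<le> B * multiplier j k"
    using Suc abs_b_le[of "j (e k)"] by (simp add: abs_mult mult.commute mult_right_mono)
  ultimately show ?case using multiplier_step[of "multiplier j (Suc k)" "multiplier j k * b (j (e k))" 1 k "multiplier j k"] Suc by blast
qed simp

lemma multiplier_telescope:
  "(\<Sum>k<Suc n. multiplier j k * (b (j (e k)) * chain z (Suc k) + \<delta> * chain z k)) =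
   \<delta> * (\<Sum>k<Suc n. M ^ k * chain z k) + multiplier j n * b (j (e n)) * chain z (Suc n)"
proof (induction n)
  case 0
  show ?case by (simp del: chain_simps)
next
  case (Suc n)
  have "\<delta> * multiplier j (Suc n) = \<delta> * M ^ Suc n - multiplier j n * b (j (e n))"
    using delta by (simp add: right_diff_distrib)
  then have 1: "multiplier j (Suc n) * (\<delta> * chain z (Suc n)) = (\<delta> * M ^ Suc n - multiplier j n * b (j (e n))) * chain z (Suc n)"
    by (metis mult.assoc mult.commute)
  have "(\<Sum>k<Suc (Suc n). multiplier j k * (b (j (e k)) * chain z (Suc k) + \<delta> * chain z k)) =
      \<delta> * (\<Sum>k<Suc n. M ^ k * chain z k) + multiplier j n * b (j (e n)) * chain z (Suc n)
      + (multiplier j (Suc n) * (b (j (e (Suc n))) * chain z (Suc (Suc n))) + multiplier j (Suc n) * (\<delta> * chain z (Suc n)))"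
    using Suc.IH by (simp only: sum.lessThan_Suc distrib_left)
  also have "\<dots> = \<delta> * (\<Sum>k<Suc (Suc n). M ^ k * chain z k) + multiplier j (Suc n) * b (j (e (Suc n))) * chain z (Suc (Suc n))"
    unfolding 1 by (simp only: sum.lessThan_Suc[of _ "Suc n"] distrib_left left_diff_distrib)
  finally show ?case .
qed

lemma sum_over_edges: "(\<Sum>i\<in>UNIV. g i) = (\<Sum>k<CARD('p). g (e k))" for g :: "'p \<Rightarrow> 'b::comm_monoid_add"
  using sum.reindex_bij_betw[OF enum, of g] by simp

text \<open>Each cell is exposed by a functional that factors through the projection and has coefficient \<open>1\<close> at the weight.
The common coefficient allows functionals of different cells to be compared.\<close>
lemma cell_supporting:
  "\<exists>w c. w $ 4 = 1 \<and> (\<forall>z\<in>deformed. w \<bullet> proj4 z \<le> c) \<and> (\<forall>z\<in>deformed. w \<bullet> proj4 z = c \<longleftrightarrow> z \<in> cell j)"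
proof -
  obtain n where n: "CARD('p) = Suc n" using card_pos gr0_implies_Suc by blast
  define v where "v = (\<Sum>k<CARD('p). multiplier j k *\<^sub>R a (e k))"
  \<comment> \<open>the last chain coordinate is the one that telescoping leaves over\<close>
  define w :: "real^4" where "w = (\<chi> i. if i = 1 then v $ 1 else if i = 2 then v $ 2
     else if i = 3 then multiplier j n * b (j (e n)) else 1)"
  define c where "c = (\<Sum>k<CARD('p). multiplier j k)"
  have eq: "w \<bullet> proj4 z = (\<Sum>k<CARD('p). multiplier j k * (rows \<delta> (Inl (e k, j (e k))) \<bullet> z))" for z
  proof -
    have "(\<Sum>k<CARD('p). multiplier j k * (rows \<delta> (Inl (e k, j (e k))) \<bullet> z))
        = (\<Sum>k<CARD('p). multiplier j k * (a (e k) \<bullet> fst (fst z)) +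
             multiplier j k * (b (j (e k)) * chain z (Suc k) + \<delta> * chain z k))"
    proof (rule sum.cong[OF refl])
      fix k assume "k \<in> {..<CARD('p)}"
      then have "pos (e k) = k" using pos(3) by simp
      then show "multiplier j k * (rows \<delta> (Inl (e k, j (e k))) \<bullet> z) = multiplier j k * (a (e k) \<bullet> fst (fst z)) +
             multiplier j k * (b (j (e k)) * chain z (Suc k) + \<delta> * chain z k)"
        by (simp add: rows_inner distrib_left)
    qed
    also have "\<dots> = v \<bullet> fst (fst z) + (\<delta> * (\<Sum>k<CARD('p). M ^ k * chain z k) + multiplier j n * b (j (e n)) * chain z (Suc n))"
      unfolding n sum.distrib multiplier_telescope by (simp add: v_def n inner_sum_left inner_add_left del: chain_simps)
    also have "\<dots> = w \<bullet> proj4 z"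
      by (simp add: inner_proj4 w_def weight_def inner_real2 n del: chain_simps)
    finally show ?thesis by simp
  qed
  have le: "rows \<delta> r \<bullet> z \<le> 1" if "z \<in> deformed" for r z using that by (simp add: deformed_def polyh_def)
  have pos_multiplier: "multiplier j k > 0" for k using multiplier_bounds by blast
  have diff: "c - w \<bullet> proj4 z = (\<Sum>k<CARD('p). multiplier j k * (1 - rows \<delta> (Inl (e k, j (e k))) \<bullet> z))" for z
    unfolding eq c_def by (simp add: sum_subtractf right_diff_distrib)
  have nonneg: "0 \<le> multiplier j k * (1 - rows \<delta> (Inl (e k, j (e k))) \<bullet> z)" if "z \<in> deformed" for z k
    using pos_multiplier[of k] le[OF that] by simp
  show ?thesis
  proof (intro exI conjI ballI)
    show "w $ 4 = 1" by (simp add: w_def)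
    show "w \<bullet> proj4 z \<le> c" if "z \<in> deformed" for z
    proof -
      have "0 \<le> c - w \<bullet> proj4 z" unfolding diff by (intro sum_nonneg nonneg that)
      then show ?thesis by simp
    qed
    show "w \<bullet> proj4 z = c \<longleftrightarrow> z \<in> cell j" if z: "z \<in> deformed" for z
    proof -
      have "w \<bullet> proj4 z = c \<longleftrightarrow> (\<Sum>k<CARD('p). multiplier j k * (1 - rows \<delta> (Inl (e k, j (e k))) \<bullet> z)) = 0"
        using diff[of z] by auto
      also have "\<dots> \<longleftrightarrow> (\<forall>k<CARD('p). rows \<delta> (Inl (e k, j (e k))) \<bullet> z = 1)"
        using pos_multiplier by (subst sum_nonneg_eq_0_iff) (auto simp: nonneg[OF z] less_imp_neq[symmetric])
      also have "\<dots> \<longleftrightarrow> (\<forall>i. rows \<delta> (Inl (i, j i)) \<bullet> z = 1)"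
        using pos by metis
      finally show ?thesis using z by (simp add: cell_def)
    qed
  qed
qed

text \<open>On a cell all rows are equations, and the equation of the edge \<open>e k\<close> determines the chain coordinate
\<open>k\<close> from the next one, so the chain is recovered downwards from its last entry.\<close>
lemma cell_coordinates_unique:
  assumes z: "z \<in> cell j" "z' \<in> cell j" and x: "fst (fst z) = fst (fst z')"
    and h: "chain z CARD('p) = chain z' CARD('p)"
  shows "z = z'"
proof -
  have row: "b (j (e k)) * chain y (Suc k) + \<delta> * chain y k = 1 - a (e k) \<bullet> fst (fst y)"
    if "k < CARD('p)" "y \<in> cell j" for y k
  proof -
    have "rows \<delta> (Inl (e k, j (e k))) \<bullet> y = 1" using that by (simp add: cell_def)
    then show ?thesis using pos(3)[OF that(1)] by (simp add: rows_inner)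
  qed
  have chain: "chain z k = chain z' k" if "k \<le> CARD('p)" for k
    using that
  proof (induction k rule: inc_induct)
    case (step k)
    have "\<delta> * chain z k = \<delta> * chain z' k"
      using row[OF step(2) z(1)] row[OF step(2) z(2)] unfolding step.IH x by linarith
    then show ?case using delta by simp
  qed (rule h)
  have "snd z = snd z'" using chain[of 0] by simp
  moreover have "snd (fst z) $ i = snd (fst z') $ i" for i
    using chain[of "Suc (pos i)"] pos(1)[of i] by (simp add: pos(2))
  ultimately show ?thesis using x by (simp add: prod_eq_iff vec_eq_iff)
qed

definition drop4 :: "3 \<Rightarrow> 4" where
  "drop4 i = (if i = 1 then 1 else if i = 2 then 2 else 3)"

lemma inj_drop4: "inj drop4"
proof (rule injI)
  fix i k assume "drop4 i = drop4 k"
  then show "i = k" using exhaust_3[of i] exhaust_3[of k] by (auto simp: drop4_def split: if_splits)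
qed

lemma proj3_eq:
  assumes "coord_proj drop4 (proj4 z) = coord_proj drop4 (proj4 z')"
  shows "fst (fst z) = fst (fst z')" "chain z CARD('p) = chain z' CARD('p)"
proof -
  have *: "proj4 z $ drop4 i = proj4 z' $ drop4 i" for i
    using assms by (simp add: coord_proj_def vec_eq_iff)
  from *[of 1] *[of 2] show "fst (fst z) = fst (fst z')" by (simp add: vec_eq_iff forall_2 drop4_def)
  from *[of 3] show "chain z CARD('p) = chain z' CARD('p)" by (simp add: drop4_def del: chain_simps)
qed

text \<open>If two points of cells agree in \<open>x\<close> and in the last chain coordinate, then the supporting functional of each cell
shows that its point has at least the weight of the other. So the weights agree, and both points lie in the same cell.\<close>
lemma inj_proj3: "inj_on (coord_proj drop4 \<circ> proj4) (\<Union>j. cell j)"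
proof (rule inj_onI)
  fix z z' assume zz: "z \<in> (\<Union>j. cell j)" "z' \<in> (\<Union>j. cell j)"
    and eq: "(coord_proj drop4 \<circ> proj4) z = (coord_proj drop4 \<circ> proj4) z'"
  then obtain j j' where z: "z \<in> cell j" "z' \<in> cell j'" by auto
  then have Q: "z \<in> deformed" "z' \<in> deformed" by (auto simp: cell_def)
  have p3: "fst (fst z) = fst (fst z')" "chain z CARD('p) = chain z' CARD('p)"
    using proj3_eq[of z z'] eq by auto
  have diff: "w \<bullet> proj4 z - w \<bullet> proj4 z' = weight z - weight z'" if "w $ 4 = 1" for w
    using that p3 by (simp add: inner_proj4 del: chain_simps)
  from cell_supporting[of j] obtain w c where
    "w $ 4 = 1 \<and> (\<forall>z\<in>deformed. w \<bullet> proj4 z \<le> c) \<and> (\<forall>z\<in>deformed. w \<bullet> proj4 z = c \<longleftrightarrow> z \<in> cell j)"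
    by (elim exE)
  then have w: "w $ 4 = 1" "\<And>z. z \<in> deformed \<Longrightarrow> w \<bullet> proj4 z \<le> c"
    "\<And>z. z \<in> deformed \<Longrightarrow> w \<bullet> proj4 z = c \<longleftrightarrow> z \<in> cell j"
    by blast+
  from cell_supporting[of j'] obtain w' c' where
    "w' $ 4 = 1 \<and> (\<forall>z\<in>deformed. w' \<bullet> proj4 z \<le> c') \<and> (\<forall>z\<in>deformed. w' \<bullet> proj4 z = c' \<longleftrightarrow> z \<in> cell j')"
    by (elim exE)
  then have w': "w' $ 4 = 1" "\<And>z. z \<in> deformed \<Longrightarrow> w' \<bullet> proj4 z \<le> c'"
    "\<And>z. z \<in> deformed \<Longrightarrow> w' \<bullet> proj4 z = c' \<longleftrightarrow> z \<in> cell j'"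
    by blast+
  have 1: "w \<bullet> proj4 z = c" "w \<bullet> proj4 z' \<le> c" using w(3)[OF Q(1)] w(2)[OF Q(2)] z by auto
  have 2: "w' \<bullet> proj4 z' = c'" "w' \<bullet> proj4 z \<le> c'" using w'(3)[OF Q(2)] w'(2)[OF Q(1)] z by auto
  have "w \<bullet> proj4 z' = c" using 1 2 diff[OF w(1)] diff[OF w'(1)] by linarith
  then have "z' \<in> cell j" using w(3)[OF Q(2)] by simp
  then show "z = z'" by (rule cell_coordinates_unique[OF z(1) _ p3])
qed

lemma polytope_deformed: "polytope deformed"
  using bounded_polyh polyhedron_polyh by (simp add: deformed_def polytope_eq_bounded_polyhedron)

lemma cell_face: "cell j face_of deformed"
proof -
  have "cell j = slice (rows \<delta>) (\<lambda>_. 1) {Inl (i, j i) | i. True}"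
    by (auto simp: cell_def slice_def active_def deformed_def)
  then show ?thesis by (simp add: deformed_def slice_face_of)
qed

text \<open>Exposedness of the cell by a functional of the projected coordinates handles the cell itself; injectivity of the
projection on the cell passes this on to its faces.\<close>
lemma cell_projects:
  assumes F: "F face_of deformed" "F \<subseteq> cell j"
  shows "proj4 ` F face_of proj4 ` deformed" "proj4 -` (proj4 ` F) \<inter> deformed = F" "inj_on proj4 F"
proof -
  from cell_supporting[of j] obtain w c where
    "w $ 4 = 1 \<and> (\<forall>z\<in>deformed. w \<bullet> proj4 z \<le> c) \<and> (\<forall>z\<in>deformed. w \<bullet> proj4 z = c \<longleftrightarrow> z \<in> cell j)"
    by (elim exE)
  then have w: "\<And>z. z \<in> deformed \<Longrightarrow> w \<bullet> proj4 z \<le> c"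
    "\<And>z. z \<in> deformed \<Longrightarrow> w \<bullet> proj4 z = c \<longleftrightarrow> z \<in> cell j"
    by blast+
  have "inj_on (coord_proj drop4 \<circ> proj4) (cell j)" by (rule inj_on_subset[OF inj_proj3]) auto
  then have inj: "inj_on proj4 (cell j)" by (rule inj_on_imageI2)
  then show "inj_on proj4 F" using F inj_on_subset by blast
  have cQ: "cell j \<subseteq> deformed" by (auto simp: cell_def)
  have cconv: "convex (cell j)" by (rule face_of_imp_convex[OF cell_face])
  have img: "proj4 ` cell j = proj4 ` deformed \<inter> {y. w \<bullet> y = c}" using w(2) cQ by auto
  have "convex (proj4 ` deformed)"
    by (rule convex_linear_image[OF linear_proj4 polytope_imp_convex[OF polytope_deformed]])
  then have 1: "proj4 ` cell j face_of proj4 ` deformed"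
    unfolding img by (rule face_of_Int_supporting_hyperplane_le) (use w(1) in auto)
  have "F face_of cell j" using F cQ face_of_subset by blast
  then have "proj4 ` F face_of proj4 ` cell j"
    using segment_map_face_iff[OF segment_map_on_linear[OF linear_proj4] cconv inj F(2)] by simp
  then show "proj4 ` F face_of proj4 ` deformed" using 1 face_of_trans by blast
  show "proj4 -` (proj4 ` F) \<inter> deformed = F"
  proof (intro equalityI subsetI)
    fix z assume z: "z \<in> proj4 -` (proj4 ` F) \<inter> deformed"
    then obtain z' where z': "z' \<in> F" "proj4 z = proj4 z'" by auto
    then have "proj4 z \<in> proj4 ` cell j" using F by auto
    then have "z \<in> cell j" using img w(2) z by auto
    moreover have "z' \<in> cell j" using z'(1) F(2) by blast
      ultimately have "z = z'" using inj_onD[OF inj z'(2)] by blast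
      then show "z \<in> F" using z'(1) by simp
  qed (use F cQ in auto)
qed

lemma sum_rows: "(\<Sum>r\<in>UNIV. g r) = (\<Sum>i\<in>UNIV. \<Sum>k\<in>UNIV. g (Inl (i, k))) + (g (Inr True) + g (Inr False))"
  for g :: "('p \<times> 2) + bool \<Rightarrow> real"
proof -
  have "(\<Sum>r\<in>UNIV. g r) = (\<Sum>r\<in>(UNIV :: ('p \<times> 2) set) <+> (UNIV :: bool set). g r)" by simp
  also have "\<dots> = (\<Sum>p\<in>(UNIV :: ('p \<times> 2) set). g (Inl p)) + (\<Sum>s\<in>(UNIV :: bool set). g (Inr s))"
    by (subst sum.Plus) auto
  also have "(\<Sum>p\<in>(UNIV :: ('p \<times> 2) set). g (Inl p)) = (\<Sum>p\<in>(UNIV :: 'p set) \<times> (UNIV :: 2 set). g (Inl p))" by simp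
  also have "\<dots> = (\<Sum>i\<in>UNIV. \<Sum>k\<in>UNIV. g (Inl (i, k)))" by (simp add: sum.cartesian_product)
  finally show ?thesis by (simp add: UNIV_bool add.commute)
qed

lemma chain_chain_vec:
  assumes "k \<le> CARD('p)" "l \<le> CARD('p)"
  shows "chain (chain_vec k) l = (if k = l then 1 else 0)"
proof (cases k; cases l)
  fix k' l' assume k: "k = Suc k'" and l: "l = Suc l'"
  have "e l' = e k' \<longleftrightarrow> k' = l'" using assms pos(3)[of k'] pos(3)[of l'] k l by (metis Suc_le_lessD)
  then show ?thesis unfolding k l by (simp add: chain_vec_def axis_def)
qed (auto simp: chain_vec_def)

text \<open>The pullback of a functional that defines \<open>G\<close> is a nonnegative combination of tight rows. The vectors
\<open>chain_vec k\<close>, \<open>k < p\<close>, compare coefficients; they show that the coefficient \<open>\<gamma>\<close> of the weight is positive, since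
otherwise all multipliers would vanish, and then that every edge has a row with positive
multiplier. These rows are tight on all of \<open>G\<close>.\<close>
lemma surface_star:
  assumes G: "G face_of proj4 ` deformed" "G \<noteq> proj4 ` deformed" and q: "q \<in> deformed" "proj4 q \<in> G"
    and act: "\<And>s. Inr s \<notin> active (rows \<delta>) (\<lambda>_. 1) q"
  obtains j where "\<And>z. z \<in> deformed \<Longrightarrow> proj4 z \<in> G \<Longrightarrow> z \<in> cell j"
proof -
  have poly: "polytope (proj4 ` deformed)" by (rule polytope_linear_image[OF linear_proj4 polytope_deformed])
  obtain w c where w: "proj4 ` deformed \<subseteq> {y. w \<bullet> y \<le> c}" "G = proj4 ` deformed \<inter> {y. w \<bullet> y = c}"
    using face_of_polytope_inequality[OF poly G(1)] .
  define f where "f = adjoint proj4 w"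
  have f: "f \<bullet> z = w \<bullet> proj4 z" for z
    using adjoint_works[OF linear_proj4, of z w] by (simp add: f_def inner_commute)
  have fq: "f \<bullet> q = c" using q(2) w(2) f by auto
  have "f \<bullet> z \<le> f \<bullet> q" if "z \<in> polyh (rows \<delta>) (\<lambda>_. 1)" for z
  proof -
    have "proj4 z \<in> proj4 ` deformed" using that by (simp add: deformed_def)
    then have "w \<bullet> proj4 z \<le> c" using w(1) by blast
    then show ?thesis by (simp add: fq) (simp add: f)
  qed
  then obtain \<mu> where \<mu>: "\<And>k. \<mu> k \<ge> 0" "\<And>k. k \<notin> active (rows \<delta>) (\<lambda>_. 1) q \<Longrightarrow> \<mu> k = 0"
    "f = (\<Sum>k\<in>UNIV. \<mu> k *\<^sub>R rows \<delta> k)"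
    by (rule simple_multipliers[OF simple q(1)[unfolded deformed_def]]) blast+
  have \<mu>R: "\<mu> (Inr s) = 0" for s using \<mu>(2) act by blast
  have expand: "w \<bullet> proj4 z = (\<Sum>i\<in>UNIV. \<Sum>k\<in>UNIV. \<mu> (Inl (i, k)) * (rows \<delta> (Inl (i, k)) \<bullet> z))" for z
    unfolding f[symmetric] \<mu>(3) inner_sum_left sum_rows by (simp add: \<mu>R)
  define \<Lambda> where "\<Lambda> k = (\<Sum>j\<in>UNIV. \<mu> (Inl (e k, j)))" for k
  define \<beta> where "\<beta> k = (\<Sum>j\<in>UNIV. \<mu> (Inl (e k, j)) * b j)" for k
  define \<gamma> where "\<gamma> = w $ 4"
  have \<Lambda>0: "\<Lambda> k \<ge> 0" for k unfolding \<Lambda>_def by (intro sum_nonneg \<mu>)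
  have \<beta>le: "\<bar>\<beta> k\<bar> \<le> B * \<Lambda> k" for k
  proof -
    have "\<bar>\<beta> k\<bar> \<le> (\<Sum>j\<in>UNIV. \<bar>\<mu> (Inl (e k, j)) * b j\<bar>)" unfolding \<beta>_def by (rule sum_abs)
    also have "\<dots> \<le> (\<Sum>j\<in>UNIV. B * \<mu> (Inl (e k, j)))"
      using \<mu>(1) abs_b_le by (intro sum_mono) (simp add: abs_mult mult.commute mult_right_mono)
    finally show ?thesis by (simp add: \<Lambda>_def sum_distrib_left)
  qed
  have coeff: "\<delta> * \<Lambda> k + (case k of 0 \<Rightarrow> 0 | Suc l \<Rightarrow> \<beta> l) = \<gamma> * (\<delta> * M ^ k)" if k: "k < CARD('p)" for k
  proof -
    have ch: "chain (chain_vec k) l = (if k = l then 1 else 0)" if "l \<le> CARD('p)" for l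
      using chain_chain_vec k that by simp
    have x0: "fst (fst (chain_vec k)) = 0" by (cases k) (auto simp: chain_vec_def)
    have "weight (chain_vec k) = \<delta> * (\<Sum>l<CARD('p). if k = l then M ^ l else 0)"
      unfolding weight_def by (intro arg_cong[where f = "\<lambda>x. \<delta> * x"] sum.cong) (auto simp: ch simp del: chain_simps)
    then have wt: "weight (chain_vec k) = \<delta> * M ^ k" using k by simp
    have "chain (chain_vec k) CARD('p) = 0" using ch[of "CARD('p)"] k by simp
    then have lhs: "w \<bullet> proj4 (chain_vec k) = \<gamma> * (\<delta> * M ^ k)"
      by (simp add: inner_proj4 x0 wt \<gamma>_def del: chain_simps)
    have row: "rows \<delta> (Inl (e l, j)) \<bullet> chain_vec k = b j * (if k = Suc l then 1 else 0) + \<delta> * (if k = l then 1 else 0)"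
      if l: "l < CARD('p)" for l j
    proof -
      have "snd (fst (chain_vec k)) $ e l = (if k = Suc l then 1 else 0)" using ch[of "Suc l"] l by simp
      then show ?thesis using ch[of l] l pos(3)[OF l] by (simp add: rows_inner x0 del: chain_simps)
    qed
    have "w \<bullet> proj4 (chain_vec k) = (\<Sum>l<CARD('p). \<Sum>j\<in>UNIV. \<mu> (Inl (e l, j)) * (rows \<delta> (Inl (e l, j)) \<bullet> chain_vec k))"
      unfolding expand sum_over_edges ..
    also have "\<dots> = (\<Sum>l<CARD('p). (if k = Suc l then \<beta> l else 0) + (if k = l then \<delta> * \<Lambda> l else 0))"
    proof (rule sum.cong[OF refl])
      fix l assume "l \<in> {..<CARD('p)}"
      then have l: "l < CARD('p)" by simp
      show "(\<Sum>j\<in>UNIV. \<mu> (Inl (e l, j)) * (rows \<delta> (Inl (e l, j)) \<bullet> chain_vec k)) =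
          (if k = Suc l then \<beta> l else 0) + (if k = l then \<delta> * \<Lambda> l else 0)"
        unfolding row[OF l] by (auto simp: \<beta>_def \<Lambda>_def sum_distrib_left mult.commute)
    qed
    also have "\<dots> = (\<Sum>l<CARD('p). if k = Suc l then \<beta> l else 0) + \<delta> * \<Lambda> k"
      using k by (simp add: sum.distrib)
    also have "(\<Sum>l<CARD('p). if k = Suc l then \<beta> l else 0) = (case k of 0 \<Rightarrow> 0 | Suc l \<Rightarrow> \<beta> l)"
      using k by (cases k) auto
    finally show ?thesis using lhs by simp
  qed
  \<comment> \<open>for \<open>\<gamma> = 0\<close> the multipliers vanish one after the other along the chain, and \<open>G\<close> would be the whole polytope\<close>
  have \<gamma>pos: "\<gamma> > 0"
  proof (rule ccontr)
    assume "\<not> \<gamma> > 0"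
    moreover have "\<gamma> \<ge> 0" using coeff[OF card_pos] \<Lambda>0[of 0] delta by (simp add: zero_le_mult_iff)
    ultimately have \<gamma>0: "\<gamma> = 0" by simp
    have "\<Lambda> k = 0" if "k < CARD('p)" for k
      using that
    proof (induction k)
      case 0
      then show ?case using coeff[OF 0] \<gamma>0 delta by simp
    next
      case (Suc k)
      then have "\<beta> k = 0" using \<beta>le[of k] by simp
      then show ?case using coeff[OF Suc.prems] \<gamma>0 delta by simp
    qed
    then have "\<Lambda> (pos i) = 0" for i using pos(1) by blast
    then have "(\<Sum>j\<in>UNIV. \<mu> (Inl (i, j))) = 0" for i unfolding \<Lambda>_def pos(2) .
    then have "\<mu> (Inl (i, j)) = 0" for i j using \<mu>(1) by (simp add: sum_nonneg_eq_0_iff)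
    then have "w \<bullet> proj4 z = 0" for z unfolding expand by simp
    then show False using G(2) w(2) f fq by auto
  qed
  have "0 < \<Lambda> k \<and> \<Lambda> k \<le> 3/2 * \<gamma> * M ^ k" if "k < CARD('p)" for k
    using that
  proof (induction k)
    case 0
    then have "\<Lambda> 0 = \<gamma>" using coeff[OF 0] delta by simp
    then show ?case using \<gamma>pos by simp
  next
    case (Suc k)
    then show ?case using multiplier_step[of "\<Lambda> (Suc k)" "\<beta> k" \<gamma> k "\<Lambda> k"] coeff[OF Suc.prems] \<beta>le[of k] by auto
  qed
  then have "0 < \<Lambda> (pos i)" for i using pos(1) by blast
  then have s: "0 < (\<Sum>j\<in>UNIV. \<mu> (Inl (i, j)))" for i unfolding \<Lambda>_def pos(2) .
  have "\<exists>j. \<mu> (Inl (i, j)) > 0" for i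
  proof (rule ccontr)
    assume "\<nexists>j. \<mu> (Inl (i, j)) > 0"
    then have "(\<Sum>j\<in>UNIV. \<mu> (Inl (i, j))) \<le> 0" by (intro sum_nonpos) (simp add: not_less)
    with s[of i] show False by simp
  qed
  then have "\<forall>i. \<exists>j. \<mu> (Inl (i, j)) > 0" by blast
  from choice[OF this] obtain j where "\<forall>i. \<mu> (Inl (i, j i)) > 0" ..
  then have j: "\<And>i. \<mu> (Inl (i, j i)) > 0" by blast
  have "z \<in> cell j" if z: "z \<in> deformed" "proj4 z \<in> G" for z
  proof -
    have le: "rows \<delta> r \<bullet> z \<le> 1" for r using z(1) by (simp add: deformed_def polyh_def)
    have "f \<bullet> z = f \<bullet> q" using z(2) w(2) f fq by auto
    then have "(\<Sum>k\<in>UNIV. \<mu> k * (rows \<delta> k \<bullet> z)) = (\<Sum>k\<in>UNIV. \<mu> k * (rows \<delta> k \<bullet> q))"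
      unfolding \<mu>(3) inner_sum_left by simp
    also have "\<dots> = (\<Sum>k\<in>UNIV. \<mu> k)"
      using \<mu>(2) by (intro sum.cong) (auto simp: active_def)
    finally have "(\<Sum>k\<in>UNIV. \<mu> k * (1 - rows \<delta> k \<bullet> z)) = 0"
      by (simp add: right_diff_distrib sum_subtractf)
    then have "\<forall>k\<in>UNIV. \<mu> k * (1 - rows \<delta> k \<bullet> z) = 0"
      using \<mu>(1) le by (subst (asm) sum_nonneg_eq_0_iff) auto
    then have "rows \<delta> (Inl (i, j i)) \<bullet> z = 1" for i using j[of i] by (force dest: bspec[of _ _ "Inl (i, j i)"])
    then show ?thesis using z by (simp add: cell_def)
  qed
  then show thesis using that by blast
qed

lemma interior_deformed: "0 \<in> interior deformed"
proof -
  have "{z. \<forall>r. rows \<delta> r \<bullet> z < 1} = (\<Inter>r. {z. rows \<delta> r \<bullet> z < 1})" by auto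
  then have "open {z. \<forall>r. rows \<delta> r \<bullet> z < 1}" by (simp add: open_INT open_halfspace_lt)
  moreover have "{z. \<forall>r. rows \<delta> r \<bullet> z < 1} \<subseteq> deformed" by (auto simp: deformed_def polyh_def less_imp_le)
  ultimately show ?thesis by (intro interiorI[of _ 0]) auto
qed

lemma surj_proj4: "surj proj4"
  unfolding surj_def
proof
  fix w :: "real^4"
  obtain n where n: "CARD('p) = Suc n" using card_pos gr0_implies_Suc by blast
  define z :: "'p ambient" where "z = (((\<chi> i. if i = 1 then w $ 1 else w $ 2), axis (e n) (w $ 3)), w $ 4 / \<delta>)"
  have "chain z k = 0" if "k \<noteq> 0" "k < CARD('p)" for k
  proof -
    obtain l where l: "k = Suc l" using \<open>k \<noteq> 0\<close> by (cases k) auto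
    have "l \<noteq> n" "l < CARD('p)" "n < CARD('p)" using that(2) n l by linarith+
    then have "pos (e l) \<noteq> pos (e n)" using pos(3) by presburger
    then have "e l \<noteq> e n" by (rule contrapos_nn) (rule arg_cong)
    then show ?thesis by (simp add: l z_def axis_def)
  qed
  then have "(\<Sum>k<CARD('p). M ^ k * chain z k) = (\<Sum>k<CARD('p). if k = 0 then chain z 0 else 0)"
    by (intro sum.cong) (auto simp del: chain_simps)
  also have "\<dots> = w $ 4 / \<delta>" using card_pos by (simp add: z_def)
  finally have "weight z = w $ 4" using delta by (simp add: weight_def)
  moreover have "chain z CARD('p) = w $ 3" by (simp add: n z_def)
  ultimately have "w = proj4 z" by (simp add: vec_eq_iff forall_4 del: chain_simps) (simp add: z_def)
  then show "\<exists>z. w = proj4 z" ..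
qed

lemma interior_proj4: "0 \<in> interior (proj4 ` deformed)"
proof -
  have "open (proj4 ` interior deformed)" by (rule open_surjective_linear_image[OF open_interior linear_proj4 surj_proj4])
  moreover have "proj4 ` interior deformed \<subseteq> proj4 ` deformed" using interior_subset by blast
  moreover have "0 \<in> proj4 ` interior deformed" using interior_deformed linear_0[OF linear_proj4] by (metis image_eqI)
  ultimately show ?thesis by (meson interiorI)
qed

text \<open>The linear change of coordinates that turns the projection into a coordinate projection. The prism coordinate,
which is the chain coordinate \<open>0\<close>, is replaced by the weight; it can be recovered since the weight involves it
with the coefficient \<open>\<delta>\<close>.\<close>
definition embed :: "'p ambient \<Rightarrow> real^('p + 3)" where
  "embed z = (\<chi> i. case i of Inl l \<Rightarrow> if pos l = 0 then weight z else chain z (pos l)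
     | Inr k \<Rightarrow> proj4 z $ drop4 k)"

definition keep4 :: "4 \<Rightarrow> 'p + 3" where
  "keep4 i = (if i = 1 then Inr 1 else if i = 2 then Inr 2 else if i = 3 then Inr 3 else Inl (e 0))"

lemma inj_keep4: "inj keep4"
proof (rule injI)
  fix i k assume "keep4 i = keep4 k"
  then show "i = k" using exhaust_4[of i] exhaust_4[of k] by (auto simp: keep4_def split: if_splits)
qed

lemma coord_proj_embed: "coord_proj keep4 (embed z) = proj4 z"
  using pos(3)[OF card_pos]
  by (simp add: vec_eq_iff forall_4 coord_proj_def keep4_def embed_def drop4_def del: chain_simps)

lemma linear_embed: "linear embed"
proof -
  have w: "weight (z + z') = weight z + weight z'" "weight (r *\<^sub>R z) = r * weight z" for z z' r
    using linear_add[OF linear_proj4, of z z'] linear_scale[OF linear_proj4, of r z]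
    by (auto simp: vec_eq_iff forall_4)
  show ?thesis
    by (rule linearI) (auto simp: vec_eq_iff embed_def w chain_add chain_scale linear_add[OF linear_proj4]
        linear_scale[OF linear_proj4] simp del: chain_simps split: sum.splits)
qed

lemma inj_embed: "inj embed"
  unfolding linear_injective_0[OF linear_embed]
proof (intro allI impI)
  fix z assume z: "embed z = 0"
  then have p: "proj4 z = 0" unfolding coord_proj_embed[symmetric] by (simp add: coord_proj_def vec_eq_iff)
  then have x: "fst (fst z) = 0" and m: "chain z CARD('p) = 0" and wt: "weight z = 0"
    by (auto simp: vec_eq_iff forall_4 forall_2)
  have mid: "chain z k = 0" if "k \<noteq> 0" "k < CARD('p)" for k
  proof -
    have "embed z $ Inl (e k) = 0" using z by simp
    then show ?thesis using that pos(3)[OF that(2)] by (simp add: embed_def)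
  qed
  then have "(\<Sum>k<CARD('p). M ^ k * chain z k) = (\<Sum>k<CARD('p). if k = 0 then chain z 0 else 0)"
    by (intro sum.cong) (auto simp del: chain_simps)
  then have "chain z 0 = 0" using wt delta card_pos by (simp add: weight_def del: chain_simps)
  then have all: "chain z k = 0" if "k \<le> CARD('p)" for k using that mid m by (metis le_neq_implies_less)
  have "snd (fst z) $ i = 0" for i using all[of "Suc (pos i)"] pos(1)[of i] by (simp add: pos(2) Suc_leI)
  moreover have "snd z = 0" using all[of 0] by simp
  ultimately show "z = 0" using x by (simp add: prod_eq_iff vec_eq_iff)
qed

end

section \<open>Posets of faces\<close>

lemma poset_iso_comp:
  assumes "poset_iso A leA B leB f" "poset_iso B leB C leC g"
  shows "poset_iso A leA C leC (\<lambda>x. g (f x))"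
proof -
  have "bij_betw (g \<circ> f) A C" using assms bij_betw_trans unfolding poset_iso_def by blast
  moreover have "f x \<in> B" if "x \<in> A" for x using assms(1) that by (auto simp: poset_iso_def bij_betw_def)
  ultimately show ?thesis using assms by (simp add: poset_iso_def o_def)
qed

lemma poset_iso_subset_image:
  assumes "\<And>x y. x \<in> A \<Longrightarrow> y \<in> A \<Longrightarrow> x \<subseteq> y \<longleftrightarrow> f x \<subseteq> f y"
  shows "poset_iso A (\<subseteq>) (f ` A) (\<subseteq>) f"
  unfolding poset_iso_def bij_betw_def
proof (intro conjI ballI)
  show "inj_on f A" by (rule inj_onI) (use assms in blast)
qed (use assms in auto)

lemma poset_iso_supset_image:
  assumes "\<And>x y. x \<in> A \<Longrightarrow> y \<in> A \<Longrightarrow> x \<subseteq> y \<longleftrightarrow> f y \<subseteq> f x"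
  shows "poset_iso A (\<supseteq>) (f ` A) (\<subseteq>) f"
  unfolding poset_iso_def bij_betw_def
proof (intro conjI ballI)
  show "inj_on f A" by (rule inj_onI) (use assms in blast)
qed (use assms in auto)

lemma comb_equivalent_sym: "comb_equivalent P Q \<Longrightarrow> comb_equivalent Q P"
proof -
  assume "comb_equivalent P Q"
  then obtain \<phi> where b: "bij_betw \<phi> (faces P) (faces Q)"
    and o: "\<And>x y. x \<in> faces P \<Longrightarrow> y \<in> faces P \<Longrightarrow> x \<subseteq> y \<longleftrightarrow> \<phi> x \<subseteq> \<phi> y"
    by (auto simp: comb_equivalent_def face_lattice_iso_def poset_iso_def)
  have b': "bij_betw (inv_into (faces P) \<phi>) (faces Q) (faces P)" by (rule bij_betw_inv_into[OF b])
  have "x \<subseteq> y \<longleftrightarrow> inv_into (faces P) \<phi> x \<subseteq> inv_into (faces P) \<phi> y" if "x \<in> faces Q" "y \<in> faces Q" for x y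
  proof -
    have "inv_into (faces P) \<phi> x \<in> faces P" "inv_into (faces P) \<phi> y \<in> faces P"
      using b' that by (auto simp: bij_betw_def)
    from o[OF this] show ?thesis using bij_betw_inv_into_right[OF b] that by simp
  qed
  then have "face_lattice_iso Q P (inv_into (faces P) \<phi>)"
    using b' by (simp add: face_lattice_iso_def poset_iso_def)
  then show ?thesis unfolding comb_equivalent_def by blast
qed

lemma comb_equivalent_trans: "comb_equivalent P Q \<Longrightarrow> comb_equivalent Q R \<Longrightarrow> comb_equivalent P R"
  unfolding comb_equivalent_def face_lattice_iso_def using poset_iso_comp by blast

text \<open>Dimensions are computed from strict chains of faces: a chain of maximal length in a space of dimension
four leaves no room for gaps.\<close>
lemma face_aff_dim_strict:
  fixes D :: "'a::euclidean_space set"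
  assumes "A face_of D" "B face_of D" "A \<subset> B"
  shows "aff_dim A < aff_dim B"
  using assms face_of_aff_dim_lt[of B A] face_of_imp_convex face_of_imp_subset face_of_subset[of A D B] by blast

lemma dual_polytope_extremes:
  assumes "poset_iso (faces P) (\<subseteq>) (faces D) (\<supseteq>) \<psi>" and P: "convex P" and D: "convex D"
  shows "\<psi> {} = D" "\<psi> P = {}"
proof -
  have b: "\<psi> ` faces P = faces D" and o: "\<And>x y. x \<in> faces P \<Longrightarrow> y \<in> faces P \<Longrightarrow> x \<subseteq> y \<Longrightarrow> \<psi> y \<subseteq> \<psi> x"
    using assms(1) by (auto simp: poset_iso_def bij_betw_def)
  have f: "{} \<in> faces P" "P \<in> faces P" "{} \<in> faces D" "D \<in> faces D"
    using P D by (auto simp: faces_def face_of_refl)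
  have sub: "F \<subseteq> P" "G \<subseteq> D" if "F \<in> faces P" "G \<in> faces D" for F G
    using that by (auto simp: faces_def face_of_imp_subset)
  obtain G where "G \<in> faces P" "\<psi> G = D" using b f by (metis imageE)
  then have "D \<subseteq> \<psi> {}" using o[OF f(1), of G] by simp
  moreover have "\<psi> {} \<in> faces D" using b f by blast
  ultimately show "\<psi> {} = D" by (auto simp: faces_def dest: face_of_imp_subset)
  obtain G where "G \<in> faces P" "\<psi> G = {}" using b f by (metis imageE)
  then show "\<psi> P = {}" using o[of G P] sub f by (auto simp: faces_def dest: face_of_imp_subset)
qed

section \<open>The prism over the surface\<close>

context deformed_prism
begin

abbreviation "W \<equiv> wedge_product a b"
abbreviation "\<Sigma> \<equiv> wedge_surface a b"
abbreviation "I \<equiv> {0..1::real}"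

definition transfer :: "'p ambient set \<Rightarrow> 'p ambient set" where
  "transfer F = slice (rows \<delta>) (\<lambda>_. 1) (common (rows 0) prism_rhs F)"

lemma UNIV_not_pattern_prism: "UNIV \<notin> patterns (rows 0) prism_rhs"
  using UNIV_not_pattern[of \<delta>] same_patterns by simp

lemma transfer_iso: "face_lattice_iso (W \<times> I) deformed transfer"
  using face_lattice_iso_patterns[OF same_patterns[symmetric] UNIV_not_pattern_prism]
  unfolding polyh_wedge_prism deformed_def transfer_def[abs_def] .

lemma transfer_mono_iff: "F face_of W \<times> I \<Longrightarrow> G face_of W \<times> I \<Longrightarrow> transfer F \<subseteq> transfer G \<longleftrightarrow> F \<subseteq> G"
  using transfer_iso by (auto simp: face_lattice_iso_def poset_iso_def faces_def)

lemma transfer_face: "F face_of W \<times> I \<Longrightarrow> transfer F face_of deformed"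
  unfolding transfer_def deformed_def by (rule slice_face_of)

lemma transfer_surj: "G face_of deformed \<Longrightarrow> \<exists>F. F face_of W \<times> I \<and> transfer F = G"
  using transfer_iso by (auto simp: face_lattice_iso_def poset_iso_def faces_def bij_betw_def)
    (metis (mono_tags, lifting) imageE mem_Collect_eq)

lemma common_transfer:
  assumes "F face_of W \<times> I"
  shows "common (rows \<delta>) (\<lambda>_. 1) (transfer F) = common (rows 0) prism_rhs F"
proof -
  have F: "F face_of polyh (rows 0) prism_rhs" using assms by (simp add: polyh_wedge_prism)
  have "common (rows 0) prism_rhs F \<in> insert UNIV (patterns (rows \<delta>) (\<lambda>_. 1))"
    using slice_common(2)[OF UNIV_not_pattern_prism F] same_patterns by simp
  then show ?thesis
    using common_slice[of _ "rows \<delta>" "\<lambda>_. 1"] slice_UNIV[OF UNIV_not_pattern[of \<delta>]]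
    by (auto simp: transfer_def) (auto simp: common_def)
qed

lemma transfer_empty: "transfer {} = {}"
  using slice_UNIV[OF UNIV_not_pattern[of \<delta>]] by (simp add: transfer_def common_def)

lemma transfer_nonempty: "F face_of W \<times> I \<Longrightarrow> F \<noteq> {} \<Longrightarrow> transfer F \<noteq> {}"
  using transfer_mono_iff[of F "{}"] transfer_empty by (auto simp: empty_face_of)

text \<open>Being contained in a cell means that the chosen rows are tight, and the transfer of faces keeps the set of
tight rows.\<close>
lemma transfer_subset_cell:
  "transfer F \<subseteq> cell j \<longleftrightarrow> (\<forall>i. F \<subseteq> wedge_hyperplane a b i (j i) \<times> UNIV)" if F: "F face_of W \<times> I"
proof -
  have row: "rows 0 (Inl (i, k)) \<bullet> z = 1 \<longleftrightarrow> fst z \<in> wedge_hyperplane a b i k" for i k z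
    by (auto simp: rows_inner wedge_hyperplane_def)
  have times: "F \<subseteq> H \<times> UNIV \<longleftrightarrow> (\<forall>z\<in>F. fst z \<in> H)" for H
    by (auto simp only: subset_iff mem_Times_iff UNIV_I)
  have "transfer F \<subseteq> cell j \<longleftrightarrow> (\<forall>i. Inl (i, j i) \<in> common (rows \<delta>) (\<lambda>_. 1) (transfer F))"
    using face_of_imp_subset[OF transfer_face[OF F]] by (auto simp: cell_def common_def)
  also have "\<dots> \<longleftrightarrow> (\<forall>i. F \<subseteq> wedge_hyperplane a b i (j i) \<times> UNIV)"
    unfolding common_transfer[OF F] times
    by (simp add: common_def prism_rhs_def row)
  finally show ?thesis .
qed

text \<open>The polygon of the surface denoted by the vector of singletons \<open>j\<close>. It is the graph of the map \<open>lift\<close>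
over the polygon given by \<open>a\<close>.\<close>
definition sheet :: "('p \<Rightarrow> 2) \<Rightarrow> ((real^2) \<times> (real^'p)) set" where
  "sheet j = {q \<in> W. \<forall>i. q \<in> wedge_hyperplane a b i (j i)}"

definition lift :: "('p \<Rightarrow> 2) \<Rightarrow> real^2 \<Rightarrow> (real^2) \<times> (real^'p)" where
  "lift j x = (x, \<chi> i. (1 - a i \<bullet> x) / b (j i))"

lemma lift_in_sheet:
  assumes "x \<in> ineq_polyhedron a" shows "lift j x \<in> sheet j"
proof -
  have "a i \<bullet> x + b k * ((1 - a i \<bullet> x) / b (j i)) \<le> 1" for i k
  proof (cases "k = j i")
    case True
    then show ?thesis using b_props(1)[of k] by simp
  next
    case False
    then have "b k * b (j i) < 0" by (rule b_props)
    then have "b k / b (j i) \<le> 0" by (auto simp: mult_less_0_iff divide_nonneg_neg divide_nonpos_pos)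
    moreover have s: "a i \<bullet> x \<le> 1" using assms by (simp add: ineq_polyhedron_def)
    ultimately have "(b k / b (j i)) * (1 - a i \<bullet> x) \<le> 0" by (intro mult_nonpos_nonneg) simp_all
    moreover have "b k * ((1 - a i \<bullet> x) / b (j i)) = (b k / b (j i)) * (1 - a i \<bullet> x)" by simp
    ultimately show ?thesis using s by linarith
  qed
  moreover have "a i \<bullet> x + b (j i) * ((1 - a i \<bullet> x) / b (j i)) = 1" for i using b_props(1)[of "j i"] by simp
  ultimately show ?thesis by (auto simp: sheet_def lift_def wedge_product_def wedge_hyperplane_def)
qed

lemma polytope_prism: "polytope (W \<times> I)"
proof -
  have "polyh (rows 0) prism_rhs \<subseteq> polyh (rows 0) (\<lambda>_. 1)"
  proof
    fix z assume z: "z \<in> polyh (rows 0) prism_rhs"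
    have "rows 0 r \<bullet> z \<le> 1" for r
    proof -
      have "rows 0 r \<bullet> z \<le> prism_rhs r" using z unfolding polyh_def by blast
      also have "\<dots> \<le> 1" by (simp add: prism_rhs_def)
      finally show ?thesis .
    qed
    then show "z \<in> polyh (rows 0) (\<lambda>_. 1)" by (simp add: polyh_def)
  qed
  then have "bounded (polyh (rows 0) prism_rhs)" using bounded_undeformed bounded_subset by blast
  then show ?thesis
    using polyhedron_polyh[of "rows 0" prism_rhs] by (simp add: polyh_wedge_prism polytope_eq_bounded_polyhedron)
qed

lemma polytope_W: "polytope W"
proof -
  have "fst ` (W \<times> I) = W" by (auto simp: image_def)
  then show ?thesis using polytope_linear_image[OF linear_fst polytope_prism] by simp
qed

lemma sheet_face: "sheet j face_of W"
proof -
  have *: "(W \<inter> {q. (a i, b (j i) *\<^sub>R axis i 1) \<bullet> q = 1}) face_of W" for i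
    by (rule face_of_Int_supporting_hyperplane_le[OF polytope_imp_convex[OF polytope_W]])
      (auto simp: wedge_product_def inner_axis')
  have "sheet j = \<Inter>(range (\<lambda>i. W \<inter> {q. (a i, b (j i) *\<^sub>R axis i 1) \<bullet> q = 1}))"
    by (auto simp: sheet_def wedge_hyperplane_def inner_axis')
  also have "\<dots> face_of W" by (rule face_of_Inter) (use * in auto)
  finally show ?thesis .
qed

lemma zero_in_polygon: "0 \<in> ineq_polyhedron a"
  by (simp add: ineq_polyhedron_def)

lemma facet_vector_sheet: "facet_vector a b (sheet j) i = {j i}"
proof -
  have "k = j i" if "sheet j \<subseteq> wedge_hyperplane a b i k" for k
  proof -
    have "lift j 0 \<in> wedge_hyperplane a b i k" using lift_in_sheet[OF zero_in_polygon] that by blast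
    then have "b k = b (j i)" using b_props(1)[of "j i"] by (simp add: lift_def wedge_hyperplane_def)
    then show ?thesis using b_props(3)[of k "j i"] by blast
  qed
  then show ?thesis by (auto simp: facet_vector_def sheet_def)
qed

lemma wedge_surface_iff: "F \<in> \<Sigma> \<longleftrightarrow> (\<exists>j. F face_of sheet j)"
proof
  assume "F \<in> \<Sigma>"
  then obtain G j where G: "G face_of W" "\<forall>i. facet_vector a b G i = {j i}" "F face_of G"
    by (auto simp: wedge_surface_def)
  have "G \<subseteq> wedge_hyperplane a b i (j i)" for i
  proof -
    have "j i \<in> facet_vector a b G i" using G(2) by simp
    then show ?thesis by (simp add: facet_vector_def)
  qed
  then have "G \<subseteq> sheet j" using face_of_imp_subset[OF G(1)] by (auto simp: sheet_def)
  then have "G face_of sheet j" by (rule face_of_subset[OF G(1) _ face_of_imp_subset[OF sheet_face]])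
  then show "\<exists>j. F face_of sheet j" using face_of_trans[OF G(3)] by blast
next
  assume "\<exists>j. F face_of sheet j"
  then obtain j where j: "F face_of sheet j" ..
  show "F \<in> \<Sigma>"
    unfolding wedge_surface_def
    by (rule CollectI, intro exI[of _ "sheet j"] exI[of _ j]) (simp add: sheet_face facet_vector_sheet j)
qed

lemma surface_face_of_W: "F \<in> \<Sigma> \<Longrightarrow> F face_of W"
proof -
  assume "F \<in> \<Sigma>"
  then obtain j where "F face_of sheet j" using wedge_surface_iff by blast
  then show ?thesis by (rule face_of_trans[OF _ sheet_face])
qed

lemma surface_iff_subset: "F \<in> \<Sigma> \<longleftrightarrow> F face_of W \<and> (\<exists>j. F \<subseteq> sheet j)"
proof
  assume F: "F \<in> \<Sigma>"
  then obtain j where "F face_of sheet j" using wedge_surface_iff by blast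
  then have "F \<subseteq> sheet j" by (rule face_of_imp_subset)
  then show "F face_of W \<and> (\<exists>j. F \<subseteq> sheet j)" using surface_face_of_W[OF F] by blast
next
  assume "F face_of W \<and> (\<exists>j. F \<subseteq> sheet j)"
  then obtain j where j: "F face_of W" "F \<subseteq> sheet j" by blast
  have "F face_of sheet j" by (rule face_of_subset[OF j face_of_imp_subset[OF sheet_face]])
  then show "F \<in> \<Sigma>" using wedge_surface_iff by blast
qed

lemma prism_surface_iff: "X \<in> prism \<Sigma> \<longleftrightarrow> X face_of W \<times> I \<and> (\<exists>j. X \<subseteq> sheet j \<times> UNIV)"
proof
  assume "X \<in> prism \<Sigma>"
  then obtain F J where X: "X = F \<times> J" "F \<in> \<Sigma>" "J face_of I" by (auto simp: prism_def)
  then have "X face_of W \<times> I" using surface_face_of_W[OF X(2)] by (simp add: face_of_Times_eq)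
  moreover obtain j where "F \<subseteq> sheet j" using X(2) surface_iff_subset by blast
  then have "X \<subseteq> sheet j \<times> UNIV" using X(1) by auto
  ultimately show "X face_of W \<times> I \<and> (\<exists>j. X \<subseteq> sheet j \<times> UNIV)" by blast
next
  assume X: "X face_of W \<times> I \<and> (\<exists>j. X \<subseteq> sheet j \<times> UNIV)"
  then obtain F J where FJ: "X = F \<times> J" "F face_of W" "J face_of I" by (auto simp: face_of_Times_decomp)
  obtain j where j: "X \<subseteq> sheet j \<times> UNIV" using X by blast
  show "X \<in> prism \<Sigma>"
  proof (cases "J = {}")
    case True
    have "{} \<in> \<Sigma>" by (simp add: surface_iff_subset)
    then show ?thesis using True FJ unfolding prism_def by blast
  next
    case False
    then have "F \<subseteq> sheet j" using j FJ(1) by auto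
    then have "F \<in> \<Sigma>" using FJ(2) surface_iff_subset by blast
    then show ?thesis using FJ unfolding prism_def by blast
  qed
qed

text \<open>The prism over the surface consists of the faces that are transferred into some cell. In this
form the results about cells apply to all of its members at once.\<close>
lemma transfer_prism: "X \<in> prism \<Sigma> \<longleftrightarrow> X face_of W \<times> I \<and> (\<exists>j. transfer X \<subseteq> cell j)"
proof -
  have "(\<forall>i. X \<subseteq> wedge_hyperplane a b i (j i) \<times> UNIV) \<longleftrightarrow> X \<subseteq> sheet j \<times> UNIV" if "X face_of W \<times> I" for j
    using face_of_imp_subset[OF that] by (fastforce simp: sheet_def)
  then show ?thesis using transfer_subset_cell[of X] unfolding prism_surface_iff by blast
qed

definition realized_face :: "'p ambient set \<Rightarrow> (real^('p + 3)) set" where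
  "realized_face F = embed ` transfer F"

lemma segment_map_embed: "face_lattice_iso F (embed ` F) ((`) embed)" if "convex F"
  using that inj_embed by (intro segment_map_faces segment_map_on_linear linear_embed) (auto intro: inj_on_subset)

lemma realized_face_iso: "face_lattice_iso (W \<times> I) (embed ` deformed) realized_face"
  using poset_iso_comp[OF transfer_iso[unfolded face_lattice_iso_def]
      segment_map_embed[OF polytope_imp_convex[OF polytope_deformed], unfolded face_lattice_iso_def]]
  unfolding face_lattice_iso_def realized_face_def[abs_def] .

lemma polytope_embedded: "polytope (embed ` deformed)"
  by (rule polytope_linear_image[OF linear_embed polytope_deformed])

lemma coord_proj_image: "coord_proj keep4 ` embed ` X = proj4 ` X"
  by (simp add: image_image coord_proj_embed)

lemma preserved_realized_face:
  assumes F: "F \<in> prism \<Sigma> - {{}}"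
  shows "preserved (coord_proj keep4) (embed ` deformed) (realized_face F)"
proof -
  have P: "F face_of W \<times> I" "F \<noteq> {}" using F transfer_prism by auto
  obtain j where j: "transfer F \<subseteq> cell j" using F transfer_prism by auto
  have F0: "transfer F face_of deformed" using transfer_face P by blast
  note cp = cell_projects[OF F0 j]
  have conv: "convex (transfer F)" by (rule face_of_imp_convex[OF F0])
  have "comb_equivalent (transfer F) (proj4 ` transfer F)"
    using segment_map_faces[OF segment_map_on_linear[OF linear_proj4] conv cp(3)]
    unfolding comb_equivalent_def by blast
  moreover have "comb_equivalent (transfer F) (embed ` transfer F)"
    using segment_map_embed[OF conv] unfolding comb_equivalent_def by blast
  ultimately have ce: "comb_equivalent (proj4 ` transfer F) (embed ` transfer F)"
    using comb_equivalent_sym comb_equivalent_trans by blast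
  have "realized_face F face_of embed ` deformed" using realized_face_iso P(1)
    by (auto simp: face_lattice_iso_def poset_iso_def faces_def bij_betw_def)
  moreover have "coord_proj keep4 -` (proj4 ` transfer F) \<inter> embed ` deformed = embed ` transfer F"
  proof (intro equalityI subsetI)
    fix y assume "y \<in> coord_proj keep4 -` (proj4 ` transfer F) \<inter> embed ` deformed"
    then obtain z where z: "y = embed z" "z \<in> deformed" "coord_proj keep4 (embed z) \<in> proj4 ` transfer F" by blast
    then have "z \<in> transfer F" using cp(2) unfolding coord_proj_embed by blast
    then show "y \<in> embed ` transfer F" using z by blast
  next
    fix y assume "y \<in> embed ` transfer F"
    then show "y \<in> coord_proj keep4 -` (proj4 ` transfer F) \<inter> embed ` deformed"
      using face_of_imp_subset[OF F0] coord_proj_embed by auto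
  qed
  ultimately show ?thesis
    using cp(1) ce transfer_nonempty[OF P] unfolding preserved_def realized_face_def coord_proj_image by auto
qed

text \<open>The transferred faces form a subcomplex of the boundary of the deformed polytope, and the linear
projection to 3-space is injective on their union.\<close>
lemma prism_image_complex:
  shows "polytopal_complex ((\<lambda>F. coord_proj drop4 ` coord_proj keep4 ` realized_face F) ` prism \<Sigma>)" (is ?A)
    and "poset_iso (prism \<Sigma>) (\<subseteq>) ((\<lambda>F. coord_proj drop4 ` coord_proj keep4 ` realized_face F) ` prism \<Sigma>) (\<subseteq>)
      (\<lambda>F. coord_proj drop4 ` coord_proj keep4 ` realized_face F)" (is ?B)
proof -
  define h where "h = coord_proj drop4 \<circ> (proj4 :: 'p ambient \<Rightarrow> real^4)"
  define S0 where "S0 = transfer ` prism \<Sigma>"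
  have eq: "(\<lambda>F. coord_proj drop4 ` coord_proj keep4 ` realized_face F) = (\<lambda>F. h ` transfer F)"
    unfolding realized_face_def coord_proj_image h_def by (simp add: image_comp)
  have "linear (coord_proj drop4 :: real^4 \<Rightarrow> real^3)"
    by (rule linearI) (simp_all add: coord_proj_def vec_eq_iff)
  then have lin: "linear h" unfolding h_def by (rule linear_compose[OF linear_proj4])
  have S0: "polytopal_complex S0"
  proof (rule polytopal_complex_of_faces[OF polytope_deformed])
    show "F face_of deformed" if "F \<in> S0" for F using that transfer_face transfer_prism by (auto simp: S0_def)
    show "G \<in> S0" if F: "F \<in> S0" and G: "G face_of F" for F G
    proof -
      obtain X where X: "X \<in> prism \<Sigma>" "F = transfer X" using F by (auto simp: S0_def)
      then have XP: "X face_of W \<times> I" using transfer_prism by blast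
      have "G face_of deformed" using face_of_trans[OF G] transfer_face[OF XP] X(2) by simp
      then obtain Y where Y: "Y face_of W \<times> I" "transfer Y = G" using transfer_surj by blast
      obtain j where "transfer X \<subseteq> cell j" using X transfer_prism by blast
      then have "transfer Y \<subseteq> cell j" using Y X G face_of_imp_subset by blast
      then show ?thesis using Y transfer_prism unfolding S0_def by blast
    qed
  qed
  have "\<Union>S0 \<subseteq> (\<Union>j. cell j)" unfolding S0_def using transfer_prism by blast
  then have inj: "inj_on h (\<Union>S0)" using inj_proj3 inj_on_subset unfolding h_def by blast
  note im = polytopal_complex_image[OF S0 inj segment_map_on_linear[OF lin]]
  show ?A using im(1) unfolding eq S0_def by (simp add: image_image)
  have "poset_iso (prism \<Sigma>) (\<subseteq>) S0 (\<subseteq>) transfer"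
    unfolding S0_def by (rule poset_iso_subset_image) (use transfer_mono_iff transfer_prism in blast)
  from poset_iso_comp[OF this im(2)] show ?B unfolding eq S0_def by (simp add: image_image)
qed

lemma dual_exists: "\<exists>D :: (real^4) set. dual_polytope (coord_proj keep4 ` embed ` deformed) D"
  unfolding coord_proj_image
  using dual_polytope_polar[OF polytope_linear_image[OF linear_proj4 polytope_deformed] interior_proj4] by blast

end

context deformed_prism
begin

lemma aff_dim_sheet: "aff_dim (sheet j) \<ge> 2"
proof -
  have "{x. \<forall>i. a i \<bullet> x < 1} = (\<Inter>i. {x. a i \<bullet> x < 1})" by auto
  then have "open {x. \<forall>i. a i \<bullet> x < 1}" by (simp add: open_INT open_halfspace_lt)
  moreover have "0 \<in> {x. \<forall>i. a i \<bullet> x < 1}" by simp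
  ultimately have "aff_dim {x. \<forall>i. a i \<bullet> x < 1} = int DIM(real^2)" by (intro aff_dim_open) blast+
  then have "aff_dim {x. \<forall>i. a i \<bullet> x < 1} = 2" by simp
  moreover have "{x. \<forall>i. a i \<bullet> x < 1} \<subseteq> fst ` sheet j"
  proof
    fix x assume "x \<in> {x. \<forall>i. a i \<bullet> x < 1}"
    then have "x \<in> ineq_polyhedron a" by (simp add: ineq_polyhedron_def less_imp_le)
    then have "lift j x \<in> sheet j" by (rule lift_in_sheet)
    then show "x \<in> fst ` sheet j" by (rule image_eqI[rotated]) (simp add: lift_def)
  qed
  then have "aff_dim {x. \<forall>i. a i \<bullet> x < 1} \<le> aff_dim (fst ` sheet j)" by (rule aff_dim_subset)
  ultimately have "2 \<le> aff_dim (fst ` sheet j)" by simp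
  also have "\<dots> \<le> aff_dim (sheet j)" by (rule aff_dim_linear_image_le[OF linear_fst])
  finally show ?thesis .
qed

text \<open>A vertex of \<open>F\<close> lies in an edge of a polygon of the surface because the polygon is at least two-dimensional.\<close>
lemma surface_flag:
  assumes F: "F \<in> \<Sigma>" "F \<noteq> {}"
  obtains p E G where "{p} \<in> \<Sigma>" "p \<in> F" "E \<in> \<Sigma>" "G \<in> \<Sigma>" "{p} \<subset> E" "E \<subset> G"
proof -
  obtain j where j: "F face_of sheet j" using F wedge_surface_iff by blast
  have poly: "polytope (sheet j)" using sheet_face polytope_W face_of_polytope_polytope by blast
  then have "polytope F" using j face_of_polytope_polytope by blast
  then have "compact F" "convex F" by (auto simp: polytope_imp_compact polytope_imp_convex)
  then obtain p where p: "p extreme_point_of F" using extreme_point_exists_convex F(2) by blast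
  then have pF: "{p} face_of F" by (simp add: face_of_singleton)
  then have pj: "{p} face_of sheet j" using j face_of_trans by blast
  have "{p} \<noteq> sheet j" using aff_dim_sheet[of j] by (auto dest: arg_cong[where f = aff_dim])
  then obtain E where E: "E facet_of sheet j" "{p} \<subseteq> E"
    using face_of_polyhedron_subset_facet[OF polytope_imp_polyhedron[OF poly] pj] by blast
  then have Ej: "E face_of sheet j" "aff_dim E = aff_dim (sheet j) - 1" by (auto simp: facet_of_def)
  have "E \<noteq> sheet j" using Ej(2) by auto
  moreover have "E \<noteq> {p}" using Ej(2) aff_dim_sheet[of j] by auto
  ultimately have sub: "{p} \<subset> E" "E \<subset> sheet j" using E face_of_imp_subset[OF Ej(1)] by auto
  have "p \<in> F" using face_of_imp_subset[OF pF] by simp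
  moreover have "{p} \<in> \<Sigma>" "E \<in> \<Sigma>" "sheet j \<in> \<Sigma>"
    using pj Ej face_of_refl[OF polytope_imp_convex[OF poly]] wedge_surface_iff by blast+
  ultimately show thesis using that sub by blast
qed

section \<open>The dual surface\<close>

definition shadow :: "'p ambient set \<Rightarrow> (real^4) set" where
  "shadow X = proj4 ` transfer X"

lemma shadow_face: "X \<in> prism \<Sigma> \<Longrightarrow> shadow X face_of proj4 ` deformed"
  using cell_projects(1)[OF transfer_face] transfer_prism unfolding shadow_def by blast

lemma shadow_mono_iff:
  assumes "X face_of W \<times> I" "Y \<in> prism \<Sigma>"
  shows "shadow X \<subseteq> shadow Y \<longleftrightarrow> X \<subseteq> Y"
proof
  have Y: "Y face_of W \<times> I" using assms transfer_prism by blast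
  obtain j where j: "transfer Y \<subseteq> cell j" using assms transfer_prism by blast
  have inv: "proj4 -` (proj4 ` transfer Y) \<inter> deformed = transfer Y" by (rule cell_projects(2)[OF transfer_face[OF Y] j])
  assume "shadow X \<subseteq> shadow Y"
  then have "transfer X \<subseteq> transfer Y"
    using face_of_imp_subset[OF transfer_face[OF assms(1)]] inv unfolding shadow_def by blast
  then show "X \<subseteq> Y" using transfer_mono_iff[OF assms(1) Y] by simp
next
  assume "X \<subseteq> Y"
  then show "shadow X \<subseteq> shadow Y"
    using transfer_mono_iff[OF assms(1)] assms(2) transfer_prism unfolding shadow_def by blast
qed

lemma shadow_not_top: "X \<in> prism \<Sigma> \<Longrightarrow> shadow X \<noteq> proj4 ` deformed"
proof
  assume X: "X \<in> prism \<Sigma>" and eq: "shadow X = proj4 ` deformed"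
  obtain j where j: "transfer X \<subseteq> cell j" "X face_of W \<times> I" using X transfer_prism by blast
  have Q: "0 \<in> deformed" using interior_deformed interior_subset by blast
  then have "proj4 0 \<in> proj4 ` transfer X" using eq unfolding shadow_def by blast
  then have "0 \<in> transfer X" using cell_projects(2)[OF transfer_face[OF j(2)] j(1)] Q by blast
  then have "0 \<in> cell j" using j by blast
  then have "rows \<delta> (Inl (undefined, j undefined)) \<bullet> 0 = 1" unfolding cell_def by blast
  then show False by simp
qed

text \<open>The preimage of \<open>G\<close> in the deformed polytope is a face inside a cell, hence the transfer of some
\<open>F' \<times> J\<close>; as it contains the transfer of \<open>F \<times> I\<close>, the factor \<open>J\<close> is the whole interval.\<close>
lemma face_above_shadow:
  assumes F: "F \<in> \<Sigma>" "F \<noteq> {}" and G: "G face_of proj4 ` deformed" "G \<noteq> proj4 ` deformed" "shadow (F \<times> I) \<subseteq> G"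
  obtains F' where "F' \<in> \<Sigma>" "F' \<noteq> {}" "G = shadow (F' \<times> I)"
proof -
  have FI: "F \<times> I \<in> prism \<Sigma>" using F(1) face_of_refl[of I] by (auto simp: prism_def)
  then have FP: "F \<times> I face_of W \<times> I" using transfer_prism by blast
  have ne: "transfer (F \<times> I) \<noteq> {}" using transfer_nonempty[OF FP] F(2) by auto
  obtain q where q: "q \<in> rel_interior (transfer (F \<times> I))"
    using ne rel_interior_eq_empty face_of_imp_convex[OF transfer_face[OF FP]] by blast
  then have qF: "q \<in> transfer (F \<times> I)" using rel_interior_subset by blast
  then have qQ: "q \<in> deformed" using face_of_imp_subset[OF transfer_face[OF FP]] by blast
  have act: "active (rows \<delta>) (\<lambda>_. 1) q = common (rows 0) prism_rhs (F \<times> I)"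
    using face_rel_interior_active[OF transfer_face[OF FP, unfolded deformed_def] q] common_transfer[OF FP] by simp
  \<comment> \<open>the two ends of a vertical segment in \<open>F \<times> I\<close> have different prism coordinates\<close>
  have noR: "Inr s \<notin> active (rows \<delta>) (\<lambda>_. 1) q" for s
  proof
    obtain p where "p \<in> F" using F(2) by blast
    then have "(p, 0) \<in> F \<times> I" "(p, 1) \<in> F \<times> I" by auto
    moreover assume "Inr s \<in> active (rows \<delta>) (\<lambda>_. 1) q"
    ultimately have "rows 0 (Inr s) \<bullet> (p, 0) = prism_rhs (Inr s)" "rows 0 (Inr s) \<bullet> (p, 1) = prism_rhs (Inr s)"
      unfolding act common_def by blast+
    then show False by (cases s) (auto simp: rows_inner prism_rhs_def)
  qed
  have "proj4 q \<in> G" using qF G(3) by (auto simp: shadow_def)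
  then obtain j where j: "\<And>z. z \<in> deformed \<Longrightarrow> proj4 z \<in> G \<Longrightarrow> z \<in> cell j"
    using surface_star[OF G(1,2) qQ _ noR] by blast
  define G' where "G' = {z \<in> deformed. proj4 z \<in> G}"
  have "G' face_of deformed"
  proof -
    obtain w c where w: "proj4 ` deformed \<subseteq> {y. w \<bullet> y \<le> c}" "G = proj4 ` deformed \<inter> {y. w \<bullet> y = c}"
      using face_of_polytope_inequality[OF polytope_linear_image[OF linear_proj4 polytope_deformed] G(1)] .
    have f: "adjoint proj4 w \<bullet> z = w \<bullet> proj4 z" for z
      using adjoint_works[OF linear_proj4, of z w] by (simp add: inner_commute)
    have "G' = deformed \<inter> {z. adjoint proj4 w \<bullet> z = c}" using w(2) by (auto simp: G'_def f)
    also have "\<dots> face_of deformed"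
      by (rule face_of_Int_supporting_hyperplane_le[OF polytope_imp_convex[OF polytope_deformed]])
        (use w(1) in \<open>auto simp: f\<close>)
    finally show ?thesis .
  qed
  then obtain X where X: "X face_of W \<times> I" "transfer X = G'" using transfer_surj by blast
  have GX: "G = shadow X" using face_of_imp_subset[OF G(1)] by (auto simp: shadow_def X(2) G'_def)
  have "transfer X \<subseteq> cell j" using j by (auto simp: X(2) G'_def)
  then have XS: "X \<in> prism \<Sigma>" using transfer_prism X(1) by blast
  have "F \<times> I \<subseteq> X" using shadow_mono_iff[OF FP XS] G(3) GX by simp
  obtain F' J where FJ: "X = F' \<times> J" "F' \<in> \<Sigma>" "J face_of I" using XS by (auto simp: prism_def)
  have "F \<subseteq> F'" "I \<subseteq> J" using \<open>F \<times> I \<subseteq> X\<close> F(2) unfolding FJ(1) times_subset_iff by auto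
  then have "J = I" using face_of_imp_subset[OF FJ(3)] by blast
  then show thesis using that[of F'] FJ GX F(2) \<open>F \<subseteq> F'\<close> by blast
qed

lemma endpoint_faces: "{0} face_of I" "{1} face_of I"
proof -
  have "(I \<inter> {x. (1::real) \<bullet> x = 1}) face_of I" by (rule face_of_Int_supporting_hyperplane_le) auto
  moreover have "I \<inter> {x. (1::real) \<bullet> x = 1} = {1}" by auto
  ultimately show "{1} face_of I" by simp
  have "(I \<inter> {x. (-1::real) \<bullet> x = 0}) face_of I" by (rule face_of_Int_supporting_hyperplane_le) auto
  moreover have "I \<inter> {x. (-1::real) \<bullet> x = 0} = {0}" by auto
  ultimately show "{0} face_of I" by simp
qed

text \<open>The faces of \<open>D\<close> dual to the projected \<open>F \<times> I\<close> form the dual surface. The strict chain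
\<open>{p} \<times> {0} \<subset> {p} \<times> I \<subset> E \<times> I \<subset> G \<times> I\<close>, completed by the empty face and the whole polytope, is reversed by duality
and has maximal length in 4-space. It shows that \<open>D\<close> is full-dimensional, that the dual of \<open>{p} \<times> {0}\<close> is a facet, and that the
dual of \<open>{p} \<times> I\<close> is a polygon.\<close>
lemma dual_surface:
  fixes D :: "(real^4) set"
  assumes dual: "dual_polytope (coord_proj keep4 ` embed ` deformed) D"
  shows "\<exists>S K. subcomplex_of S (boundary_complex D) \<and> has_dual_face_poset \<Sigma> S \<and>
     schlegel_image D S K \<and> polytopal_complex K \<and> pure_2_dimensional K \<and> has_dual_face_poset \<Sigma> K"
proof -
  define P where "P = proj4 ` deformed"
  have polyP: "polytope P" unfolding P_def by (rule polytope_linear_image[OF linear_proj4 polytope_deformed])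
  have polyD: "polytope D" and "\<exists>\<psi>. poset_iso (faces P) (\<subseteq>) (faces D) (\<supseteq>) \<psi>"
    using dual unfolding dual_polytope_def coord_proj_image P_def by auto
  then obtain \<psi> where \<psi>: "poset_iso (faces P) (\<subseteq>) (faces D) (\<supseteq>) \<psi>" by (elim exE)
  have ord: "\<psi> B \<subseteq> \<psi> A \<longleftrightarrow> A \<subseteq> B" if "A face_of P" "B face_of P" for A B
    using \<psi> that by (auto simp: poset_iso_def faces_def)
  have face\<psi>: "\<psi> A face_of D" if "A face_of P" for A
    using \<psi> that by (auto simp: poset_iso_def faces_def bij_betw_def)
  have surj\<psi>: "\<exists>A. A face_of P \<and> \<psi> A = B" if "B face_of D" for B
  proof -
    have "B \<in> \<psi> ` faces P" using \<psi> that by (auto simp: poset_iso_def bij_betw_def faces_def)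
    then show ?thesis by (auto simp: faces_def)
  qed
  have ext: "\<psi> {} = D" "\<psi> P = {}"
    using dual_polytope_extremes[OF \<psi>] polyP polyD polytope_imp_convex by auto
  have PP: "P face_of P" by (rule face_of_refl[OF polytope_imp_convex[OF polyP]])
  have kf: "shadow X face_of P" if "X \<in> prism \<Sigma>" for X using shadow_face[OF that] by (simp add: P_def)
  have kP: "shadow X \<noteq> P" if "X \<in> prism \<Sigma>" for X using shadow_not_top[OF that] by (simp add: P_def)
  have pf: "X face_of W \<times> I" if "X \<in> prism \<Sigma>" for X using that transfer_prism by blast
  have k0: "shadow X \<noteq> {}" if "X \<in> prism \<Sigma>" "X \<noteq> {}" for X
    using transfer_nonempty[OF pf[OF that(1)] that(2)] by (simp add: shadow_def)
  have sub: "\<psi> (shadow Y) \<subseteq> \<psi> (shadow X) \<longleftrightarrow> X \<subseteq> Y" if "X \<in> prism \<Sigma>" "Y \<in> prism \<Sigma>" for X Y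
    using ord[OF kf[OF that(1)] kf[OF that(2)]] shadow_mono_iff[OF pf[OF that(1)] that(2)] by simp
  have psub: "\<psi> (shadow Y) \<subset> \<psi> (shadow X)" if "X \<in> prism \<Sigma>" "Y \<in> prism \<Sigma>" "X \<subset> Y" for X Y
    using that(3) unfolding less_le_not_le by (simp add: sub that(1,2))
  have ne: "\<psi> (shadow X) \<noteq> {}" if "X \<in> prism \<Sigma>" for X
  proof
    assume "\<psi> (shadow X) = {}"
    then have "P \<subseteq> shadow X" using ord[OF PP kf[OF that]] by simp
    then show False using kP[OF that] face_of_imp_subset[OF kf[OF that]] by simp
  qed
  have nD: "\<psi> (shadow X) \<noteq> D" if "X \<in> prism \<Sigma>" "X \<noteq> {}" for X
  proof
    assume "\<psi> (shadow X) = D"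
    then have "shadow X \<subseteq> {}" using ord[OF kf[OF that(1)] empty_face_of] ext(1) by simp
    then show False using k0[OF that] by simp
  qed
  have FI: "F \<times> I \<in> prism \<Sigma>" if "F \<in> \<Sigma>" for F using that face_of_refl[of I] by (auto simp: prism_def)
  have F01: "F \<times> {0} \<in> prism \<Sigma>" "F \<times> {1} \<in> prism \<Sigma>" if "F \<in> \<Sigma>" for F
    using that endpoint_faces by (auto simp: prism_def)

  define \<theta> where "\<theta> F = \<psi> (shadow (F \<times> I))" for F
  define S where "S = insert {} (\<theta> ` (\<Sigma> - {{}}))"
  have \<theta>sub: "F \<subseteq> F' \<longleftrightarrow> \<theta> F' \<subseteq> \<theta> F" if "F \<in> \<Sigma>" "F' \<in> \<Sigma>" for F F'
    
  proof -
    have "F \<times> I \<subseteq> F' \<times> I \<longleftrightarrow> F \<subseteq> F'" by (auto simp: times_subset_iff)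
    then show ?thesis unfolding \<theta>_def using sub[OF FI[OF that(1)] FI[OF that(2)]] by simp
  qed
  have \<theta>ne: "\<theta> F \<noteq> {}" if "F \<in> \<Sigma>" for F unfolding \<theta>_def by (rule ne[OF FI[OF that]])
  have \<theta>face: "\<theta> F face_of D" if "F \<in> \<Sigma>" for F unfolding \<theta>_def by (rule face\<psi>[OF kf[OF FI[OF that]]])
  have Sface: "X face_of D" if "X \<in> S" for X using that \<theta>face by (auto simp: S_def)
  have Sclosed: "Y \<in> S" if X: "X \<in> S" and Y: "Y face_of X" for X Y
  proof (cases "X = {}")
    case True
    then show ?thesis using Y by (simp add: S_def)
  next
    case False
    then obtain F where F: "F \<in> \<Sigma>" "F \<noteq> {}" "X = \<theta> F" using X by (auto simp: S_def)
    have "Y face_of D" using face_of_trans[OF Y Sface[OF X]] .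
    then obtain A where A: "A face_of P" "\<psi> A = Y" using surj\<psi> by blast
    have "shadow (F \<times> I) \<subseteq> A"
      using ord[OF kf[OF FI[OF F(1)]] A(1)] face_of_imp_subset[OF Y] A(2) F(3) by (simp add: \<theta>_def)
    show ?thesis
    proof (cases "A = P")
      case True
      then show ?thesis using A ext by (simp add: S_def)
    next
      case False
      obtain F' where "F' \<in> \<Sigma>" "F' \<noteq> {}" "A = shadow (F' \<times> I)"
        by (rule face_above_shadow[OF F(1,2) A(1)[unfolded P_def] False[unfolded P_def] \<open>shadow (F \<times> I) \<subseteq> A\<close>]) blast
      then show ?thesis using A(2) by (auto simp: S_def \<theta>_def)
    qed
  qed
  have Scomplex: "polytopal_complex S" by (rule polytopal_complex_of_faces[OF polyD Sface Sclosed])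

  have dims: "\<exists>E\<in>\<Sigma>. \<exists>G\<in>\<Sigma>. {} \<subset> \<theta> G \<and> \<theta> G \<subset> \<theta> E \<and> \<theta> E \<subset> \<theta> {p} \<and> E \<noteq> {} \<and> G \<noteq> {} \<and>
      aff_dim (\<theta> {p}) = 2 \<and> aff_dim D = 4 \<and>
      aff_dim (\<psi> (shadow ({p} \<times> {0}))) = 3 \<and> aff_dim (\<psi> (shadow ({p} \<times> {1}))) = 3"
    if E: "E \<in> \<Sigma>" and G: "G \<in> \<Sigma>" and p: "{p} \<in> \<Sigma>" and lt: "{p} \<subset> E" "E \<subset> G" for p E G
  proof -
    note strict = face_aff_dim_strict[of _ D]
    have 1: "{} \<subset> \<theta> G" using \<theta>ne[OF G] by auto
    have 2: "\<theta> G \<subset> \<theta> E" "\<theta> E \<subset> \<theta> {p}" 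
      using lt unfolding less_le_not_le \<theta>sub[OF E G] \<theta>sub[OF G E] \<theta>sub[OF p E] \<theta>sub[OF E p] by auto
    have a1: "-1 < aff_dim (\<theta> G)" using strict[OF empty_face_of \<theta>face[OF G] 1] by simp
    have a2: "aff_dim (\<theta> G) < aff_dim (\<theta> E)" "aff_dim (\<theta> E) < aff_dim (\<theta> {p})"
      using strict \<theta>face E G p 2 by blast+
    have up: "aff_dim (\<theta> {p}) < aff_dim (\<psi> (shadow ({p} \<times> {s}))) \<and> aff_dim (\<psi> (shadow ({p} \<times> {s}))) < aff_dim D"
      if s: "{p} \<times> {s} \<in> prism \<Sigma>" "s \<in> I" for s
    proof
      define s' :: real where "s' = (if s = 0 then 1 else 0)"
      have "(p, s') \<in> {p} \<times> I" "(p, s') \<notin> {p} \<times> {s}" by (auto simp: s'_def)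
      moreover have "{p} \<times> {s} \<subseteq> {p} \<times> I" using s(2) by simp
      ultimately have lt': "{p} \<times> {s} \<subset> {p} \<times> I" by blast
      have fs: "\<psi> (shadow ({p} \<times> {s})) face_of D" by (rule face\<psi>[OF kf[OF s(1)]])
      show "aff_dim (\<theta> {p}) < aff_dim (\<psi> (shadow ({p} \<times> {s})))"
        by (rule strict[OF \<theta>face[OF p] fs]) (unfold \<theta>_def, rule psub[OF s(1) FI[OF p] lt'])
      have "\<psi> (shadow ({p} \<times> {s})) \<noteq> D" by (rule nD[OF s(1)]) simp
      then show "aff_dim (\<psi> (shadow ({p} \<times> {s}))) < aff_dim D"
        by (rule face_of_aff_dim_lt[OF polytope_imp_convex[OF polyD] fs])
    qed
    have "aff_dim D \<le> 4" using aff_dim_le_DIM[of D] by simp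
    then have "aff_dim (\<theta> {p}) = 2 \<and> aff_dim D = 4 \<and>
      aff_dim (\<psi> (shadow ({p} \<times> {0}))) = 3 \<and> aff_dim (\<psi> (shadow ({p} \<times> {1}))) = 3"
      using a1 a2 up[OF F01(1)[OF p]] up[OF F01(2)[OF p]] by simp
    moreover have "E \<noteq> {}" "G \<noteq> {}" using lt by auto
    ultimately show ?thesis using E G 1 2 by blast
  qed
  have flag: "\<exists>p. p \<in> F \<and> {p} \<in> \<Sigma> \<and> aff_dim D = 4 \<and> aff_dim (\<theta> {p}) = 2 \<and>
      aff_dim (\<psi> (shadow ({p} \<times> {0}))) = 3 \<and> aff_dim (\<psi> (shadow ({p} \<times> {1}))) = 3 \<and>
      (\<exists>E\<in>\<Sigma>. \<exists>G\<in>\<Sigma>. E \<noteq> {} \<and> G \<noteq> {} \<and> {} \<subset> \<theta> G \<and> \<theta> G \<subset> \<theta> E \<and> \<theta> E \<subset> \<theta> {p})"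
    if F: "F \<in> \<Sigma>" "F \<noteq> {}" for F
  proof -
    obtain p E G where p: "{p} \<in> \<Sigma>" "p \<in> F" "E \<in> \<Sigma>" "G \<in> \<Sigma>" "{p} \<subset> E" "E \<subset> G"
      by (rule surface_flag[OF F])
    from dims[OF p(3,4,1,5,6)] p(1,2) show ?thesis by blast
  qed
  define j0 :: "'p \<Rightarrow> 2" where "j0 = (\<lambda>_. 0)"
  have "sheet j0 \<in> \<Sigma>" using wedge_surface_iff face_of_refl[OF face_of_imp_convex[OF sheet_face]] by blast
  moreover have "sheet j0 \<noteq> {}" using lift_in_sheet[OF zero_in_polygon] by blast
  ultimately obtain p0 where p0: "{p0} \<in> \<Sigma>" "aff_dim D = 4" "aff_dim (\<psi> (shadow ({p0} \<times> {0}))) = 3"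
    "aff_dim (\<psi> (shadow ({p0} \<times> {1}))) = 3" using flag by metis
  define G where "G = \<psi> (shadow ({p0} \<times> {0}))"
  have facet: "\<psi> (shadow ({p} \<times> {s})) facet_of D"
    if "{p} \<times> {s} \<in> prism \<Sigma>" "aff_dim (\<psi> (shadow ({p} \<times> {s}))) = 3" for p s
    using that face\<psi>[OF kf[OF that(1)]] ne[OF that(1)] p0(2) by (simp add: facet_of_def)
  have Gfacet: "G facet_of D" unfolding G_def using facet F01 p0 by blast
  \<comment> \<open>a face of the dual surface lies in two facets, so it also lies in one that differs from the base \<open>G\<close>\<close>
  have distinct: "\<psi> (shadow ({p} \<times> {0})) \<noteq> \<psi> (shadow ({p} \<times> {1}))" if "{p} \<in> \<Sigma>" for p
  proof
    assume "\<psi> (shadow ({p} \<times> {0})) = \<psi> (shadow ({p} \<times> {1}))"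
    then have "{p} \<times> {0::real} \<subseteq> {p} \<times> {1}" using sub[OF F01(1)[OF that] F01(2)[OF that]] by simp
    then show False by auto
  qed
  have other: "\<exists>F. F facet_of D \<and> F \<noteq> G \<and> \<theta> {p} \<subseteq> F"
    if p: "{p} \<in> \<Sigma>" "aff_dim (\<psi> (shadow ({p} \<times> {0}))) = 3" "aff_dim (\<psi> (shadow ({p} \<times> {1}))) = 3" for p
  proof -
    have "\<theta> {p} \<subseteq> \<psi> (shadow ({p} \<times> {0}))" "\<theta> {p} \<subseteq> \<psi> (shadow ({p} \<times> {1}))"
      unfolding \<theta>_def using sub[OF F01(1)[OF p(1)] FI[OF p(1)]] sub[OF F01(2)[OF p(1)] FI[OF p(1)]] by auto
    moreover have "\<psi> (shadow ({p} \<times> {0})) facet_of D" "\<psi> (shadow ({p} \<times> {1})) facet_of D"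
      using facet F01 p by blast+
    ultimately show ?thesis using distinct[OF p(1)] by metis
  qed
  have inner: "\<exists>p. {p} \<in> \<Sigma> \<and> X \<subseteq> \<theta> {p} \<and> aff_dim (\<theta> {p}) = 2 \<and>
      aff_dim (\<psi> (shadow ({p} \<times> {0}))) = 3 \<and> aff_dim (\<psi> (shadow ({p} \<times> {1}))) = 3 \<and>
      (\<exists>E\<in>\<Sigma>. \<exists>G\<in>\<Sigma>. E \<noteq> {} \<and> G \<noteq> {} \<and> {} \<subset> \<theta> G \<and> \<theta> G \<subset> \<theta> E \<and> \<theta> E \<subset> \<theta> {p})" if X: "X \<in> S" for X
  proof (cases "X = {}")
    case True
    obtain p where "{p} \<in> \<Sigma>" "aff_dim (\<theta> {p}) = 2" "aff_dim (\<psi> (shadow ({p} \<times> {0}))) = 3"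
      "aff_dim (\<psi> (shadow ({p} \<times> {1}))) = 3"
      "\<exists>E\<in>\<Sigma>. \<exists>G\<in>\<Sigma>. E \<noteq> {} \<and> G \<noteq> {} \<and> {} \<subset> \<theta> G \<and> \<theta> G \<subset> \<theta> E \<and> \<theta> E \<subset> \<theta> {p}"
      using flag[OF p0(1)] by blast
    then show ?thesis using True by blast
  next
    case False
    then obtain F where F: "F \<in> \<Sigma>" "F \<noteq> {}" "X = \<theta> F" using X by (auto simp: S_def)
    obtain p where p: "p \<in> F" "{p} \<in> \<Sigma>" "aff_dim (\<theta> {p}) = 2" "aff_dim (\<psi> (shadow ({p} \<times> {0}))) = 3"
      "aff_dim (\<psi> (shadow ({p} \<times> {1}))) = 3"
      "\<exists>E\<in>\<Sigma>. \<exists>G\<in>\<Sigma>. E \<noteq> {} \<and> G \<noteq> {} \<and> {} \<subset> \<theta> G \<and> \<theta> G \<subset> \<theta> E \<and> \<theta> E \<subset> \<theta> {p}"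
      using flag[OF F(1,2)] by blast
    then have "X \<subseteq> \<theta> {p}" using \<theta>sub[OF p(2) F(1)] F(3) by simp
    then show ?thesis using p by blast
  qed
  have Sfacet: "\<exists>F. F facet_of D \<and> F \<noteq> G \<and> X \<subseteq> F" if X: "X \<in> S" for X
  proof -
    obtain p where p: "{p} \<in> \<Sigma>" "X \<subseteq> \<theta> {p}" "aff_dim (\<psi> (shadow ({p} \<times> {0}))) = 3" "aff_dim (\<psi> (shadow ({p} \<times> {1}))) = 3"
      using inner[OF X] by blast
    then show ?thesis using other[OF p(1,3,4)] by blast
  qed
  have GS: "G \<notin> S"
  proof
    assume "G \<in> S"
    then obtain p where "G \<subseteq> \<theta> {p}" "aff_dim (\<theta> {p}) = 2" using inner by blast
    then have "aff_dim G \<le> 2" using aff_dim_subset by metis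
    then show False using p0(3) by (simp add: G_def)
  qed
  obtain z and L :: "real^4 \<Rightarrow> real^3" where zL: "beyond_facet D G z" "linear L" "inj_on L (affine hull G)"
    and hinj: "inj_on (L \<circ> schlegel_map G z) (\<Union>S)"
    and hseg: "\<And>X. X \<in> S \<Longrightarrow> segment_map_on X (L \<circ> schlegel_map G z)"
    and hdim: "\<And>X. X \<in> S \<Longrightarrow> aff_dim ((L \<circ> schlegel_map G z) ` X) \<le> aff_dim X"
    by (rule schlegel_complex[OF polyD p0(2) Gfacet, of S], erule Sfacet) (rule that, assumption+)
  define h where "h = L \<circ> schlegel_map G z"
  define K where "K = (`) h ` S"
  note im = polytopal_complex_image[OF Scomplex hinj hseg, folded h_def, folded K_def]
  have KS: "K = (\<lambda>F. L ` schlegel_map G z ` F) ` S" by (simp add: K_def h_def image_comp)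
  have schl: "schlegel_image D S K"
    unfolding schlegel_image_def KS using zL GS by blast
  have hsub: "h ` X \<subseteq> h ` Y \<longleftrightarrow> X \<subseteq> Y" if "X \<in> S" "Y \<in> S" for X Y
    using im(2) that by (simp add: poset_iso_def)
  have hlt: "aff_dim (h ` X) < aff_dim (h ` Y)" if "X \<in> S" "Y \<in> S" "X \<subset> Y" for X Y
  proof -
    have "h ` X \<subset> h ` Y" using hsub[OF that(1,2)] hsub[OF that(2,1)] that(3) by blast
    moreover have "h ` X \<in> K" "h ` Y \<in> K" using that by (auto simp: K_def)
    ultimately have "h ` X face_of h ` Y"
      using im(1) unfolding polytopal_complex_def by (metis inf.absorb1 psubset_imp_subset)
    moreover have "convex (h ` Y)" using im(1) \<open>h ` Y \<in> K\<close> polytope_imp_convex unfolding polytopal_complex_def by blast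
    ultimately show ?thesis using face_of_aff_dim_lt \<open>h ` X \<subset> h ` Y\<close> by blast
  qed
  have \<theta>S: "\<theta> F \<in> S" if "F \<in> \<Sigma>" "F \<noteq> {}" for F using that by (simp add: S_def)
  have pure: "pure_2_dimensional K"
    unfolding pure_2_dimensional_def
  proof
    fix Y assume "Y \<in> K"
    then obtain X where X: "X \<in> S" "Y = h ` X" by (auto simp: K_def)
    obtain p E G' where p: "{p} \<in> \<Sigma>" "X \<subseteq> \<theta> {p}" "aff_dim (\<theta> {p}) = 2"
      and EG: "E \<in> \<Sigma>" "G' \<in> \<Sigma>" "E \<noteq> {}" "G' \<noteq> {}" "{} \<subset> \<theta> G'" "\<theta> G' \<subset> \<theta> E" "\<theta> E \<subset> \<theta> {p}"
      using inner[OF X(1)] by blast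
    have S4: "{} \<in> S" "\<theta> G' \<in> S" "\<theta> E \<in> S" "\<theta> {p} \<in> S"
      using \<theta>S p(1) EG by (auto simp: S_def)
    have "aff_dim (h ` {}) < aff_dim (h ` \<theta> G')" by (rule hlt[OF S4(1,2) EG(5)])
    moreover have "aff_dim (h ` \<theta> G') < aff_dim (h ` \<theta> E)" by (rule hlt[OF S4(2,3) EG(6)])
    moreover have "aff_dim (h ` \<theta> E) < aff_dim (h ` \<theta> {p})" by (rule hlt[OF S4(3,4) EG(7)])
    moreover have "aff_dim (h ` \<theta> {p}) \<le> 2" using hdim[OF S4(4)] p(3) by (simp add: h_def)
    ultimately have "aff_dim (h ` \<theta> {p}) = 2" by simp
    moreover have "h ` \<theta> {p} \<in> K" using S4 by (simp add: K_def)
    ultimately show "\<exists>G\<in>K. Y \<subseteq> G \<and> aff_dim G = 2" using X p(2) by blast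
  qed
  have iso1: "poset_iso (\<Sigma> - {{}}) (\<supseteq>) (S - {{}}) (\<subseteq>) \<theta>"
  proof -
    have "S - {{}} = \<theta> ` (\<Sigma> - {{}})" using \<theta>ne by (auto simp: S_def)
    moreover have "poset_iso (\<Sigma> - {{}}) (\<supseteq>) (\<theta> ` (\<Sigma> - {{}})) (\<subseteq>) \<theta>"
      by (rule poset_iso_supset_image) (use \<theta>sub in blast)
    ultimately show ?thesis by simp
  qed
  have iso2: "poset_iso (S - {{}}) (\<subseteq>) (K - {{}}) (\<subseteq>) ((`) h)"
  proof -
    have "K - {{}} = (`) h ` (S - {{}})" by (auto simp: K_def)
    moreover have "poset_iso (S - {{}}) (\<subseteq>) ((`) h ` (S - {{}})) (\<subseteq>) ((`) h)"
      by (rule poset_iso_subset_image) (use hsub in blast)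
    ultimately show ?thesis by simp
  qed
  have "subcomplex_of S (boundary_complex D)"
    unfolding subcomplex_of_def boundary_complex_def
  proof (intro conjI ballI allI impI subsetI CollectI)
    fix X assume X: "X \<in> S"
    show "X face_of D" by (rule Sface[OF X])
    show "X \<noteq> D"
    proof
      assume "X = D"
      then have "aff_dim X = 4" using p0(2) by simp
      moreover obtain p where "X \<subseteq> \<theta> {p}" "aff_dim (\<theta> {p}) = 2" using inner[OF X] by blast
      then have "aff_dim X \<le> 2" using aff_dim_subset by metis
      ultimately show False by simp
    qed
  next
    show "Y \<in> S" if "X \<in> S" "Y face_of X" for X Y using Sclosed that by blast
  qed
  moreover have "has_dual_face_poset \<Sigma> S" using iso1 unfolding has_dual_face_poset_def by blast
  moreover have "has_dual_face_poset \<Sigma> K"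
    using poset_iso_comp[OF iso1 iso2] unfolding has_dual_face_poset_def by blast
  ultimately show ?thesis using schl im(1) pure by blast
qed

end

theorem theorem4p6:
  fixes a :: "'p::finite \<Rightarrow> real^2" and b :: "2 \<Rightarrow> real" and e :: "nat \<Rightarrow> 'p"
  assumes "CARD('p) \<ge> 3"
    and "facet_description a"
    and "cyclically_labeled a e"
    and "facet_description b"
  shows "\<exists>(Q :: (real^('p + 3)) set) \<phi> (f :: 4 \<Rightarrow> 'p + 3) (g :: 3 \<Rightarrow> 4).
      polytope Q \<and>
      face_lattice_iso (wedge_product a b \<times> {0..1::real}) Q \<phi> \<and>
      inj f \<and> inj g \<and>
      (\<forall>F \<in> prism (wedge_surface a b) - {{}}. preserved (coord_proj f) Q (\<phi> F)) \<and>
      (let \<rho> = (\<lambda>F. coord_proj g ` coord_proj f ` \<phi> F);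
           K = \<rho> ` prism (wedge_surface a b)
       in polytopal_complex K \<and> poset_iso (prism (wedge_surface a b)) (\<subseteq>) K (\<subseteq>) \<rho>) \<and>
      (\<exists>D :: (real^4) set. dual_polytope (coord_proj f ` Q) D) \<and>
      (\<forall>D :: (real^4) set. dual_polytope (coord_proj f ` Q) D \<longrightarrow>
         (\<exists>S K. subcomplex_of S (boundary_complex D) \<and>
                has_dual_face_poset (wedge_surface a b) S \<and>
                schlegel_image D S K \<and>
                polytopal_complex K \<and> pure_2_dimensional K \<and>
                has_dual_face_poset (wedge_surface a b) K))"
proof -
  interpret wedge_data a b e
    using assms by unfold_locales (simp_all add: cyclically_labeled_def)
  obtain \<delta> where \<delta>: "\<delta> > 0" "patterns (rows \<delta>) (\<lambda>_. 1) = patterns (rows 0) prism_rhs"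
    "simple_system (rows \<delta>) (\<lambda>_. 1)" "bounded (polyh (rows \<delta>) (\<lambda>_. 1))"
    by (rule deformation_exists)
  interpret deformed_prism a b e \<delta> by unfold_locales (fact \<delta>)+
  show ?thesis
    unfolding Let_def
    by (rule exI[of _ "embed ` deformed"], rule exI[of _ realized_face], rule exI[of _ keep4], rule exI[of _ drop4])
      (intro conjI ballI allI impI polytope_embedded realized_face_iso inj_keep4 inj_drop4 preserved_realized_face
        prism_image_complex dual_exists dual_surface; assumption)
qed

end
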